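(* Let $q$ be a power of a prime $p>2$, let $A=\mathbb{F}_q[t]$, $k=\mathbb{F}_q(t)$, let $\alpha\in A$ be a square-free polynomial which is of odd degree or whose leading coefficient is not a square in $\mathbb{F}_q$, let $K=k(\sqrt{\alpha})$ (so $\mathrm{char}(K)=p>2$) and let $\mathbb{A}=A+A\sqrt{\alpha}$ be the integral closure of $A$ in $K$. Let $Q,N\in\mathbb{N}$ and let $(a_g)_{g\in\mathbb{A}}$ be any sequence of complex numbers. Then $$ \sum_{\substack{f\in \mathbb{A}\setminus\{0\}\\ \mathbf{N}(f)= q^Q}} \ \sum_{\substack{r \bmod f^2\\ (r,f)=1}} \left|\sum_{g \in \mathbf{B}(0, N)\cap \mathbb{A}} a_g \cdot e\left(\mathbf{Tr}\left(\frac{gr}{2\sqrt{\alpha}f^2}\right)\right)\right|^2 \ll \left(q^{3Q}+2^{(N-Q)/2}\left(q^{Q/2+N}+q^{2Q+N/2}\right)\right) \sum_{g \in \mathbf{B}(0, N)\cap \mathbb{A}} |a_g|^2, $$ where the implied constant depends only on $q$ and $\deg(\alpha)$.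
   Context: Let $\mathrm{Tr}:\mathbb{F}_q\to\mathbb{F}_p$ be the trace map. Let $k_\infty=\mathbb{F}_q((1/t))$ be the completion of $k$ at $\infty$, with absolute value $|\sum_{i=-\infty}^n a_it^i|_\infty=q^n$ if $a_n\neq 0$ (and $|0|_\infty=0$). Define $E:\mathbb{F}_q\to\mathbb{C}^\times$ by $E(x)=\exp\left(\frac{2\pi i}{p}\mathrm{Tr}(x)\right)$ and the additive character $e:k_\infty\to\mathbb{C}^\times$ by $e\left(\sum_{i=-\infty}^n a_it^i\right)=E(a_{-1})$. $\mathbf{Tr}:K\to k$ is the field trace, $\mathbf{Tr}(a+b\sqrt{\alpha})=2a$ for $a,b\in k$. Under the assumptions on $\alpha$ there is a single place of $K$ above $\infty$; $K_\infty$ denotes the completion of $K$ at it, and the absolute value of $k_\infty$ extends uniquely to an absolute value $|\cdot|_\infty$ on $K_\infty$. For $f\in K_\infty$ put $\mathbf{N}(f)=|f|_\infty^2$; thus for nonzero $f=a+b\sqrt{\alpha}\in\mathbb{A}$ with $a,b\in A$, $\mathbf{N}(f)=q^{\deg(a^2-b^2\alpha)}$. For $f\in K_\infty$ and $N\in\mathbb{R}$, $\mathbf{B}(f,N)=\{g\in K_\infty:\mathbf{N}(g-f)\le q^N\}$. The sum over $r \bmod f^2$ with $(r,f)=1$ runs over representatives $r\in\mathbb{A}$ of the residue classes in $\mathbb{A}/(f^2)$ with $r\mathbb{A}+f\mathbb{A}=\mathbb{A}$; the summand does not depend on the choice of representatives. *)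

theory Defs
  imports
    Complex_Main
    "HOL-Library.Cardinality"
    "HOL-Computational_Algebra.Computational_Algebra"
    "HOL-Algebra.QuotRing"
begin

text \<open>
  Throughout, \<open>'a\<close> is the finite field of \<open>q = CARD('a) = p ^ n\<close> elements, \<open>'a poly\<close> is
  \<open>A\<close>, \<open>'a poly fract\<close> is \<open>k\<close>, and \<open>'a fls\<close> is the field of formal Laurent series in the
  variable \<open>1/t\<close>, i.e. the completion of \<open>k\<close> at infinity: the coefficient of \<open>t ^ i\<close>
  is \<open>fls_nth x (- i)\<close>, and \<open>t\<close> itself is \<open>fls_X_inv\<close>.
\<close>

section \<open>The completion of the rational function field at infinity\<close>

definition poly_to_kinf :: "'a::field poly \<Rightarrow> 'a fls" where
  "poly_to_kinf f = poly (map_poly fls_const f) fls_X_inv"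

lemma poly_to_kinf_0 [simp]: "poly_to_kinf 0 = 0"
  by (simp add: poly_to_kinf_def)

lemma poly_to_kinf_pCons [simp]:
  "poly_to_kinf (pCons c f) = fls_const c + fls_X_inv * poly_to_kinf f"
  by (simp add: poly_to_kinf_def map_poly_pCons)

lemma poly_to_kinf_1 [simp]: "poly_to_kinf 1 = 1"
  by (simp add: one_pCons)

lemma poly_to_kinf_add: "poly_to_kinf (f + g) = poly_to_kinf f + poly_to_kinf g"
  by (induction f g rule: poly_induct2) (simp_all add: algebra_simps fls_plus_const[symmetric])

lemma poly_to_kinf_smult: "poly_to_kinf (smult c f) = fls_const c * poly_to_kinf f"
  by (induction f) (simp_all add: algebra_simps)

lemma poly_to_kinf_mult: "poly_to_kinf (f * g) = poly_to_kinf f * poly_to_kinf g"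
  by (induction f) (simp_all add: poly_to_kinf_add poly_to_kinf_smult algebra_simps)

lemma fls_nth_poly_to_kinf:
  "fls_nth (poly_to_kinf f) i = (if i \<le> 0 then coeff f (nat (- i)) else 0)"
proof (induction f arbitrary: i)
  case (pCons c f)
  have "fls_nth (fls_X_inv * poly_to_kinf f) i = fls_nth (poly_to_kinf f) (i + 1)"
    using fls_X_inv_times_conv_shift(1)[of "poly_to_kinf f"] by simp
  moreover have "nat (- i) = Suc (nat (- (i + 1)))" if "i < 0"
    using that by simp
  ultimately show ?case
    using pCons.IH[of "i + 1"] by (auto simp: coeff_pCons split: nat.splits)
qed simp

lemma poly_to_kinf_eq_0_iff [simp]: "poly_to_kinf f = 0 \<longleftrightarrow> f = 0"
proof
  assume "poly_to_kinf f = 0"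
  then have "coeff f j = 0" for j
    using fls_nth_poly_to_kinf[of f "- int j"] by simp
  then show "f = 0"
    by (simp add: poly_eq_iff)
qed simp

definition k_to_kinf :: "'a::field poly fract \<Rightarrow> 'a fls" where
  "k_to_kinf x =
     (THE y. \<exists>f g. g \<noteq> 0 \<and> x = Fract f g \<and> y = poly_to_kinf f / poly_to_kinf g)"

lemma k_to_kinf_Fract:
  assumes "g \<noteq> 0"
  shows "k_to_kinf (Fract f g) = poly_to_kinf f / poly_to_kinf g"
  unfolding k_to_kinf_def
proof (rule the_equality)
  fix y assume "\<exists>f' g'. g' \<noteq> 0 \<and> Fract f g = Fract f' g' \<and> y = poly_to_kinf f' / poly_to_kinf g'"
  then obtain f' g' where *: "g' \<noteq> 0" "Fract f g = Fract f' g'"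
      "y = poly_to_kinf f' / poly_to_kinf g'"
    by blast
  then have "f * g' = f' * g"
    using assms by (simp add: eq_fract)
  then have "poly_to_kinf f * poly_to_kinf g' = poly_to_kinf f' * poly_to_kinf g"
    by (metis poly_to_kinf_mult)
  then show "y = poly_to_kinf f / poly_to_kinf g"
    using * assms by (simp add: frac_eq_eq)
qed (use assms in blast)

lemma k_to_kinf_to_fract [simp]: "k_to_kinf (to_fract f) = poly_to_kinf f"
  by (simp add: to_fract_def k_to_kinf_Fract)

definition abs_kinf :: "'a::field fls \<Rightarrow> real" where
  "abs_kinf x = (if x = 0 then 0 else real CARD('a) powi (- fls_subdegree x))"

lemma abs_kinf_poly:
  fixes f :: "'a::field poly"
  assumes "f \<noteq> 0"
  shows "abs_kinf (poly_to_kinf f) = real CARD('a) ^ degree f"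
proof -
  have "fls_subdegree (poly_to_kinf f) = - int (degree f)"
    using assms by (intro fls_subdegree_eqI) (auto simp: fls_nth_poly_to_kinf coeff_eq_0)
  with assms show ?thesis
    by (simp add: abs_kinf_def)
qed


section \<open>Additive characters\<close>

text \<open>The trace from the field of \<open>p ^ n\<close> elements to its prime field.\<close>

definition prime_field_trace :: "nat \<Rightarrow> nat \<Rightarrow> 'a::field \<Rightarrow> 'a" where
  "prime_field_trace p n x = (\<Sum>i<n. x ^ (p ^ i))"

lemma CHAR_eq:
  assumes "prime p" and "CARD('a::finite_field) = p ^ n"
  shows "CHAR('a) = p"
proof -
  have "CHAR('a) dvd p ^ n"
  proof -
    have "(\<Sum>x\<in>UNIV. x + 1) = (\<Sum>x\<in>UNIV. x :: 'a)"
      by (rule sum.reindex_bij_witness[of _ "\<lambda>x. x - 1" "\<lambda>x. x + 1"]) auto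
    then have "of_nat CARD('a) = (0 :: 'a)"
      by (simp add: sum.distrib)
    then show ?thesis
      by (simp only: of_nat_eq_0_iff_char_dvd assms(2))
  qed
  moreover have "prime (CHAR('a))"
    by (rule prime_CHAR_semidom) (rule CHAR_pos)
  ultimately show ?thesis
    using assms(1) by (metis prime_dvd_power primes_dvd_imp_eq)
qed

lemma prime_field_trace_in_prime_field:
  fixes x :: "'a::finite_field"
  assumes p: "prime p" and q: "CARD('a) = p ^ n"
  shows "\<exists>!m. m < p \<and> of_nat m = prime_field_trace p n x"
proof -
  have ch: "CHAR('a) = p" using CHAR_eq[OF p q] .
  have frob: "prime_field_trace p n x ^ p = prime_field_trace p n x"
  proof -
    have "prime_field_trace p n x ^ p = (\<Sum>i<n. (x ^ (p ^ i)) ^ p)"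
      unfolding prime_field_trace_def using p ch by (intro freshmans_dream_sum) auto
    also have "\<dots> = (\<Sum>i<n. x ^ (p ^ Suc i))"
      by (simp add: power_mult[symmetric] mult.commute)
    also have "x + \<dots> = prime_field_trace p n x + x ^ (p ^ n)"
      using sum.lessThan_Suc_shift[of "\<lambda>i. x ^ (p ^ i)" n]
      by (simp add: prime_field_trace_def)
    finally show ?thesis
      using finite_field_power_card_eq_same[of x] q by (simp add: add.commute)
  qed
  have inj: "inj_on (of_nat :: nat \<Rightarrow> 'a) {..<p}"
  proof (rule linorder_inj_onI)
    fix i j :: nat assume "i < j" "i \<in> {..<p}" "j \<in> {..<p}"
    then have "\<not> p dvd j - i"
      by (auto dest: dvd_imp_le)
    then have "of_nat (j - i) \<noteq> (0 :: 'a)"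
      by (simp only: of_nat_eq_0_iff_char_dvd ch not_False_eq_True)
    with \<open>i < j\<close> show "of_nat i \<noteq> (of_nat j :: 'a)"
      by (simp add: of_nat_diff)
  qed auto
  define P where "P = (monom 1 p - monom 1 1 :: 'a poly)"
  have p2: "p > 1" using p by (rule prime_gt_1_nat)
  have "coeff P p = 1" using p2 by (simp add: P_def)
  then have P0: "P \<noteq> 0" by auto
  have "degree P \<le> p"
    unfolding P_def using p2 by (intro degree_diff_le) (auto intro: order.trans[OF degree_monom_le])
  then have le: "card {y. poly P y = 0} \<le> p"
    using card_poly_roots_bound[OF P0] by simp
  have "of_nat m ^ p = (of_nat m :: 'a)" for m
    using p p2 ch by (induction m) (simp_all add: freshmans_dream)
  then have sub: "of_nat ` {..<p} \<subseteq> {y. poly P y = 0}"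
    by (auto simp: P_def poly_monom)
  have "of_nat ` {..<p} = {y. poly P y = 0}"
    using le inj by (intro card_seteq[OF poly_roots_finite[OF P0] sub]) (simp add: card_image)
  moreover have "prime_field_trace p n x \<in> {y. poly P y = 0}"
    using frob by (simp add: P_def poly_monom)
  ultimately have "\<exists>m<p. of_nat m = prime_field_trace p n x"
    by (metis imageE lessThan_iff)
  then show ?thesis
    using inj by (auto simp: inj_on_def)
qed

text \<open>
  The element \<open>prime_field_trace p n x\<close> of the prime field is identified with the residue
  \<open>m < p\<close> it is the image of.
\<close>

definition char_Fq :: "nat \<Rightarrow> nat \<Rightarrow> 'a::field \<Rightarrow> complex" where
  "char_Fq p n x =
     exp (2 * of_real pi * \<i> / of_nat p *
          of_nat (THE m. m < p \<and> of_nat m = prime_field_trace p n x))"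

definition char_kinf :: "nat \<Rightarrow> nat \<Rightarrow> 'a::field fls \<Rightarrow> complex" where
  "char_kinf p n x = char_Fq p n (fls_nth x 1)"


section \<open>Quadratic extensions\<close>

text \<open>
  The ring obtained from the field \<open>'b\<close> by adjoining a square root of \<open>D\<close>; the pair
  \<open>(a, b)\<close> stands for \<open>a + b * sqrt D\<close>. It is a field if \<open>D\<close> is not a square.
\<close>

definition quad_ext :: "'b::field \<Rightarrow> ('b \<times> 'b) ring" where
  "quad_ext D =
     \<lparr>carrier = UNIV,
      mult = (\<lambda>(a, b) (c, d). (a * c + b * d * D, a * d + b * c)),
      one = (1, 0),
      zero = (0, 0),
      add = (\<lambda>(a, b) (c, d). (a + c, b + d))\<rparr>"

lemma quad_ext_simps [simp]:
  "carrier (quad_ext D) = UNIV"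
  "(a, b) \<otimes>\<^bsub>quad_ext D\<^esub> (c, d) = (a * c + b * d * D, a * d + b * c)"
  "\<one>\<^bsub>quad_ext D\<^esub> = (1, 0)"
  "\<zero>\<^bsub>quad_ext D\<^esub> = (0, 0)"
  "(a, b) \<oplus>\<^bsub>quad_ext D\<^esub> (c, d) = (a + c, b + d)"
  by (simp_all add: quad_ext_def)

lemma cring_quad_ext: "cring (quad_ext D)"
proof (rule cringI)
  show "abelian_group (quad_ext D)"
  proof (rule abelian_groupI)
    fix x assume "x \<in> carrier (quad_ext D)"
    show "\<exists>y\<in>carrier (quad_ext D). y \<oplus>\<^bsub>quad_ext D\<^esub> x = \<zero>\<^bsub>quad_ext D\<^esub>"
      by (intro bexI[of _ "(- fst x, - snd x)"]) (cases x, simp_all)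
  qed (auto simp: algebra_simps)
  show "Group.comm_monoid (quad_ext D)"
    by (rule comm_monoidI) (auto simp: algebra_simps)
qed (auto simp: algebra_simps)

lemma quad_norm_nonzero:
  fixes D :: "'b::field"
  assumes "\<nexists>c. D = c ^ 2" and "(a, b) \<noteq> (0, 0)"
  shows "a ^ 2 - b ^ 2 * D \<noteq> 0"
proof
  assume *: "a ^ 2 - b ^ 2 * D = 0"
  show False
  proof (cases "b = 0")
    case False
    with * have "D = (a / b) ^ 2"
      by (simp add: field_simps power2_eq_square)
    with assms(1) show False by blast
  qed (use * assms(2) in auto)
qed

lemma field_quad_ext:
  fixes D :: "'b::field"
  assumes "\<nexists>c. D = c ^ 2"
  shows "Ring.field (quad_ext D)"
proof (rule cring.cring_fieldI2[OF cring_quad_ext])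
  fix x assume "x \<noteq> \<zero>\<^bsub>quad_ext D\<^esub>"
  obtain a b where x: "x = (a, b)" by fastforce
  define m where "m = a ^ 2 - b ^ 2 * D"
  have m: "m \<noteq> 0"
    using quad_norm_nonzero[OF assms, of a b] \<open>x \<noteq> _\<close> x by (simp add: m_def)
  have "a * (a / m) + b * (- b / m) * D = (a ^ 2 - b ^ 2 * D) / m"
    by (simp add: power2_eq_square diff_divide_distrib)
  also have "\<dots> = 1"
    using m by (simp add: m_def)
  finally have "x \<otimes>\<^bsub>quad_ext D\<^esub> (a / m, - b / m) = \<one>\<^bsub>quad_ext D\<^esub>"
    by (simp add: x)
  then show "\<exists>y\<in>carrier (quad_ext D). x \<otimes>\<^bsub>quad_ext D\<^esub> y = \<one>\<^bsub>quad_ext D\<^esub>"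
    by auto
qed simp

definition quad_trace :: "'b \<times> 'b \<Rightarrow> 'b::field" where
  "quad_trace x = 2 * fst x"

definition quad_sqrt :: "'b::field \<times> 'b" where
  "quad_sqrt = (0, 1)"

abbreviation K :: "'a::field poly \<Rightarrow> ('a poly fract \<times> 'a poly fract) ring" where
  "K \<alpha> \<equiv> quad_ext (to_fract \<alpha>)"

text \<open>
  If \<open>\<alpha>\<close> has odd degree or a leading coefficient that is not a square, then \<open>\<alpha>\<close> is not a
  square in the completion of \<open>k\<close>, so that the completion of \<open>K\<close> at its place above
  infinity is obtained by adjoining a square root of \<open>\<alpha>\<close> there.
\<close>

abbreviation Kinf :: "'a::field poly \<Rightarrow> ('a fls \<times> 'a fls) ring" where
  "Kinf \<alpha> \<equiv> quad_ext (poly_to_kinf \<alpha>)"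

definition K_to_Kinf :: "'a::field poly fract \<times> 'a poly fract \<Rightarrow> 'a fls \<times> 'a fls" where
  "K_to_Kinf x = (k_to_kinf (fst x), k_to_kinf (snd x))"

definition K_integers :: "'a::field poly \<Rightarrow> ('a poly fract \<times> 'a poly fract) ring" where
  "K_integers \<alpha> = (K \<alpha>)\<lparr>carrier := {(to_fract a, to_fract b) | a b. True}\<rparr>"


section \<open>The absolute value on the completion of the quadratic extension\<close>

definition is_absolute_value :: "('b, 'm) ring_scheme \<Rightarrow> ('b \<Rightarrow> real) \<Rightarrow> bool" where
  "is_absolute_value R v \<longleftrightarrow>
     (\<forall>x\<in>carrier R. v x \<ge> 0 \<and> (v x = 0 \<longleftrightarrow> x = \<zero>\<^bsub>R\<^esub>)) \<and>
     (\<forall>x\<in>carrier R. \<forall>y\<in>carrier R. v (x \<otimes>\<^bsub>R\<^esub> y) = v x * v y \<and> v (x \<oplus>\<^bsub>R\<^esub> y) \<le> v x + v y)"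

text \<open>Existence and uniqueness: see \<open>is_absolute_value_Kinf\<close> and \<open>abs_Kinf_unique\<close> below.\<close>

definition abs_Kinf :: "'a::field poly \<Rightarrow> 'a fls \<times> 'a fls \<Rightarrow> real" where
  "abs_Kinf \<alpha> = (THE v. is_absolute_value (Kinf \<alpha>) v \<and> (\<forall>x. v (x, 0) = abs_kinf x))"

lemma abs_kinf_eq_0_iff [simp]: "abs_kinf (x :: 'a::finite_field fls) = 0 \<longleftrightarrow> x = 0"
  by (simp add: abs_kinf_def)

lemma abs_kinf_nonneg [simp]: "abs_kinf x \<ge> 0"
  by (simp add: abs_kinf_def)

lemma abs_kinf_mult: "abs_kinf (x * y) = abs_kinf x * abs_kinf (y :: 'a::finite_field fls)"
proof (cases "x = 0 \<or> y = 0")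
  case False
  then show ?thesis
    by (simp add: abs_kinf_def power_int_add[symmetric] add.commute)
qed (auto simp: abs_kinf_def)

lemma abs_kinf_power: "abs_kinf (x ^ j) = abs_kinf (x :: 'a::finite_field fls) ^ j"
  by (induction j) (simp_all add: abs_kinf_mult, simp add: abs_kinf_def)

lemma abs_kinf_minus [simp]: "abs_kinf (- x) = abs_kinf x"
  by (simp add: abs_kinf_def)

lemma one_le_CARD: "real CARD('a::finite_field) \<ge> 1"
  by (simp add: Suc_leI)

lemma abs_kinf_add_le: "abs_kinf (x + y) \<le> max (abs_kinf x) (abs_kinf (y :: 'a::finite_field fls))"
proof (cases "x = 0 \<or> y = 0 \<or> x + y = 0")
  case False
  then have "min (fls_subdegree x) (fls_subdegree y) \<le> fls_subdegree (x + y)"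
    by (intro fls_plus_subdegree) auto
  then have "fls_subdegree x \<le> fls_subdegree (x + y) \<or> fls_subdegree y \<le> fls_subdegree (x + y)"
    by linarith
  then show ?thesis
    using False one_le_CARD[where 'a = 'a]
    by (auto simp: abs_kinf_def le_max_iff_disj intro!: power_int_increasing)
next
  case True
  then show ?thesis
    using abs_kinf_nonneg[of x] by (auto simp: abs_kinf_def[of 0] le_max_iff_disj)
qed

text \<open>No cancellation occurs between the two terms of a norm.\<close>

lemma abs_kinf_quad_norm:
  fixes \<alpha> :: "'a::finite_field poly"
  assumes "\<alpha> \<noteq> 0" and "odd (degree \<alpha>) \<or> (\<nexists>c. lead_coeff \<alpha> = c ^ 2)"
  shows "abs_kinf (a ^ 2 - b ^ 2 * poly_to_kinf \<alpha>) =
         max (abs_kinf a ^ 2) (abs_kinf b ^ 2 * abs_kinf (poly_to_kinf \<alpha>))"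
proof (cases "a = 0 \<or> b = 0")
  case True
  then show ?thesis
    by (auto simp: abs_kinf_power abs_kinf_mult abs_kinf_def[of 0])
next
  case False
  define D where "D = poly_to_kinf \<alpha>"
  have D0: "D \<noteq> 0" using assms(1) by (simp add: D_def)
  have sD: "fls_subdegree D = - int (degree \<alpha>)"
    using assms(1) unfolding D_def
    by (intro fls_subdegree_eqI) (auto simp: fls_nth_poly_to_kinf coeff_eq_0)
  have sa: "fls_subdegree (a ^ 2) = 2 * fls_subdegree a"
    by (simp add: fls_subdegree_pow)
  have sb: "fls_subdegree (b ^ 2 * D) = 2 * fls_subdegree b + fls_subdegree D"
    using False D0 by (simp add: fls_subdegree_pow)
  have ge: "abs_kinf (a ^ 2 - b ^ 2 * D) \<le> max (abs_kinf (a ^ 2)) (abs_kinf (b ^ 2 * D))"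
    using abs_kinf_add_le[of "a ^ 2" "- (b ^ 2 * D)"] by simp
  have nz: "a ^ 2 \<noteq> 0" "b ^ 2 * D \<noteq> 0"
    using False D0 by simp_all
  have "abs_kinf (a ^ 2 - b ^ 2 * D) = max (abs_kinf (a ^ 2)) (abs_kinf (b ^ 2 * D))"
  proof (rule antisym[OF ge])
    define m where "m = min (fls_subdegree (a ^ 2)) (fls_subdegree (b ^ 2 * D))"
    have "fls_nth (a ^ 2 - b ^ 2 * D) m \<noteq> 0"
    proof (cases "fls_subdegree (a ^ 2) = fls_subdegree (b ^ 2 * D)")
      case neq: False
      then consider "m = fls_subdegree (a ^ 2)" "m < fls_subdegree (b ^ 2 * D)"
        | "m = fls_subdegree (b ^ 2 * D)" "m < fls_subdegree (a ^ 2)"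
        unfolding m_def by linarith
      then show ?thesis
        using nz nth_fls_subdegree_nonzero[OF nz(1)] nth_fls_subdegree_nonzero[OF nz(2)]
        by cases auto
    next
      case eq: True
      then have "2 * fls_subdegree a = 2 * fls_subdegree b - int (degree \<alpha>)"
        using sa sb sD by simp
      then have "even (degree \<alpha>)" by presburger
      with assms(2) have ns: "\<nexists>c. lead_coeff \<alpha> = c ^ 2" by blast
      define u where "u = fls_nth a (fls_subdegree a)"
      define w where "w = fls_nth b (fls_subdegree b)"
      have u: "fls_nth (a ^ 2) m = u ^ 2"
        using eq sa fls_times_base[of a a] by (simp add: m_def u_def power2_eq_square)
      have bb: "fls_nth (b ^ 2) (fls_subdegree (b ^ 2)) = w ^ 2"
        using False
        using fls_times_base[of b b] by (simp add: w_def power2_eq_square)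
      have Dl: "fls_nth D (fls_subdegree D) = lead_coeff \<alpha>"
        by (simp add: sD) (simp add: D_def fls_nth_poly_to_kinf)
      have "m = fls_subdegree (b ^ 2) + fls_subdegree D"
        using eq nz by (simp add: m_def)
      then have w: "fls_nth (b ^ 2 * D) m = w ^ 2 * lead_coeff \<alpha>"
        using fls_times_base[of "b ^ 2" D] bb Dl by simp
      have "w \<noteq> 0"
        using False by (simp add: w_def)
      have "u ^ 2 \<noteq> w ^ 2 * lead_coeff \<alpha>"
      proof
        assume "u ^ 2 = w ^ 2 * lead_coeff \<alpha>"
        with \<open>w \<noteq> 0\<close> have "lead_coeff \<alpha> = (u / w) ^ 2"
          by (simp add: field_simps)
        with ns show False by blast
      qed
      then show ?thesis
        by (simp add: u w)
    qed
    then have nz': "a ^ 2 - b ^ 2 * D \<noteq> 0" and le: "fls_subdegree (a ^ 2 - b ^ 2 * D) \<le> m"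
      by (auto intro: fls_subdegree_leI)
    show "max (abs_kinf (a ^ 2)) (abs_kinf (b ^ 2 * D)) \<le> abs_kinf (a ^ 2 - b ^ 2 * D)"
      unfolding max.bounded_iff abs_kinf_def
      using nz nz' le one_le_CARD[where 'a = 'a]
      by (auto simp: m_def intro!: power_int_increasing simp del: fls_subdegree_mult)
  qed
  then show ?thesis
    by (simp add: D_def abs_kinf_power abs_kinf_mult)
qed

context
  fixes \<alpha> :: "'a::finite_field poly"
  assumes \<alpha>_nz: "\<alpha> \<noteq> 0" and \<alpha>_nonsq: "odd (degree \<alpha>) \<or> (\<nexists>c. lead_coeff \<alpha> = c ^ 2)"
begin

lemma is_absolute_value_Kinf:
  "is_absolute_value (Kinf \<alpha>) (\<lambda>(a, b). sqrt (abs_kinf (a ^ 2 - b ^ 2 * poly_to_kinf \<alpha>)))"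
proof -
  define D where "D = poly_to_kinf \<alpha>"
  define w where "w = (\<lambda>(a, b). sqrt (abs_kinf (a ^ 2 - b ^ 2 * D)))"
  have w_max: "w (a, b) = max (abs_kinf a) (abs_kinf b * sqrt (abs_kinf D))" for a b
  proof -
    have "sqrt (max x y) = max (sqrt x) (sqrt y)" for x y
      by (auto simp: max_def)
    then show ?thesis
      unfolding w_def D_def
      by (simp add: abs_kinf_quad_norm[OF \<alpha>_nz \<alpha>_nonsq] real_sqrt_mult)
  qed
  have D0: "abs_kinf D > 0"
    using \<alpha>_nz by (simp add: D_def less_le)
  have "w (a, b) = 0 \<longleftrightarrow> a = 0 \<and> b = 0" for a b
  proof -
    have "abs_kinf a \<ge> 0" "abs_kinf b * sqrt (abs_kinf D) \<ge> 0"
      by simp_all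
    then have "w (a, b) = 0 \<longleftrightarrow> abs_kinf a = 0 \<and> abs_kinf b * sqrt (abs_kinf D) = 0"
      unfolding w_max by linarith
    then show ?thesis
      using D0 by (cases "D = 0") (auto simp: abs_kinf_def[of 0])
  qed
  moreover have "w (a, b) \<ge> 0" for a b
    by (simp add: w_def)
  moreover have "w (a * c + b * d * D, a * d + b * c) = w (a, b) * w (c, d)" for a b c d
  proof -
    have "(a * c + b * d * D) ^ 2 - (a * d + b * c) ^ 2 * D =
          (a ^ 2 - b ^ 2 * D) * (c ^ 2 - d ^ 2 * D)"
      by (simp add: power2_eq_square algebra_simps)
    then show ?thesis
      by (simp add: w_def abs_kinf_mult real_sqrt_mult)
  qed
  moreover have "w (a + c, b + d) \<le> w (a, b) + w (c, d)" for a b c d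
  proof -
    have "abs_kinf (a + c) \<le> max (abs_kinf a) (abs_kinf c)"
      "abs_kinf (b + d) * sqrt (abs_kinf D) \<le> max (abs_kinf b) (abs_kinf d) * sqrt (abs_kinf D)"
      by (auto intro: abs_kinf_add_le mult_right_mono)
    moreover have "max (abs_kinf b) (abs_kinf d) * sqrt (abs_kinf D) =
        max (abs_kinf b * sqrt (abs_kinf D)) (abs_kinf d * sqrt (abs_kinf D))"
      by (simp add: max_mult_distrib_right)
    moreover have "abs_kinf a \<ge> 0" "abs_kinf c \<ge> 0"
      "abs_kinf b * sqrt (abs_kinf D) \<ge> 0" "abs_kinf d * sqrt (abs_kinf D) \<ge> 0"
      by simp_all
    ultimately show ?thesis
      unfolding w_max by linarith
  qed
  ultimately have "is_absolute_value (Kinf \<alpha>) w"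
    unfolding is_absolute_value_def
    by (auto simp: D_def)
  then show ?thesis
    by (simp add: w_def D_def)
qed

lemma abs_Kinf_unique:
  assumes v: "is_absolute_value (Kinf \<alpha>) v" and ext: "\<And>x. v (x, 0) = abs_kinf x"
  shows "v (a, b) = sqrt (abs_kinf (a ^ 2 - b ^ 2 * poly_to_kinf \<alpha>))"
proof -
  define D where "D = poly_to_kinf \<alpha>"
  define w where "w = (\<lambda>(a, b). sqrt (abs_kinf (a ^ 2 - b ^ 2 * D)))"
  have v_mult: "v ((a, b) \<otimes>\<^bsub>Kinf \<alpha>\<^esub> (c, d)) = v (a, b) * v (c, d)"
    and v_add: "v ((a, b) \<oplus>\<^bsub>Kinf \<alpha>\<^esub> (c, d)) \<le> v (a, b) + v (c, d)"
    and v_nonneg: "v (a, b) \<ge> 0" for a b c d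
    using v unfolding is_absolute_value_def quad_ext_simps(1) by blast+
  have w_mult: "w (x \<otimes>\<^bsub>Kinf \<alpha>\<^esub> y) = w x * w y" and w_nonneg: "w x \<ge> 0" for x y
    using is_absolute_value_Kinf
    unfolding is_absolute_value_def quad_ext_simps(1) w_def D_def by blast+
  have "v (0, 1) ^ 2 = abs_kinf D"
    using v_mult[of 0 1 0 1] ext[of D] by (simp add: D_def power2_eq_square)
  then have v_sqrt: "v (0, 1) = sqrt (abs_kinf D)"
    using v_nonneg[of 0 1] by (metis real_sqrt_unique)
  have bound: "v (a, b) \<le> 2 * w (a, b)" for a b
  proof -
    have "abs_kinf a ^ 2 \<le> abs_kinf (a ^ 2 - b ^ 2 * D)"
      "abs_kinf b ^ 2 * abs_kinf D \<le> abs_kinf (a ^ 2 - b ^ 2 * D)"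
      by (simp_all add: abs_kinf_quad_norm[OF \<alpha>_nz \<alpha>_nonsq] D_def)
    then have "sqrt (abs_kinf a ^ 2) \<le> w (a, b)" "sqrt (abs_kinf b ^ 2 * abs_kinf D) \<le> w (a, b)"
      unfolding w_def by (simp_all only: case_prod_conv real_sqrt_le_iff)
    moreover have "v (a, b) \<le> v (a, 0) + v (b, 0) * v (0, 1)"
      using v_add[of a 0 0 b] v_mult[of b 0 0 1] by simp
    ultimately show ?thesis
      by (simp add: ext v_sqrt real_sqrt_mult)
  qed
  have le: "v x \<le> w x" for x
  proof (rule ccontr)
    assume "\<not> v x \<le> w x"
    then have less: "w x < v x" by simp
    define P where "P = (\<lambda>j. ((\<lambda>y. x \<otimes>\<^bsub>Kinf \<alpha>\<^esub> y) ^^ j) (1, 0))"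
    have P: "v (P j) = v x ^ j" "w (P j) = w x ^ j" for j
    proof (induction j)
      case 0
      show "v (P 0) = v x ^ 0" by (simp add: P_def ext abs_kinf_def)
      show "w (P 0) = w x ^ 0" by (simp add: P_def w_def abs_kinf_def)
    next
      case (Suc j)
      have "P (Suc j) = x \<otimes>\<^bsub>Kinf \<alpha>\<^esub> P j" by (simp add: P_def)
      then show "v (P (Suc j)) = v x ^ Suc j" "w (P (Suc j)) = w x ^ Suc j"
        using Suc v_mult[of "fst x" "snd x" "fst (P j)" "snd (P j)"] w_mult by simp_all
    qed
    have *: "v x ^ j \<le> 2 * w x ^ j" for j
      using bound[of "fst (P j)" "snd (P j)"] by (simp add: P)
    show False
    proof (cases "w x = 0")
      case True
      with *[of 1] less show False by simp
    next
      case False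
      then have pos: "w x > 0" using w_nonneg[of x] by simp
      then obtain j where "2 < (v x / w x) ^ j"
        using real_arch_pow[of "v x / w x" 2] less by (auto simp: field_simps)
      with pos *[of j] show False
        by (simp add: power_divide field_simps)
    qed
  qed
  have "v (a, b) = w (a, b)"
  proof (rule antisym[OF le])
    have "v (a, b) * v (a, - b) = v (a ^ 2 - b ^ 2 * D, 0)"
      using v_mult[of a b a "- b"] by (simp add: D_def power2_eq_square mult.commute)
    also have "\<dots> = w (a, b) * w (a, - b)"
      by (simp add: ext w_def)
    finally have *: "v (a, b) * v (a, - b) = w (a, b) * w (a, b)"
      by (simp add: w_def)
    have "v (a, b) * v (a, - b) \<le> v (a, b) * w (a, b)"
      using le[of "(a, - b)"] v_nonneg by (intro mult_left_mono) (simp_all add: w_def)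
    with * have "w (a, b) * w (a, b) \<le> v (a, b) * w (a, b)" by simp
    then show "w (a, b) \<le> v (a, b)"
      using w_nonneg[of "(a, b)"] v_nonneg[of a b] by (cases "w (a, b) = 0") (simp_all add: mult_le_cancel_right)
  qed
  then show ?thesis
    by (simp add: w_def D_def)
qed

lemma abs_Kinf_eq: "abs_Kinf \<alpha> (a, b) = sqrt (abs_kinf (a ^ 2 - b ^ 2 * poly_to_kinf \<alpha>))"
proof -
  have "abs_Kinf \<alpha> = (\<lambda>(a, b). sqrt (abs_kinf (a ^ 2 - b ^ 2 * poly_to_kinf \<alpha>)))"
    unfolding abs_Kinf_def
  proof (rule the_equality)
    fix v assume "is_absolute_value (Kinf \<alpha>) v \<and> (\<forall>x. v (x, 0) = abs_kinf x)"
    then show "v = (\<lambda>(a, b). sqrt (abs_kinf (a ^ 2 - b ^ 2 * poly_to_kinf \<alpha>)))"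
      using abs_Kinf_unique by (auto simp: fun_eq_iff)
  qed (use is_absolute_value_Kinf in \<open>simp add: abs_kinf_power\<close>)
  then show ?thesis by simp
qed

end

definition norm_Kinf :: "'a::field poly \<Rightarrow> 'a fls \<times> 'a fls \<Rightarrow> real" where
  "norm_Kinf \<alpha> f = (abs_Kinf \<alpha> f) ^ 2"

lemma norm_Kinf_integer:
  fixes \<alpha> a b :: "'a::finite_field poly"
  assumes "\<alpha> \<noteq> 0" and "odd (degree \<alpha>) \<or> (\<nexists>c. lead_coeff \<alpha> = c ^ 2)" and "(a, b) \<noteq> (0, 0)"
  shows "norm_Kinf \<alpha> (K_to_Kinf (to_fract a, to_fract b)) =
         real CARD('a) ^ degree (a ^ 2 - b ^ 2 * \<alpha>)"
proof -
  have "poly_to_kinf (- f) = - poly_to_kinf f" for f :: "'a poly"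
    using poly_to_kinf_smult[of "- 1" f] by simp
  then have *: "poly_to_kinf a ^ 2 - poly_to_kinf b ^ 2 * poly_to_kinf \<alpha> =
      poly_to_kinf (a ^ 2 - b ^ 2 * \<alpha>)"
    using poly_to_kinf_add[of "a ^ 2" "- (b ^ 2 * \<alpha>)"]
    by (simp add: poly_to_kinf_mult power2_eq_square)
  have "norm_Kinf \<alpha> (K_to_Kinf (to_fract a, to_fract b)) =
      abs_kinf (poly_to_kinf (a ^ 2 - b ^ 2 * \<alpha>))"
    by (simp add: norm_Kinf_def K_to_Kinf_def abs_Kinf_eq[OF assms(1,2)] *)
  moreover have "a ^ 2 - b ^ 2 * \<alpha> \<noteq> 0"
  proof
    assume "a ^ 2 - b ^ 2 * \<alpha> = 0"
    then have "max (abs_kinf (poly_to_kinf a) ^ 2)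
        (abs_kinf (poly_to_kinf b) ^ 2 * abs_kinf (poly_to_kinf \<alpha>)) = 0"
      using abs_kinf_quad_norm[OF assms(1,2), of "poly_to_kinf a" "poly_to_kinf b"] *
      by (simp add: abs_kinf_def[of 0])
    then have "abs_kinf (poly_to_kinf a) ^ 2 \<le> 0"
      "abs_kinf (poly_to_kinf b) ^ 2 * abs_kinf (poly_to_kinf \<alpha>) \<le> 0"
      by (metis max.cobounded1, metis max.cobounded2)
    then show False
      using assms(1,3) abs_kinf_nonneg[of "poly_to_kinf \<alpha>"]
      by (auto simp: mult_le_0_iff not_le less_le simp del: abs_kinf_nonneg dest: antisym)
  qed
  ultimately show ?thesis
    by (simp add: abs_kinf_poly)
qed

definition ball_Kinf :: "'a::field poly \<Rightarrow> 'a fls \<times> 'a fls \<Rightarrow> real \<Rightarrow> ('a fls \<times> 'a fls) set" where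
  "ball_Kinf \<alpha> f N =
     {g. norm_Kinf \<alpha> (g \<ominus>\<^bsub>Kinf \<alpha>\<^esub> f) \<le> real CARD('a) powr N}"


section \<open>Reduced residue systems\<close>

definition comaximal :: "('b, 'm) ring_scheme \<Rightarrow> 'b \<Rightarrow> 'b \<Rightarrow> bool" where
  "comaximal R r f \<longleftrightarrow> (PIdl\<^bsub>R\<^esub> r) <+>\<^bsub>R\<^esub> (PIdl\<^bsub>R\<^esub> f) = carrier R"

text \<open>\<open>S\<close> contains exactly one representative of each residue class \<open>r\<close> modulo \<open>f ^ 2\<close>
  with \<open>(r, f) = 1\<close>.\<close>

definition reduced_residues_mod_square :: "('b, 'm) ring_scheme \<Rightarrow> 'b \<Rightarrow> 'b set \<Rightarrow> bool" where
  "reduced_residues_mod_square R f S \<longleftrightarrow>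
     S \<subseteq> {r \<in> carrier R. comaximal R r f} \<and>
     bij_betw (\<lambda>r. (PIdl\<^bsub>R\<^esub> (f [^]\<^bsub>R\<^esub> (2::nat))) +>\<^bsub>R\<^esub> r) S
       ((\<lambda>r. (PIdl\<^bsub>R\<^esub> (f [^]\<^bsub>R\<^esub> (2::nat))) +>\<^bsub>R\<^esub> r) ` {r \<in> carrier R. comaximal R r f})"

end

theory Submission
  imports Defs "HOL-Library.FuncSet" "HOL-Library.Product_Plus" "HOL-Number_Theory.Cong"
begin

text \<open>
  Write \<open>g = g1 + g2 * sqrt \<alpha>\<close> and \<open>y = r / f\<^sup>2 = y1 + y2 * sqrt \<alpha>\<close>. The trace of
  \<open>g * r / (2 * sqrt \<alpha> * f\<^sup>2)\<close> equals \<open>g1 * y2 + g2 * y1\<close> (\<open>trace_frequency\<close>). As the degrees of \<open>g1\<close>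
  and \<open>g2\<close> are bounded in terms of \<open>N\<close>, the exponential sum is a Fourier transform on a vector space over
  \<open>F\<^sub>q\<close> of dimension at most \<open>N + 2\<close>, evaluated at a vector made of the first coefficients of the
  fractional part of \<open>y\<close>. By Parseval, the left-hand side is at most \<open>K * q ^ (N + 2)\<close> times the sum of
  the \<open>\<bar>a g\<bar>\<^sup>2\<close>, where \<open>K\<close> is the largest number of pairs \<open>(f, r)\<close> that give the same vector
  (\<open>large_sieve_fibres\<close>). The fractions \<open>r / f\<^sup>2\<close> of such pairs are close to each other modulo integers,
  so it remains to count the fractions close to a given one, \<open>x = r0 / f0\<^sup>2\<close>. In what follows, constants may
  depend on \<open>q\<close> and the degree of \<open>\<alpha>\<close>.
  
  For each \<open>f\<close> there are \<open>O(1 + q powr (2 * Q - N))\<close> numerators (\<open>card_numerators_le\<close>). If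
  \<open>N \<le> 2 * Q\<close>, the trivial bound \<open>O(q ^ Q)\<close> for the number of \<open>f\<close> makes \<open>K * q ^ N\<close> at most
  \<open>O(q ^ (3 * Q))\<close>. If \<open>N > 2 * Q\<close>, the number of \<open>f\<close> is bounded by Weyl differencing
  (\<open>card_moduli_square_le\<close>): for two occurring \<open>f\<close> and \<open>f'\<close>, put
  \<open>m = f\<^sup>2 - f'\<^sup>2 = (f - f') * (f + f')\<close>. Then \<open>m * x\<close> is close to an integer, so \<open>r0 * m\<close> is congruent
  modulo \<open>f0\<^sup>2\<close> to an element of a ball with \<open>O(1 + q powr (4 * Q - N))\<close> elements. As \<open>r0\<close> is invertible
  modulo \<open>f0\<^sup>2\<close>, the number of such \<open>m\<close> is bounded in the same way. The value \<open>m = 0\<close> comes from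
  \<open>O(q ^ Q)\<close> pairs \<open>(f, f')\<close>, and any other \<open>m\<close> from at most as many pairs as it has divisors, which is
  \<open>O(2 ^ Q)\<close>. The square root of the number of pairs bounds the number of \<open>f\<close>, which gives the remaining
  two terms, with a factor \<open>2 powr (Q / 2)\<close> that is at most \<open>2 powr ((N - Q) / 2)\<close>.
  
  The ring of integers need not have unique factorisation, so its divisors are counted through norms: a
  divisor of \<open>m\<close> has a norm dividing the norm of \<open>m\<close>, and the number of elements of a given norm is bounded
  by the number of square roots of \<open>\<alpha>\<close> modulo divisors of that norm, which is again at most a number of
  divisors (\<open>primitive_elements_congruent\<close>, \<open>card_norm_dvd_le\<close>). With the divisor bound for polynomials
  (\<open>card_divisors_le\<close>) this needs no ideal theory.
\<close>

section \<open>Divisors of polynomials over a finite field\<close>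

text \<open>
  The condition is on coefficients, so that \<open>polys_below 0 = {0}\<close> and \<open>polys_below n\<close> is always an
  additive group of \<open>q ^ n\<close> elements; a bound on the degree alone would lose \<open>0\<close> when \<open>n = 0\<close>.
\<close>

definition polys_below :: "nat \<Rightarrow> 'a::zero poly set" where
  "polys_below n = {f. \<forall>i\<ge>n. coeff f i = 0}"

lemma polys_below_degree: "degree f < n \<Longrightarrow> f \<in> polys_below n"
  by (auto simp: polys_below_def intro: coeff_eq_0)

lemma polys_below_subset:
  "polys_below n \<subseteq> (\<lambda>c. Poly (map c [0..<n])) ` ({..<n} \<rightarrow>\<^sub>E (UNIV :: 'a::zero set))"
proof
  fix f :: "'a poly" assume f: "f \<in> polys_below n"
  have "f = Poly (map (restrict (coeff f) {..<n}) [0..<n])"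
    using f by (auto simp: poly_eq_iff nth_default_def polys_below_def)
  then show "f \<in> (\<lambda>c. Poly (map c [0..<n])) ` ({..<n} \<rightarrow>\<^sub>E UNIV)"
    by (intro image_eqI[where x = "restrict (coeff f) {..<n}"]) auto
qed

lemma finite_polys_below: "finite (polys_below n :: 'a::{finite,zero} poly set)"
  by (rule finite_subset[OF polys_below_subset]) (auto intro!: finite_PiE)

lemma card_polys_below_le: "card (polys_below n :: 'a::{finite,zero} poly set) \<le> CARD('a) ^ n"
proof -
  have "card (polys_below n :: 'a poly set) \<le> card ({..<n} \<rightarrow>\<^sub>E (UNIV :: 'a set))"
    by (rule surj_card_le[OF _ polys_below_subset]) (auto intro!: finite_PiE)
  then show ?thesis by (simp add: card_PiE)
qed

lemma divisors_subset_polys_below: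
  fixes M :: "'a::idom poly"
  assumes "M \<noteq> 0"
  shows "{d. d dvd M} \<subseteq> polys_below (Suc (degree M))"
  using assms by (auto intro!: polys_below_degree dest: dvd_imp_degree_le simp: less_Suc_eq_le)

lemma finite_divisors:
  fixes M :: "'a::{idom,finite} poly"
  assumes "M \<noteq> 0"
  shows "finite {d. d dvd M}"
  by (rule finite_subset[OF divisors_subset_polys_below[OF assms] finite_polys_below])

text \<open>
  This replaces unique factorisation when the divisors of a polynomial are counted: the prime is taken
  out of the divisor as long as it divides it, and then it no longer interferes.
\<close>

lemma dvd_prime_power_mult:
  fixes P :: "'b::idom"
  assumes P: "prime_elem P" and "d dvd P ^ e * X"
  shows "\<exists>i\<le>e. \<exists>d'. d' dvd X \<and> d = P ^ i * d'"
  using assms(2)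
proof (induction e arbitrary: d)
  case 0
  then show ?case by auto
next
  case (Suc e)
  have P0: "P \<noteq> 0" using P by auto
  from Suc.prems have dv: "d dvd P * (P ^ e * X)" by (simp add: mult.assoc)
  show ?case
  proof (cases "P dvd d")
    case True
    then obtain d1 where d1: "d = P * d1" by auto
    with dv P0 have "d1 dvd P ^ e * X" by simp
    from Suc.IH[OF this] obtain i d' where "i \<le> e" "d' dvd X" "d1 = P ^ i * d'" by blast
    with d1 show ?thesis
      by (intro exI[of _ "Suc i"]) (auto simp: mult.assoc)
  next
    case False
    from dv obtain k where k: "P * (P ^ e * X) = d * k" by (auto simp: dvd_def)
    then have "P dvd d * k" by (metis dvd_triv_left)
    with False P have "P dvd k" by (simp add: prime_elem_dvd_mult_iff)
    then obtain k' where "k = P * k'" by auto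
    with k P0 have "P ^ e * X = d * k'" by (simp add: mult.left_commute)
    then have "d dvd P ^ e * X" by simp
    from Suc.IH[OF this] show ?thesis using le_SucI by blast
  qed
qed

lemma ex_monic_irreducible_factor:
  fixes M :: "'a::field poly"
  assumes "degree M > 0"
  shows "\<exists>P. irreducible P \<and> lead_coeff P = 1 \<and> P dvd M"
proof -
  define good where "good P \<longleftrightarrow> degree P > 0 \<and> P dvd M" for P
  obtain P where P: "good P" and minP: "\<And>P'. good P' \<Longrightarrow> degree P \<le> degree P'"
    using ex_has_least_nat[of good M degree] assms by (auto simp: good_def)
  define P1 where "P1 = smult (inverse (lead_coeff P)) P"
  have P0: "P \<noteq> 0" using P by (auto simp: good_def)
  have "P1 dvd M" using P P0 by (simp add: P1_def good_def smult_dvd_iff)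
  moreover have "lead_coeff P1 = 1" using P0 by (simp add: P1_def)
  moreover have "irreducible P1"
  proof (rule irreducibleI)
    show "P1 \<noteq> 0" using P0 by (simp add: P1_def)
    show "\<not> is_unit P1"
      using P P0 by (simp add: P1_def is_unit_iff_degree good_def)
    fix a b assume ab: "P1 = a * b"
    have nz: "a \<noteq> 0" "b \<noteq> 0" using ab \<open>P1 \<noteq> 0\<close> by auto
    have deg: "degree a + degree b = degree P"
      using degree_mult_eq[OF nz] P0 unfolding ab[symmetric] by (simp add: P1_def)
    have "a dvd M" "b dvd M" using \<open>P1 dvd M\<close> ab by (auto dest: dvd_mult_left dvd_mult_right)
    then have "degree a = 0 \<or> degree a \<ge> degree P" "degree b = 0 \<or> degree b \<ge> degree P"
      using minP unfolding good_def by (metis gr0I)+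
    moreover have "degree P > 0" using P by (simp add: good_def)
    ultimately show "is_unit a \<or> is_unit b"
      using deg nz by (auto simp: is_unit_iff_degree)
  qed
  ultimately show ?thesis by blast
qed

lemma prime_power_decomposition:
  fixes P M :: "'a::idom poly"
  assumes "degree P > 0" and "M \<noteq> 0"
  shows "\<exists>e X. M = P ^ e * X \<and> \<not> P dvd X"
  using assms(2)
proof (induction "degree M" arbitrary: M rule: less_induct)
  case less
  show ?case
  proof (cases "P dvd M")
    case False
    then show ?thesis by (intro exI[of _ 0] exI[of _ M]) auto
  next
    case True
    then obtain N where N: "M = P * N" by auto
    with less.prems have "N \<noteq> 0" "P \<noteq> 0" by auto
    with N assms(1) have "degree N < degree M" by (simp add: degree_mult_eq)
    from less.hyps[OF this \<open>N \<noteq> 0\<close>] obtain e X where "N = P ^ e * X" "\<not> P dvd X" by blast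
    with N show ?thesis
      by (intro exI[of _ "Suc e"] exI[of _ X]) (auto simp: mult.assoc)
  qed
qed

lemma card_divisors_prime_power_mult_le:
  fixes P X :: "'a::{idom,finite} poly"
  assumes "prime_elem P" and "X \<noteq> 0"
  shows "card {d. d dvd P ^ e * X} \<le> (e + 1) * card {d. d dvd X}"
proof -
  have "{d. d dvd P ^ e * X} \<subseteq> (\<lambda>(i, d). P ^ i * d) ` ({..e} \<times> {d. d dvd X})"
    using dvd_prime_power_mult[OF assms(1)] by force
  then have "card {d. d dvd P ^ e * X} \<le> card ({..e} \<times> {d. d dvd X})"
    using finite_divisors[OF assms(2)] by (intro surj_card_le) auto
  then show ?thesis by (simp add: card_cartesian_product)
qed

text \<open>
  A prime power \<open>P ^ e\<close> has \<open>e + 1\<close> divisors up to units, so this is what each single prime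
  contributes to the divisor bound; the constant must grow as \<open>\<epsilon>\<close> tends to \<open>0\<close>.
\<close>

lemma linear_le_exponential:
  fixes \<epsilon> :: real
  assumes "\<epsilon> > 0"
  shows "real e + 1 \<le> (1 + 2 / \<epsilon>) * 2 powr (\<epsilon> * real e)"
proof -
  have "2 powr x \<ge> 1 + x / 2" if "x \<ge> 0" for x :: real
  proof -
    have "1 / 2 \<le> ln (2::real)" using exp_half_le2 ln_ge_iff[of 2 "1/2"] by (simp only: zero_less_numeral)
    then have "x * (1/2) \<le> x * ln 2" using that by (intro mult_left_mono)
    moreover have "1 + x * ln 2 \<le> exp (x * ln 2)" by (rule exp_ge_add_one_self)
    moreover have "2 powr x = exp (x * ln 2)" by (simp add: powr_def)
    ultimately show ?thesis by linarith
  qed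
  from this[of "\<epsilon> * real e"] assms
  have "(1 + 2 / \<epsilon>) * (1 + \<epsilon> * real e / 2) \<le> (1 + 2 / \<epsilon>) * 2 powr (\<epsilon> * real e)"
    by (intro mult_left_mono) auto
  moreover have "(1 + 2 / \<epsilon>) * (1 + \<epsilon> * real e / 2) = real e + 1 + (2/\<epsilon> + \<epsilon> * real e / 2)"
    using assms by (simp add: field_simps)
  moreover have "2/\<epsilon> + \<epsilon> * real e / 2 \<ge> 0" using assms by simp
  ultimately show ?thesis by linarith
qed

text \<open>
  The classical divisor bound. Primes \<open>P\<close> with \<open>\<epsilon> * degree P \<ge> 1\<close> cost nothing, since
  \<open>e + 1 \<le> 2 ^ e \<le> 2 powr (\<epsilon> * degree (P ^ e))\<close>. Only the finitely many monic primes of smaller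
  degree cost a constant factor each, so the total loss is bounded.
\<close>

lemma card_divisors_le:
  fixes \<epsilon> :: real
  assumes "\<epsilon> > 0"
  shows "\<exists>C>0. \<forall>M :: 'a::finite_field poly. M \<noteq> 0 \<longrightarrow>
           real (card {d. d dvd M}) \<le> C * 2 powr (\<epsilon> * degree M)"
proof -
  define A where "A = 1 + 2 / \<epsilon>"
  have A1: "A \<ge> 1" using assms by (simp add: A_def)
  define S :: "'a poly set" where "S = {P. irreducible P \<and> lead_coeff P = 1 \<and> \<epsilon> * degree P < 1}"
  have finS: "finite S"
  proof (rule finite_subset[OF _ finite_polys_below])
    show "S \<subseteq> polys_below (nat \<lceil>1 / \<epsilon>\<rceil>)"
    proof
      fix P assume "P \<in> S"
      then have "real (degree P) < 1 / \<epsilon>"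
        using assms by (simp add: S_def field_simps)
      then show "P \<in> polys_below (nat \<lceil>1 / \<epsilon>\<rceil>)"
        by (intro polys_below_degree) linarith
    qed
  qed
  \<comment> \<open>The number of primes that cost a factor \<open>A\<close>; it drops when such a prime is split off.\<close>
  define w where "w M = card {P \<in> S. P dvd M}" for M
  have main: "real (card {d. d dvd M}) \<le> CARD('a) * A ^ w M * 2 powr (\<epsilon> * degree M)" if "M \<noteq> 0" for M
    using that
  proof (induction "degree M" arbitrary: M rule: less_induct)
    case less
    show ?case
    proof (cases "degree M = 0")
      case True
      have "card {d. d dvd M} \<le> card (polys_below 1 :: 'a poly set)"
        using divisors_subset_polys_below[OF less.prems] True
        by (intro card_mono finite_polys_below) auto
      also have "\<dots> \<le> CARD('a)" using card_polys_below_le[of 1, where 'a = 'a] by simp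
      finally have "real (card {d. d dvd M}) \<le> real CARD('a) * 1" by simp
      also have "\<dots> \<le> CARD('a) * A ^ w M"
        using A1 by (intro mult_left_mono one_le_power) auto
      finally show ?thesis using True by simp
    next
      case False
      then obtain P where P: "irreducible P" "lead_coeff P = 1" "P dvd M"
        using ex_monic_irreducible_factor[of M] by auto
      have P0: "P \<noteq> 0" using P(1) by auto
      have dP: "degree P > 0"
        using P(1) P0 by (auto simp: irreducible_def is_unit_iff_degree)
      obtain e X where eX: "M = P ^ e * X" "\<not> P dvd X"
        using prime_power_decomposition[OF dP less.prems] by blast
      have X0: "X \<noteq> 0" using eX by auto
      have "e \<noteq> 0" using eX P(3) by (intro notI) simp
      have degM: "degree M = e * degree P + degree X"
        using eX P0 X0 by (simp add: degree_mult_eq degree_power_eq)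
      with dP \<open>e \<noteq> 0\<close> have "degree X < degree M" by simp
      from less.hyps[OF this X0]
      have IH: "real (card {d. d dvd X}) \<le> CARD('a) * A ^ w X * 2 powr (\<epsilon> * degree X)" .
      have "real (card {d. d dvd M}) \<le> real ((e + 1) * card {d. d dvd X})"
        unfolding eX(1) of_nat_le_iff
        by (intro card_divisors_prime_power_mult_le field_poly_irreducible_imp_prime P X0)
      also have "\<dots> \<le> (real e + 1) * (CARD('a) * A ^ w X * 2 powr (\<epsilon> * degree X))"
        using mult_left_mono[OF IH, of "real e + 1"]
        by (simp only: of_nat_mult of_nat_add of_nat_1)
      finally have step: "real (card {d. d dvd M}) \<le>
          CARD('a) * ((real e + 1) * A ^ w X) * 2 powr (\<epsilon> * degree X)"
        by (simp add: algebra_simps)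
      have sub: "{P' \<in> S. P' dvd X} \<subseteq> {P' \<in> S. P' dvd M}"
        using eX(1) by auto
      have "(real e + 1) * A ^ w X \<le> A ^ w M * 2 powr (\<epsilon> * (e * degree P))"
      \<comment> \<open>A small prime pays with one factor \<open>A\<close>, a large one with its own degree.\<close>
      proof (cases "P \<in> S")
        case True
        have "insert P {P' \<in> S. P' dvd X} \<subseteq> {P' \<in> S. P' dvd M}"
          using sub True P(3) by auto
        then have "card (insert P {P' \<in> S. P' dvd X}) \<le> w M"
          unfolding w_def using finS by (intro card_mono) auto
        then have w: "Suc (w X) \<le> w M"
          using finS eX(2) by (simp add: w_def)
        have "(real e + 1) \<le> A * 2 powr (\<epsilon> * real e)"
          unfolding A_def by (rule linear_le_exponential[OF assms])
        also have "\<dots> \<le> A * 2 powr (\<epsilon> * (e * degree P))"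
          using A1 assms dP by (intro mult_left_mono powr_mono) (auto simp: mult_le_cancel_left1)
        finally have "(real e + 1) * A ^ w X \<le> A * 2 powr (\<epsilon> * (e * degree P)) * A ^ w X"
          using A1 by (intro mult_right_mono) auto
        also have "\<dots> = A ^ Suc (w X) * 2 powr (\<epsilon> * (e * degree P))" by simp
        also have "\<dots> \<le> A ^ w M * 2 powr (\<epsilon> * (e * degree P))"
          using w A1 by (intro mult_right_mono power_increasing) auto
        finally show ?thesis .
      next
        case False
        then have big: "\<epsilon> * degree P \<ge> 1" using P by (simp add: S_def)
        have "w X \<le> w M" unfolding w_def using finS sub by (intro card_mono) auto
        then have wX: "A ^ w X \<le> A ^ w M" using A1 by (intro power_increasing)
        have "real e + 1 \<le> 2 ^ e"
        proof -
          have "Suc e \<le> 2 ^ e" using less_exp[of e] by linarith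
          then have "real (Suc e) \<le> real (2 ^ e)" by (simp only: of_nat_le_iff)
          then show ?thesis by simp
        qed
        also have "\<dots> = 2 powr real e" by (simp add: powr_realpow)
        also have "\<dots> \<le> 2 powr (\<epsilon> * (e * degree P))"
          using mult_left_mono[OF big, of "real e"] by (intro powr_mono) (auto simp: algebra_simps)
        finally have "(real e + 1) * A ^ w X \<le> 2 powr (\<epsilon> * (e * degree P)) * A ^ w M"
          using wX A1 by (intro mult_mono) auto
        then show ?thesis by (simp add: mult.commute)
      qed
      then have "CARD('a) * ((real e + 1) * A ^ w X) * 2 powr (\<epsilon> * degree X) \<le>
          CARD('a) * (A ^ w M * 2 powr (\<epsilon> * (e * degree P))) * 2 powr (\<epsilon> * degree X)"
        by (intro mult_right_mono mult_left_mono) auto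
      also have "\<dots> = CARD('a) * A ^ w M * 2 powr (\<epsilon> * degree M)"
        by (simp add: degM powr_add algebra_simps)
      finally show ?thesis using step by linarith
    qed
  qed
  show ?thesis
  proof (intro exI[of _ "CARD('a) * A ^ card S"] conjI allI impI)
    show "0 < CARD('a) * A ^ card S" using A1 by simp
    fix M :: "'a poly" assume "M \<noteq> 0"
    have "A ^ w M \<le> A ^ card S"
      unfolding w_def using A1 finS by (intro power_increasing card_mono) auto
    then have "CARD('a) * A ^ w M * 2 powr (\<epsilon> * degree M) \<le> CARD('a) * A ^ card S * 2 powr (\<epsilon> * degree M)"
      by (intro mult_right_mono mult_left_mono) auto
    with main[OF \<open>M \<noteq> 0\<close>]
    show "real (card {d. d dvd M}) \<le> CARD('a) * A ^ card S * 2 powr (\<epsilon> * degree M)"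
      by linarith
  qed
qed

text \<open>
  A greatest common divisor in Bezout form, determined up to a unit only; no normalised choice is made.
\<close>

lemma bezout_gcd_poly:
  fixes a b :: "'a::field poly"
  shows "\<exists>g x y. g dvd a \<and> g dvd b \<and> g = x * a + y * b"
proof (induction "euclidean_size b" arbitrary: a b rule: less_induct)
  case less
  show ?case
  proof (cases "b = 0")
    case True
    then show ?thesis by (intro exI[of _ a] exI[of _ 1] exI[of _ 0]) auto
  next
    case False
    then have "euclidean_size (a mod b) < euclidean_size b" by (rule mod_size_less)
    from less.hyps[OF this] obtain g x y where
      g: "g dvd b" "g dvd a mod b" "g = x * b + y * (a mod b)" by blast
    have "g dvd a" using g(1,2) by (metis dvd_mod_imp_dvd)
    moreover have "g = y * a + (x - y * (a div b)) * b"
      unfolding g(3) minus_div_mult_eq_mod[symmetric] by (simp add: algebra_simps)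
    ultimately show ?thesis using g(1) by blast
  qed
qed

lemma coprime_poly_bezout:
  fixes a b :: "'a::field poly"
  assumes "coprime a b"
  shows "\<exists>x y. x * a + y * b = 1"
proof -
  obtain g x y where g: "g dvd a" "g dvd b" "g = x * a + y * b"
    using bezout_gcd_poly by blast
  then have "is_unit g" using assms by (auto simp: coprime_def)
  then obtain h where "1 = g * h" by (auto simp: dvd_def)
  then have "(h * x) * a + (h * y) * b = 1" using g(3) by (simp add: algebra_simps)
  then show ?thesis by blast
qed

lemma bezout_coprime:
  fixes a b :: "'a::field poly"
  assumes "x * a + y * b = 1"
  shows "coprime a b"
  by (rule coprimeI) (metis assms dvd_add dvd_mult)

text \<open>
  Coprimality is tested one prime at a time, which is how the arguments on norms below proceed.
\<close>

lemma coprime_poly_irreducibleI: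
  fixes a b :: "'a::field poly"
  assumes "a \<noteq> 0" and "\<And>P. irreducible P \<Longrightarrow> P dvd a \<Longrightarrow> P dvd b \<Longrightarrow> False"
  shows "coprime a b"
proof (rule coprimeI)
  fix g assume g: "g dvd a" "g dvd b"
  have "g \<noteq> 0" using g assms(1) by auto
  moreover have "degree g = 0"
  proof (rule ccontr)
    assume "degree g \<noteq> 0"
    then obtain P where "irreducible P" "P dvd g"
      using ex_monic_irreducible_factor[of g] by auto
    with g assms(2) show False by (meson dvd_trans)
  qed
  ultimately show "is_unit g" by (simp add: is_unit_iff_degree)
qed

lemma coprime_poly_mult_dvd:
  fixes a b c :: "'a::field poly"
  assumes "coprime a b" and "a dvd c" and "b dvd c"
  shows "a * b dvd c"
proof -
  obtain x y where xy: "x * a + y * b = 1" using coprime_poly_bezout[OF assms(1)] by blast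
  have "x * (a * c) + y * (c * b) = (x * a + y * b) * c" by (simp add: algebra_simps)
  then have "c = x * (a * c) + y * (c * b)" by (simp add: xy)
  moreover have "a * b dvd a * c" "a * b dvd c * b" using assms by (auto intro: mult_dvd_mono)
  ultimately show ?thesis by (metis dvd_add dvd_mult)
qed

lemma coprime_poly_dvd_mult_cancel:
  fixes a b c :: "'a::field poly"
  assumes "coprime a b" and "a dvd b * c"
  shows "a dvd c"
proof -
  obtain x y where xy: "x * a + y * b = 1" using coprime_poly_bezout[OF assms(1)] by blast
  have "x * c * a + y * (b * c) = (x * a + y * b) * c" by (simp add: algebra_simps)
  then have "c = x * c * a + y * (b * c)" by (simp add: xy)
  then show ?thesis using assms(2) by (metis dvd_add dvd_mult dvd_triv_right)
qed

section \<open>Integers of given norm in an imaginary quadratic function field\<close>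

text \<open>
  Multiplication and norm for pairs \<open>(a, b)\<close> standing for \<open>a + b * sqrt D\<close>. They are stated over any
  commutative ring because the same formulas are needed for the integers (coefficients in \<open>A\<close>) and for
  the completion (coefficients in the Laurent series). Addition is componentwise.
\<close>

definition qmul :: "'b::comm_ring_1 \<Rightarrow> 'b \<times> 'b \<Rightarrow> 'b \<times> 'b \<Rightarrow> 'b \<times> 'b" where
  "qmul D x y = (fst x * fst y + snd x * snd y * D, fst x * snd y + snd x * fst y)"

definition qnorm :: "'b::comm_ring_1 \<Rightarrow> 'b \<times> 'b \<Rightarrow> 'b" where
  "qnorm D x = fst x ^ 2 - snd x ^ 2 * D"

lemma qmul_commute: "qmul D x y = qmul D y x"
  by (simp add: qmul_def algebra_simps)

lemma qmul_assoc: "qmul D (qmul D x y) z = qmul D x (qmul D y z)"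
  by (simp add: qmul_def algebra_simps)

lemma qmul_left_commute: "qmul D x (qmul D y z) = qmul D y (qmul D x z)"
  by (simp add: qmul_def algebra_simps)

lemmas qmul_ac = qmul_assoc qmul_commute qmul_left_commute

lemma qmul_add_right: "qmul D x (y + z) = qmul D x y + qmul D x z"
  by (simp add: qmul_def prod_eq_iff algebra_simps)

lemma qmul_add_left: "qmul D (x + y) z = qmul D x z + qmul D y z"
  by (simp add: qmul_def prod_eq_iff algebra_simps)

lemma qmul_diff_right: "qmul D x (y - z) = qmul D x y - qmul D x z"
  by (simp add: qmul_def prod_eq_iff algebra_simps)

lemma qmul_diff_left: "qmul D (x - y) z = qmul D x z - qmul D y z"
  by (simp add: qmul_def prod_eq_iff algebra_simps)

lemma qmul_one [simp]: "qmul D (1, 0) x = x" "qmul D x (1, 0) = x"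
  by (simp_all add: qmul_def)

lemma qmul_zero [simp]: "qmul D 0 x = 0" "qmul D x 0 = 0"
  by (simp_all add: qmul_def prod_eq_iff)

lemmas qmul_distribs = qmul_add_right qmul_add_left qmul_diff_right qmul_diff_left

lemma qnorm_qmul: "qnorm D (qmul D x y) = qnorm D x * qnorm D y"
  by (simp add: qmul_def qnorm_def power2_eq_square algebra_simps)

lemma poly_to_kinf_uminus: "poly_to_kinf (- f) = - poly_to_kinf f"
  using poly_to_kinf_smult[of "- 1" f] by simp

lemma poly_to_kinf_diff: "poly_to_kinf (f - g) = poly_to_kinf f - poly_to_kinf g"
  using poly_to_kinf_add[of f "- g"] by (simp add: poly_to_kinf_uminus)

lemma poly_to_kinf_qnorm:
  "qnorm (poly_to_kinf \<alpha>) (poly_to_kinf a, poly_to_kinf b) = poly_to_kinf (qnorm \<alpha> (a, b))"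
  by (simp add: qnorm_def power2_eq_square poly_to_kinf_diff poly_to_kinf_mult)

text \<open>
  The condition on the degree and the leading coefficient says that infinity does not split, so that
  norms of integers are as large as their coordinates allow; everything below, in particular the
  finiteness of the unit group, rests on this.
\<close>

locale imaginary_quadratic =
  fixes \<alpha> :: "'a::finite_field poly"
  assumes squarefree: "squarefree \<alpha>"
    and nonsquare_at_infinity: "odd (degree \<alpha>) \<or> (\<nexists>c. lead_coeff \<alpha> = c ^ 2)"
    and odd_characteristic: "(2 :: 'a) \<noteq> 0"
begin

lemma alpha_nonzero: "\<alpha> \<noteq> 0"
proof
  assume "\<alpha> = 0"
  then have "(monom 1 1 :: 'a poly) ^ 2 dvd \<alpha>" by simp
  then have "is_unit (monom 1 1 :: 'a poly)" using squarefree unfolding squarefree_def by blast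
  moreover have "monom (1::'a) 1 \<noteq> 0" by simp
  ultimately have "degree (monom 1 1 :: 'a poly) = 0" using is_unit_iff_degree by blast
  then show False by (simp add: degree_monom_eq)
qed

lemma one_less_card: "real CARD('a) > 1"
proof -
  have "card {0, 1::'a} \<le> CARD('a)" by (intro card_mono) auto
  then show ?thesis by simp
qed

text \<open>
  No cancellation takes place in a norm at infinity. A bound on the degree of the norm therefore bounds
  both coordinates.
\<close>

lemma qnorm_degree:
  fixes a b :: "'a poly"
  assumes "(a, b) \<noteq> (0, 0)"
  shows "qnorm \<alpha> (a, b) \<noteq> 0" and "2 * degree a \<le> degree (qnorm \<alpha> (a, b))"
    and "b \<noteq> 0 \<Longrightarrow> 2 * degree b + degree \<alpha> \<le> degree (qnorm \<alpha> (a, b))"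
proof -
  define q where "q = real CARD('a)"
  have q: "q > 1" using one_less_card by (simp add: q_def)
  have eq: "abs_kinf (poly_to_kinf (qnorm \<alpha> (a, b))) =
      max (abs_kinf (poly_to_kinf a) ^ 2) (abs_kinf (poly_to_kinf b) ^ 2 * abs_kinf (poly_to_kinf \<alpha>))"
    using abs_kinf_quad_norm[OF alpha_nonzero nonsquare_at_infinity, of "poly_to_kinf a" "poly_to_kinf b"]
    unfolding poly_to_kinf_qnorm[symmetric] by (simp add: qnorm_def)
  have le: "abs_kinf (poly_to_kinf a) ^ 2 \<le> abs_kinf (poly_to_kinf (qnorm \<alpha> (a, b)))"
    "abs_kinf (poly_to_kinf b) ^ 2 * abs_kinf (poly_to_kinf \<alpha>) \<le> abs_kinf (poly_to_kinf (qnorm \<alpha> (a, b)))"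
    unfolding eq by simp_all
  have abs: "abs_kinf (poly_to_kinf f) = q ^ degree f" if "f \<noteq> 0" for f :: "'a poly"
    using abs_kinf_poly[OF that] by (simp add: q_def)
  show nz: "qnorm \<alpha> (a, b) \<noteq> 0"
  proof
    assume "qnorm \<alpha> (a, b) = 0"
    then have le': "abs_kinf (poly_to_kinf a) ^ 2 \<le> 0"
        "abs_kinf (poly_to_kinf b) ^ 2 * abs_kinf (poly_to_kinf \<alpha>) \<le> 0"
      using le by (simp_all only: poly_to_kinf_0 abs_kinf_eq_0_iff[THEN iffD2])
    have "a = 0"
      using le'(1) abs[of a] q by (cases "a = 0") auto
    moreover have "b = 0"
    proof (rule ccontr)
      assume "b \<noteq> 0"
      then have "(q ^ degree b) ^ 2 * q ^ degree \<alpha> \<le> 0"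
        using le'(2) by (simp only: abs alpha_nonzero not_False_eq_True)
      moreover have "(q ^ degree b) ^ 2 * q ^ degree \<alpha> > 0" using q by simp
      ultimately show False by linarith
    qed
    ultimately show False using assms by simp
  qed
  show "2 * degree a \<le> degree (qnorm \<alpha> (a, b))"
  proof (cases "a = 0")
    case False
    with le(1) nz have "q ^ (degree a * 2) \<le> q ^ degree (qnorm \<alpha> (a, b))"
      by (simp only: abs power_mult not_False_eq_True)
    then show ?thesis using q by simp
  qed simp
  show "2 * degree b + degree \<alpha> \<le> degree (qnorm \<alpha> (a, b))" if "b \<noteq> 0"
  proof -
    from le(2) nz that have "q ^ (degree b * 2 + degree \<alpha>) \<le> q ^ degree (qnorm \<alpha> (a, b))"
      by (simp only: abs alpha_nonzero power_mult power_add not_False_eq_True)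
    then show ?thesis using q by simp
  qed
qed

lemma qnorm_eq_0_iff: "qnorm \<alpha> u = 0 \<longleftrightarrow> u = 0"
  using qnorm_degree(1)[of "fst u" "snd u"] by (cases u) (auto simp: qnorm_def zero_prod_def)

lemma norm_one_subset:
  "{w. qnorm \<alpha> w = 1} \<subseteq> polys_below 1 \<times> polys_below 1"
proof
  fix w assume "w \<in> {w. qnorm \<alpha> w = 1}"
  then have w: "qnorm \<alpha> (fst w, snd w) = 1" by simp
  then have nz: "(fst w, snd w) \<noteq> (0, 0)" by (auto simp: qnorm_def)
  have "degree (fst w) < 1" "degree (snd w) < 1"
    using qnorm_degree(2,3)[OF nz] w by (cases "snd w = 0", auto)+
  then show "w \<in> polys_below 1 \<times> polys_below 1"
    by (auto simp: mem_Times_iff intro: polys_below_degree)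
qed

lemma finite_norm_one: "finite {w. qnorm \<alpha> w = 1}"
  by (rule finite_subset[OF norm_one_subset]) (auto intro: finite_polys_below)

lemma card_norm_one_le: "card {w. qnorm \<alpha> w = 1} \<le> CARD('a) ^ 2"
proof -
  have "card {w. qnorm \<alpha> w = 1} \<le> card (polys_below 1 \<times> polys_below 1 :: ('a poly \<times> 'a poly) set)"
    by (rule card_mono[OF _ norm_one_subset]) (auto intro: finite_polys_below)
  also have "\<dots> \<le> CARD('a) ^ 1 * CARD('a) ^ 1"
    unfolding card_cartesian_product by (intro mult_mono card_polys_below_le) auto
  finally show ?thesis by (simp add: power2_eq_square)
qed

text \<open>
  If a prime divides the norm \<open>a\<^sup>2 - b\<^sup>2 * \<alpha>\<close> and \<open>b\<close>, then it divides \<open>a\<close>.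
\<close>

lemma irreducible_not_dvd_snd:
  assumes P: "irreducible P" and cop: "coprime a b" and dv: "P dvd qnorm \<alpha> (a, b)"
  shows "\<not> P dvd b"
proof
  assume b: "P dvd b"
  have pr: "prime_elem P" using P by (rule field_poly_irreducible_imp_prime)
  have "P dvd b ^ 2 * \<alpha>" using b by (simp add: power2_eq_square)
  then have "P dvd qnorm \<alpha> (a, b) + b ^ 2 * \<alpha>" using dv by (rule dvd_add[rotated])
  then have "P dvd a ^ 2" by (simp add: qnorm_def)
  then have "P dvd a" using pr by (rule prime_elem_dvd_power[rotated])
  with b cop have "is_unit P" by (auto simp: coprime_def)
  then show False using P by (simp add: irreducible_def)
qed

text \<open>
  Here \<open>\<alpha>\<close> being square-free enters: a prime that divides \<open>a\<close> and the norm divides \<open>\<alpha>\<close>, and it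
  divides \<open>\<alpha>\<close> exactly once.
\<close>

lemma ramified_square_not_dvd_qnorm:
  assumes P: "irreducible P" and cop: "coprime a b" and a: "P dvd a"
  shows "\<not> P ^ 2 dvd qnorm \<alpha> (a, b)"
proof
  assume dv: "P ^ 2 dvd qnorm \<alpha> (a, b)"
  have pr: "prime_elem P" using P by (rule field_poly_irreducible_imp_prime)
  have "P dvd P ^ 2" by (simp add: power2_eq_square)
  with dv have "\<not> P dvd b" using irreducible_not_dvd_snd[OF P cop] dvd_trans by blast
  then have b2: "\<not> P dvd b ^ 2" using pr prime_elem_dvd_power by blast
  have "P ^ 2 dvd a ^ 2 - qnorm \<alpha> (a, b)" using a dv by (intro dvd_diff dvd_power_same)
  then have "P ^ 2 dvd b ^ 2 * \<alpha>" by (simp add: qnorm_def)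
  then have "P ^ 2 dvd \<alpha>"
    using b2 pr by (intro prime_power_dvd_multD[of P 2 "b ^ 2" \<alpha>]) auto
  then have "is_unit P" using squarefree by (auto simp: squarefree_def)
  then show False using P by (simp add: irreducible_def)
qed

text \<open>
  For a primitive element \<open>a + b * sqrt \<alpha>\<close> of norm \<open>n\<close> the quotient \<open>a / b\<close> is a square root of \<open>\<alpha>\<close>
  modulo \<open>n\<close>. Compare it with the root \<open>a0 / b0\<close> of a fixed element: their difference and their sum
  multiply to \<open>0\<close> modulo \<open>n\<close>. If \<open>e\<close> is the greatest common divisor of \<open>n\<close> with the difference and
  \<open>n = e * h\<close>, then \<open>a / b\<close> agrees with \<open>a0 / b0\<close> modulo \<open>e\<close> and with \<open>- a0 / b0\<close> modulo \<open>h\<close>. As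
  \<open>e\<close> and \<open>h\<close> are coprime, \<open>e\<close> determines \<open>a / b\<close> modulo \<open>n\<close>. This counts square roots by divisors,
  without Hensel lifting or the Chinese remainder theorem.
\<close>

lemma primitive_elements_congruent:
  assumes cop: "coprime a0 b0" "coprime a b" "coprime a' b'"
    and nm: "qnorm \<alpha> (a0, b0) = n" "qnorm \<alpha> (a, b) = n" "qnorm \<alpha> (a', b') = n" and "n \<noteq> 0"
    and e: "e dvd n" "e dvd a * b0 - a0 * b" "e dvd a' * b0 - a0 * b'"
    and bez: "e = x * n + y * (a * b0 - a0 * b)" "e = x' * n + y' * (a' * b0 - a0 * b')"
  shows "n dvd a * b' - a' * b"
proof -
  obtain h where h: "n = e * h" using e(1) by auto
  have "e \<noteq> 0" "h \<noteq> 0" using h \<open>n \<noteq> 0\<close> by auto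
  have other: "h dvd c * b0 + a0 * d"
    if "qnorm \<alpha> (c, d) = n" "e = x * n + y * (c * b0 - a0 * d)" for c d x y
  proof -
    have "(c * b0 - a0 * d) * (c * b0 + a0 * d) =
        b0 ^ 2 * qnorm \<alpha> (c, d) - d ^ 2 * qnorm \<alpha> (a0, b0)"
      by (simp add: qnorm_def power2_eq_square algebra_simps)
    also have "\<dots> = n * (b0 ^ 2 - d ^ 2)" using that nm by (simp add: algebra_simps)
    finally have 1: "n dvd (c * b0 - a0 * d) * (c * b0 + a0 * d)" by simp
    have "e * (c * b0 + a0 * d) =
        n * (x * (c * b0 + a0 * d)) + y * ((c * b0 - a0 * d) * (c * b0 + a0 * d))"
      by (subst that(2)) (simp add: algebra_simps)
    then have "n dvd e * (c * b0 + a0 * d)" using 1 by (metis dvd_add dvd_mult dvd_triv_left)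
    then show ?thesis using h \<open>e \<noteq> 0\<close> by simp
  qed
  have h1: "h dvd a * b0 + a0 * b" using nm(2) bez(1) by (rule other)
  have h2: "h dvd a' * b0 + a0 * b'" using nm(3) bez(2) by (rule other)
  \<comment> \<open>A common prime divides \<open>2 * a * b0\<close>, hence is ramified, but its square divides \<open>n\<close>.\<close>
  have eh: "coprime e h"
  proof (rule coprime_poly_irreducibleI[OF \<open>e \<noteq> 0\<close>])
    fix P assume P: "irreducible P" "P dvd e" "P dvd h"
    have pr: "prime_elem P" using P(1) by (rule field_poly_irreducible_imp_prime)
    have Pn: "P ^ 2 dvd n" unfolding h power2_eq_square using P by (intro mult_dvd_mono)
    have Pn1: "P dvd n" using P(2) e(1) dvd_trans by blast
    have "P dvd (a * b0 - a0 * b) + (a * b0 + a0 * b)"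
      by (rule dvd_add[OF dvd_trans[OF P(2) e(2)] dvd_trans[OF P(3) h1]])
    also have "\<dots> = smult 2 (a * b0)" using smult_add_left[of 1 1 "a * b0"] by simp
    finally have "P dvd smult 2 (a * b0)" .
    then have "P dvd a * b0"
      using odd_characteristic by (simp add: dvd_smult_iff)
    then have "P dvd a \<or> P dvd b0" using pr by (simp add: prime_elem_dvd_mult_iff)
    moreover have "\<not> P dvd b0" using irreducible_not_dvd_snd[OF P(1) cop(1)] nm Pn1 by simp
    ultimately have "P dvd a" by simp
    from ramified_square_not_dvd_qnorm[OF P(1) cop(2) this] nm Pn show False by simp
  qed
  have "b0 * (a * b' - a' * b) = (a * b0 - a0 * b) * b' - (a' * b0 - a0 * b') * b"
    by (simp add: algebra_simps)
  then have d1: "e dvd b0 * (a * b' - a' * b)" using e by simp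
  have "b0 * (a * b' - a' * b) = (a * b0 + a0 * b) * b' - (a' * b0 + a0 * b') * b"
    by (simp add: algebra_simps)
  then have d2: "h dvd b0 * (a * b' - a' * b)" using h1 h2 by simp
  have "n dvd b0 * (a * b' - a' * b)"
    unfolding h by (rule coprime_poly_mult_dvd[OF eh d1 d2])
  moreover have "coprime n b0"
    using irreducible_not_dvd_snd[OF _ cop(1)] nm
    by (intro coprime_poly_irreducibleI[OF \<open>n \<noteq> 0\<close>]) auto
  ultimately show ?thesis by (rule coprime_poly_dvd_mult_cancel[rotated])
qed

text \<open>
  Two elements of norm \<open>n\<close> in the same congruence class have quotient \<open>u * conj u' / n\<close>, which is then
  integral of norm \<open>1\<close>. In ideal language: both generate the ideal of norm \<open>n\<close> given by the common
  square root of \<open>\<alpha>\<close>.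
\<close>

lemma congruent_elements_associated:
  assumes cop: "coprime a b" and nm: "qnorm \<alpha> (a, b) = n" "qnorm \<alpha> (a', b') = n" and "n \<noteq> 0"
    and dv: "n dvd a * b' - a' * b"
  shows "\<exists>w. qnorm \<alpha> w = 1 \<and> (a, b) = qmul \<alpha> w (a', b')"
proof -
  have "b * (a * a' - b * b' * \<alpha>) = b' * qnorm \<alpha> (a, b) - a * (a * b' - a' * b)"
    by (simp add: qnorm_def power2_eq_square algebra_simps)
  then have "n dvd b * (a * a' - b * b' * \<alpha>)" using nm dv by simp
  moreover have "coprime n b"
    using irreducible_not_dvd_snd[OF _ cop] nm
    by (intro coprime_poly_irreducibleI[OF \<open>n \<noteq> 0\<close>]) auto
  ultimately have "n dvd a * a' - b * b' * \<alpha>" by (rule coprime_poly_dvd_mult_cancel[rotated])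
  then obtain c where c: "a * a' - b * b' * \<alpha> = n * c" by auto
  have "n dvd - (a * b' - a' * b)" using dv by (simp only: dvd_minus_iff)
  then have "n dvd a' * b - a * b'" by (simp only: minus_diff_eq)
  then obtain d where d: "a' * b - a * b' = n * d" by auto
  have "n * (c * a' + d * b' * \<alpha>) = (n * c) * a' + (n * d) * b' * \<alpha>" by (simp add: algebra_simps)
  also have "\<dots> = (a * a' - b * b' * \<alpha>) * a' + (a' * b - a * b') * b' * \<alpha>" by (simp only: c d)
  also have "\<dots> = a * qnorm \<alpha> (a', b')" by (simp add: qnorm_def power2_eq_square algebra_simps)
  finally have 1: "c * a' + d * b' * \<alpha> = a" using nm \<open>n \<noteq> 0\<close> by simp
  have "n * (c * b' + d * a') = (n * c) * b' + (n * d) * a'" by (simp add: algebra_simps)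
  also have "\<dots> = (a * a' - b * b' * \<alpha>) * b' + (a' * b - a * b') * a'" by (simp only: c d)
  also have "\<dots> = b * qnorm \<alpha> (a', b')" by (simp add: qnorm_def power2_eq_square algebra_simps)
  finally have 2: "c * b' + d * a' = b" using nm \<open>n \<noteq> 0\<close> by simp
  have eq: "(a, b) = qmul \<alpha> (c, d) (a', b')" using 1 2 by (simp add: qmul_def)
  then have "n = qnorm \<alpha> (c, d) * n" using nm by (metis qnorm_qmul)
  then have "qnorm \<alpha> (c, d) = 1" using \<open>n \<noteq> 0\<close> by simp
  with eq show ?thesis by blast
qed

text \<open>
  The divisor \<open>e\<close> of the preceding comparison determines a primitive element of norm \<open>n\<close> up to the at
  most \<open>q\<^sup>2\<close> elements of norm \<open>1\<close>.
\<close>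

lemma card_primitive_norm_le:
  assumes "n \<noteq> 0"
  shows "finite {u. coprime (fst u) (snd u) \<and> qnorm \<alpha> u = n} \<and>
         card {u. coprime (fst u) (snd u) \<and> qnorm \<alpha> u = n} \<le> CARD('a) ^ 2 * card {d. d dvd n}"
    (is "finite ?S \<and> _")
proof (cases "?S = {}")
  case False
  then obtain a0 b0 where u0: "(a0, b0) \<in> ?S" by fastforce
  \<comment> \<open>The elements whose comparison with \<open>(a0, b0)\<close> gives \<open>e\<close>, up to a unit; this spares choosing a gcd.\<close>
  define S where "S e = {u \<in> ?S. e dvd n \<and> e dvd fst u * b0 - a0 * snd u \<and>
      (\<exists>x y. e = x * n + y * (fst u * b0 - a0 * snd u))}" for e
  have S: "finite (S e) \<and> card (S e) \<le> CARD('a) ^ 2" for e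
  proof (cases "S e = {}")
    case False
    then obtain a' b' where u': "(a', b') \<in> S e" by fastforce
    have sub: "S e \<subseteq> (\<lambda>w. qmul \<alpha> w (a', b')) ` {w. qnorm \<alpha> w = 1}"
    proof
      fix u assume u: "u \<in> S e"
      obtain a b where ab: "u = (a, b)" by fastforce
      obtain x y where xy: "e = x * n + y * (a * b0 - a0 * b)"
        using u by (auto simp: S_def ab)
      obtain x' y' where xy': "e = x' * n + y' * (a' * b0 - a0 * b')"
        using u' by (auto simp: S_def)
      have "n dvd a * b' - a' * b"
        by (rule primitive_elements_congruent[OF _ _ _ _ _ _ assms _ _ _ xy xy'])
          (use u u' u0 in \<open>auto simp: S_def ab\<close>)
      moreover have "coprime a b" "qnorm \<alpha> (a, b) = n" "qnorm \<alpha> (a', b') = n"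
        using u u' by (auto simp: S_def ab)
      ultimately obtain w where "qnorm \<alpha> w = 1" "(a, b) = qmul \<alpha> w (a', b')"
        using congruent_elements_associated[of a b n a' b'] assms by blast
      then show "u \<in> (\<lambda>w. qmul \<alpha> w (a', b')) ` {w. qnorm \<alpha> w = 1}" using ab by blast
    qed
    then show ?thesis
      using surj_card_le[OF finite_norm_one sub] card_norm_one_le finite_subset[OF sub] finite_norm_one
      by auto
  qed auto
  have sub: "?S \<subseteq> (\<Union>e\<in>{d. d dvd n}. S e)"
  proof
    fix u assume u: "u \<in> ?S"
    obtain e x y where "e dvd n" "e dvd fst u * b0 - a0 * snd u"
        "e = x * n + y * (fst u * b0 - a0 * snd u)"
      using bezout_gcd_poly by blast
    then show "u \<in> (\<Union>e\<in>{d. d dvd n}. S e)" using u by (auto simp: S_def)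
  qed
  have fin: "finite (\<Union>e\<in>{d. d dvd n}. S e)"
    using S finite_divisors[OF assms] by blast
  have "card ?S \<le> card (\<Union>e\<in>{d. d dvd n}. S e)" by (rule card_mono[OF fin sub])
  also have "\<dots> \<le> (\<Sum>e\<in>{d. d dvd n}. card (S e))"
    by (rule card_UN_le[OF finite_divisors[OF assms]])
  also have "\<dots> \<le> card {d. d dvd n} * CARD('a) ^ 2"
    using S by (intro order.trans[OF sum_bounded_above[where K = "CARD('a) ^ 2"]]) auto
  finally show ?thesis using finite_subset[OF sub fin] by (simp add: mult.commute)
next
  case True
  show ?thesis unfolding True by simp
qed

text \<open>
  An element of norm \<open>n\<close> is its content \<open>g\<close> times a primitive element of norm \<open>n / g\<^sup>2\<close>.
\<close>

lemma card_norm_le: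
  assumes "n \<noteq> 0"
  shows "finite {u. qnorm \<alpha> u = n} \<and>
         card {u. qnorm \<alpha> u = n} \<le> CARD('a) ^ 2 * card {d. d dvd n} ^ 2"
proof -
  define G where "G = {g. g ^ 2 dvd n}"
  define S where "S g = (\<lambda>u. (g * fst u, g * snd u)) `
      {u. coprime (fst u) (snd u) \<and> qnorm \<alpha> u = n div g ^ 2}" for g
  have Gsub: "G \<subseteq> {d. d dvd n}"
    unfolding G_def by (auto simp: power2_eq_square dest: dvd_mult_left)
  then have finG: "finite G" using finite_divisors[OF assms] finite_subset by blast
  have S: "finite (S g) \<and> card (S g) \<le> CARD('a) ^ 2 * card {d. d dvd n}" if "g \<in> G" for g
  proof -
    have "g ^ 2 dvd n" using that by (simp add: G_def)
    then obtain k where k: "n = g ^ 2 * k" by (elim dvdE)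
    then have nz: "k \<noteq> 0" "g \<noteq> 0" using assms by auto
    have "{d. d dvd k} \<subseteq> {d. d dvd n}" unfolding k by auto
    then have "card {d. d dvd k} \<le> card {d. d dvd n}"
      by (intro card_mono finite_divisors assms)
    moreover have "n div g ^ 2 = k" using k nz by simp
    ultimately show ?thesis
      unfolding S_def using card_primitive_norm_le[OF nz(1)]
      by (auto intro!: order.trans[OF card_image_le] elim!: order.trans intro: mult_left_mono)
  qed
  have sub: "{u. qnorm \<alpha> u = n} \<subseteq> (\<Union>g\<in>G. S g)"
  proof
    fix u assume "u \<in> {u. qnorm \<alpha> u = n}"
    then have u: "qnorm \<alpha> u = n" by simp
    obtain g x y where g: "g dvd fst u" "g dvd snd u" "g = x * fst u + y * snd u"
      using bezout_gcd_poly by blast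
    from g(1,2) obtain a b where ab: "fst u = g * a" "snd u = g * b" by (elim dvdE)
    have "qnorm \<alpha> u = g ^ 2 * qnorm \<alpha> (a, b)"
      unfolding qnorm_def ab fst_conv snd_conv power_mult_distrib right_diff_distrib mult.assoc ..
    then have n: "n = g ^ 2 * qnorm \<alpha> (a, b)" using u by simp
    then have "g \<noteq> 0" using assms by auto
    have "g * (x * a + y * b) = x * fst u + y * snd u" unfolding ab by (simp add: algebra_simps)
    then have "g * (x * a + y * b) = g * 1" using g(3) by simp
    then have "x * a + y * b = 1" using \<open>g \<noteq> 0\<close> mult_left_cancel[of g] by blast
    then have "coprime a b" by (rule bezout_coprime)
    moreover have "n div g ^ 2 = qnorm \<alpha> (a, b)" using n \<open>g \<noteq> 0\<close> by simp
    moreover have "g \<in> G" using n by (simp add: G_def)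
    ultimately show "u \<in> (\<Union>g\<in>G. S g)"
      using ab by (auto simp: S_def prod_eq_iff intro!: bexI[of _ g] image_eqI[where x = "(a, b)"])
  qed
  have fin: "finite (\<Union>g\<in>G. S g)" using S finG by blast
  have "card {u. qnorm \<alpha> u = n} \<le> card (\<Union>g\<in>G. S g)" by (rule card_mono[OF fin sub])
  also have "\<dots> \<le> (\<Sum>g\<in>G. card (S g))" by (rule card_UN_le[OF finG])
  also have "\<dots> \<le> card G * (CARD('a) ^ 2 * card {d. d dvd n})"
    using S by (intro order.trans[OF sum_bounded_above[where K = "CARD('a) ^ 2 * card {d. d dvd n}"]]) auto
  also have "\<dots> \<le> card {d. d dvd n} * (CARD('a) ^ 2 * card {d. d dvd n})"
    using card_mono[OF finite_divisors[OF assms] Gsub] by (rule mult_right_mono) simp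
  finally show ?thesis
    using finite_subset[OF sub fin] by (simp add: power2_eq_square algebra_simps)
qed

text \<open>
  This is the substitute for the divisor bound in a quadratic ring without unique factorisation: a divisor
  \<open>u\<close> of \<open>m\<close> has a norm that divides the norm of \<open>m\<close>.
\<close>

lemma card_norm_dvd_le:
  assumes "M \<noteq> 0"
  shows "finite {u. qnorm \<alpha> u dvd M} \<and>
         card {u. qnorm \<alpha> u dvd M} \<le> CARD('a) ^ 2 * card {d. d dvd M} ^ 3"
proof -
  have eq: "{u. qnorm \<alpha> u dvd M} = (\<Union>n\<in>{d. d dvd M}. {u. qnorm \<alpha> u = n})" by auto
  have S: "finite {u. qnorm \<alpha> u = n} \<and> card {u. qnorm \<alpha> u = n} \<le> CARD('a) ^ 2 * card {d. d dvd M} ^ 2"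
    if "n dvd M" for n
  proof -
    have "n \<noteq> 0" using that assms by auto
    have "{d. d dvd n} \<subseteq> {d. d dvd M}" using that dvd_trans by blast
    then have "card {d. d dvd n} ^ 2 \<le> card {d. d dvd M} ^ 2"
      by (intro power_mono card_mono finite_divisors assms) auto
    with card_norm_le[OF \<open>n \<noteq> 0\<close>] show ?thesis
      by (auto elim!: order.trans)
  qed
  have "card {u. qnorm \<alpha> u dvd M} \<le> (\<Sum>n\<in>{d. d dvd M}. card {u. qnorm \<alpha> u = n})"
    unfolding eq by (rule card_UN_le[OF finite_divisors[OF assms]])
  also have "\<dots> \<le> card {d. d dvd M} * (CARD('a) ^ 2 * card {d. d dvd M} ^ 2)"
    using S by (intro order.trans[OF sum_bounded_above[where K = "CARD('a) ^ 2 * card {d. d dvd M} ^ 2"]]) auto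
  finally show ?thesis
    using S finite_divisors[OF assms] unfolding eq by (auto simp: power3_eq_cube power2_eq_square algebra_simps)
qed

end

section \<open>The large sieve over a finite vector space\<close>

locale additive_character =
  fixes \<psi> :: "'a::finite_field \<Rightarrow> complex"
  assumes add: "\<psi> (x + y) = \<psi> x * \<psi> y"
    and norm_one: "cmod (\<psi> x) = 1"
    and nontrivial: "\<exists>x. \<psi> x \<noteq> 1"
begin

text \<open>
  Orthogonality: translating the coordinate \<open>i\<close> multiplies the sum by a value of the character different
  from \<open>1\<close>.
\<close>

lemma sum_over_frequencies:
  fixes w :: "'i \<Rightarrow> 'a"
  assumes I: "finite I" and i: "i \<in> I" "w i \<noteq> 0"
  shows "(\<Sum>c\<in>I \<rightarrow>\<^sub>E UNIV. \<psi> (\<Sum>j\<in>I. w j * c j)) = 0"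
proof -
  define T where "T = (\<Sum>c\<in>I \<rightarrow>\<^sub>E UNIV. \<psi> (\<Sum>j\<in>I. w j * c j))"
  obtain x where x: "\<psi> x \<noteq> 1" using nontrivial by blast
  \<comment> \<open>The shift by \<open>s\<close> in coordinate \<open>i\<close> changes the argument of \<open>\<psi>\<close> by exactly \<open>x\<close>.\<close>
  define s where "s = x / w i"
  have shift: "(\<Sum>j\<in>I. w j * (c(i := c i + s)) j) = x + (\<Sum>j\<in>I. w j * c j)" for c
  proof -
    have "(\<Sum>j\<in>I. w j * (c(i := c i + s)) j) =
        w i * (c i + s) + (\<Sum>j\<in>I - {i}. w j * c j)"
      using I i by (simp add: sum.remove)
    also have "\<dots> = x + (w i * c i + (\<Sum>j\<in>I - {i}. w j * c j))"
      using i by (simp add: s_def algebra_simps)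
    also have "w i * c i + (\<Sum>j\<in>I - {i}. w j * c j) = (\<Sum>j\<in>I. w j * c j)"
      using I i by (simp add: sum.remove)
    finally show ?thesis .
  qed
  have "T = (\<Sum>c\<in>I \<rightarrow>\<^sub>E UNIV. \<psi> (\<Sum>j\<in>I. w j * (c(i := c i + s)) j))"
    unfolding T_def
    by (rule sum.reindex_bij_witness[of _ "\<lambda>c. c(i := c i + s)" "\<lambda>c. c(i := c i - s)"])
      (use i in \<open>auto simp: fun_eq_iff PiE_iff extensional_def\<close>)
  also have "\<dots> = \<psi> x * T"
    by (simp only: shift add T_def sum_distrib_left)
  finally have "T * (1 - \<psi> x) = 0" by (simp add: algebra_simps)
  then show ?thesis using x by (simp add: T_def)
qed

lemma zero: "\<psi> 0 = 1"
  using add[of 0 0] norm_one[of 0] by (metis add_0 mult_cancel_left2 norm_zero zero_neq_one)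

lemma cnj_character: "cnj (\<psi> x) = \<psi> (- x)"
proof -
  have "\<psi> x * \<psi> (- x) = 1" using add[of x "- x"] zero by simp
  moreover have "\<psi> x * cnj (\<psi> x) = 1"
    using complex_norm_square[of "\<psi> x"] norm_one[of x] by simp
  moreover have "\<psi> x \<noteq> 0" using norm_one[of x] by auto
  ultimately show ?thesis by (metis mult_left_cancel)
qed

text \<open>
  Each \<open>g\<close> is seen only through its coordinate vector \<open>v g\<close> in \<open>F\<^sub>q ^ I\<close>, and distinct \<open>g\<close> have distinct
  vectors. The right-hand side is then the norm of a function on \<open>F\<^sub>q ^ I\<close>, up to the factor
  \<open>q ^ card I\<close>, and the left-hand side that of its Fourier transform.
\<close>

lemma parseval:
  fixes v :: "'g \<Rightarrow> 'i \<Rightarrow> 'a" and a :: "'g \<Rightarrow> complex"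
  assumes I: "finite I" and G: "finite G"
    and inj: "\<And>g g'. g \<in> G \<Longrightarrow> g' \<in> G \<Longrightarrow> g \<noteq> g' \<Longrightarrow> \<exists>i\<in>I. v g i \<noteq> v g' i"
  shows "(\<Sum>c\<in>I \<rightarrow>\<^sub>E UNIV. (cmod (\<Sum>g\<in>G. a g * \<psi> (\<Sum>i\<in>I. v g i * c i))) ^ 2) =
         real (CARD('a) ^ card I) * (\<Sum>g\<in>G. (cmod (a g)) ^ 2)"
proof -
  let ?F = "I \<rightarrow>\<^sub>E (UNIV :: 'a set)"
  have orth: "(\<Sum>c\<in>?F. \<psi> (\<Sum>i\<in>I. v g i * c i) * cnj (\<psi> (\<Sum>i\<in>I. v g' i * c i))) =
      (if g = g' then of_nat (CARD('a) ^ card I) else 0)" if "g \<in> G" "g' \<in> G" for g g'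
  proof -
    have "\<psi> (\<Sum>i\<in>I. v g i * c i) * cnj (\<psi> (\<Sum>i\<in>I. v g' i * c i)) =
        \<psi> (\<Sum>i\<in>I. (v g i - v g' i) * c i)" for c
      by (simp add: cnj_character add[symmetric] sum_subtractf left_diff_distrib)
    moreover have "(\<Sum>c\<in>?F. \<psi> (\<Sum>i\<in>I. (v g i - v g' i) * c i)) = 0" if "g \<noteq> g'"
    proof -
      obtain i where "i \<in> I" "v g i \<noteq> v g' i" using inj \<open>g \<in> G\<close> \<open>g' \<in> G\<close> \<open>g \<noteq> g'\<close> by blast
      then show ?thesis
        by (intro sum_over_frequencies[OF I, of i]) auto
    qed
    ultimately show ?thesis using I by (simp add: card_PiE zero)
  qed
  have "complex_of_real (\<Sum>c\<in>?F. (cmod (\<Sum>g\<in>G. a g * \<psi> (\<Sum>i\<in>I. v g i * c i))) ^ 2) =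
      (\<Sum>c\<in>?F. (\<Sum>g\<in>G. a g * \<psi> (\<Sum>i\<in>I. v g i * c i)) *
        cnj (\<Sum>g\<in>G. a g * \<psi> (\<Sum>i\<in>I. v g i * c i)))"
    by (simp only: of_real_sum complex_norm_square)
  also have "\<dots> = (\<Sum>c\<in>?F. \<Sum>g\<in>G. \<Sum>g'\<in>G. (a g * cnj (a g')) *
        (\<psi> (\<Sum>i\<in>I. v g i * c i) * cnj (\<psi> (\<Sum>i\<in>I. v g' i * c i))))"
    by (simp add: sum_product cnj_sum mult_ac)
  also have "\<dots> = (\<Sum>g\<in>G. \<Sum>g'\<in>G. (a g * cnj (a g')) *
        (\<Sum>c\<in>?F. \<psi> (\<Sum>i\<in>I. v g i * c i) * cnj (\<psi> (\<Sum>i\<in>I. v g' i * c i))))"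
    unfolding sum_distrib_left
    by (subst sum.swap, rule sum.cong[OF refl], subst sum.swap, rule refl)
  also have "\<dots> = (\<Sum>g\<in>G. \<Sum>g'\<in>G. if g = g' then (a g * cnj (a g')) * of_nat (CARD('a) ^ card I) else 0)"
    by (intro sum.cong refl) (simp add: orth)
  also have "\<dots> = (\<Sum>g\<in>G. a g * cnj (a g) * of_nat (CARD('a) ^ card I))"
    using G by (simp add: sum.delta)
  also have "\<dots> = complex_of_real (real (CARD('a) ^ card I) * (\<Sum>g\<in>G. (cmod (a g)) ^ 2))"
    by (simp only: of_real_mult of_real_sum complex_norm_square of_real_of_nat_eq sum_distrib_left mult.commute)
  finally show ?thesis by (simp only: of_real_eq_iff)
qed

text \<open>
  A large sieve in which well-spacing is replaced by a count: the exponential sum at \<open>j\<close> depends only on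
  the frequency vector \<open>y j\<close> in \<open>F\<^sub>q ^ I\<close>, so the sum over \<open>j\<close> is at most the multiplicity \<open>B\<close> times
  the sum over all frequency vectors.
\<close>

lemma large_sieve_fibres:
  fixes v :: "'g \<Rightarrow> 'i \<Rightarrow> 'a" and a :: "'g \<Rightarrow> complex" and y :: "'j \<Rightarrow> 'i \<Rightarrow> 'a"
  assumes I: "finite I" and G: "finite G"
    and inj: "\<And>g g'. g \<in> G \<Longrightarrow> g' \<in> G \<Longrightarrow> g \<noteq> g' \<Longrightarrow> \<exists>i\<in>I. v g i \<noteq> v g' i"
    and fibre: "\<And>j0. j0 \<in> J \<Longrightarrow>
      finite {j \<in> J. \<forall>i\<in>I. y j i = y j0 i} \<and> real (card {j \<in> J. \<forall>i\<in>I. y j i = y j0 i}) \<le> B"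
    and "B \<ge> 0"
  shows "finite J" and
    "(\<Sum>j\<in>J. (cmod (\<Sum>g\<in>G. a g * \<psi> (\<Sum>i\<in>I. v g i * y j i))) ^ 2) \<le>
      B * real (CARD('a) ^ card I) * (\<Sum>g\<in>G. (cmod (a g)) ^ 2)"
proof -
  let ?F = "I \<rightarrow>\<^sub>E (UNIV :: 'a set)"
  have finF: "finite ?F" using I by (intro finite_PiE) auto
  define \<kappa> where "\<kappa> j = restrict (y j) I" for j
  define S where "S c = (cmod (\<Sum>g\<in>G. a g * \<psi> (\<Sum>i\<in>I. v g i * c i))) ^ 2" for c
  have fib: "finite {j \<in> J. \<kappa> j = c} \<and> real (card {j \<in> J. \<kappa> j = c}) \<le> B" for c
  proof (cases "{j \<in> J. \<kappa> j = c} = {}")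
    case True
    show ?thesis unfolding True using \<open>B \<ge> 0\<close> by simp
  next
    case False
    then obtain j0 where j0: "j0 \<in> J" "c = \<kappa> j0" by auto
    have "{j \<in> J. \<kappa> j = c} = {j \<in> J. \<forall>i\<in>I. y j i = y j0 i}"
      unfolding j0(2) by (auto simp: \<kappa>_def fun_eq_iff restrict_def)
    then show ?thesis using fibre[OF j0(1)] by simp
  qed
  have J: "J = (\<Union>c\<in>?F. {j \<in> J. \<kappa> j = c})" by (auto simp: \<kappa>_def)
  show finJ: "finite J" using fib finF by (subst J) blast
  have "(\<Sum>j\<in>J. S (y j)) = (\<Sum>j\<in>J. S (\<kappa> j))"
    unfolding S_def \<kappa>_def by (intro sum.cong refl) simp
  also have "\<dots> = (\<Sum>c\<in>?F. \<Sum>j\<in>{j \<in> J. \<kappa> j = c}. S (\<kappa> j))"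
    by (rule sum.group[symmetric]) (auto simp: finJ finF \<kappa>_def)
  also have "\<dots> = (\<Sum>c\<in>?F. real (card {j \<in> J. \<kappa> j = c}) * S c)" by simp
  also have "\<dots> \<le> (\<Sum>c\<in>?F. B * S c)"
    using fib by (intro sum_mono mult_right_mono) (auto simp: S_def)
  also have "\<dots> = B * (real (CARD('a) ^ card I) * (\<Sum>g\<in>G. (cmod (a g)) ^ 2))"
    unfolding sum_distrib_left[symmetric] S_def by (subst parseval[OF I G inj]) auto
  finally show "(\<Sum>j\<in>J. (cmod (\<Sum>g\<in>G. a g * \<psi> (\<Sum>i\<in>I. v g i * y j i))) ^ 2) \<le>
      B * real (CARD('a) ^ card I) * (\<Sum>g\<in>G. (cmod (a g)) ^ 2)"
    by (simp add: S_def mult.assoc)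
qed

end

lemma exp_root_of_unity_cong:
  assumes "[i = j] (mod p)"
  shows "exp (2 * of_real pi * \<i> / of_nat p * of_nat i) = exp (2 * of_real pi * \<i> / of_nat p * of_nat j)"
proof (cases "p = 0")
  case False
  have *: "exp (2 * of_real pi * \<i> / of_nat p * of_nat k) =
      exp (2 * of_real pi * \<i> / of_nat p * of_nat (k mod p))" for k
  proof -
    have "(of_nat k :: complex) = of_nat (k div p * p + k mod p)" by simp
    also have "\<dots> = of_nat (k div p) * of_nat p + of_nat (k mod p)"
      by (simp only: of_nat_add of_nat_mult)
    finally have "2 * of_real pi * \<i> / of_nat p * of_nat k =
        (of_nat (k div p)) * (2 * of_real pi * \<i>) + 2 * of_real pi * \<i> / of_nat p * (of_nat (k mod p) :: complex)"
      using False by (simp add: field_simps)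
    then show ?thesis
      by (simp only: exp_add exp_of_nat_mult exp_two_pi_i power_one mult_1)
  qed
  show ?thesis using assms *[of i] *[of j] by (simp only: cong_def)
qed (use assms in simp)

text \<open>
  The character is additive because the trace is. It is nontrivial because the trace is a polynomial
  function of degree at most \<open>p ^ (n - 1)\<close>, which is less than the number of elements of the field.
\<close>

lemma additive_character_char_Fq:
  assumes p: "prime p" and q: "CARD('a::finite_field) = p ^ n"
  shows "additive_character (char_Fq p n :: 'a \<Rightarrow> complex)"
proof
  define m where "m x = (THE m. m < p \<and> of_nat m = (prime_field_trace p n x :: 'a))" for x
  have m: "m x < p" "of_nat (m x) = (prime_field_trace p n x :: 'a)" for x
    using theI'[OF prime_field_trace_in_prime_field[OF p q, of x]] by (simp_all add: m_def)
  have eq: "char_Fq p n x = exp (2 * of_real pi * \<i> / of_nat p * of_nat (m x))" for x :: 'a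
    by (simp add: char_Fq_def m_def)
  have ch: "CHAR('a) = p" by (rule CHAR_eq[OF p q])
  fix x y :: 'a
  have "prime_field_trace p n (x + y) = prime_field_trace p n x + prime_field_trace p n y"
    unfolding prime_field_trace_def sum.distrib[symmetric]
    using p ch by (intro sum.cong refl freshmans_dream') auto
  then have "(of_nat (m (x + y)) :: 'a) = of_nat (m x + m y)" by (simp add: m)
  then have "[m (x + y) = m x + m y] (mod p)" by (simp only: of_nat_eq_iff_cong_CHAR ch)
  then have "char_Fq p n (x + y) = exp (2 * of_real pi * \<i> / of_nat p * of_nat (m x + m y))"
    unfolding eq by (rule exp_root_of_unity_cong)
  then show "char_Fq p n (x + y) = char_Fq p n x * char_Fq p n y"
    by (simp only: eq of_nat_add distrib_left exp_add)
  have "2 * of_real pi * \<i> / of_nat p * of_nat (m x) = \<i> * of_real (2 * pi / p * m x)"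
    by simp
  then show "cmod (char_Fq p n x) = 1"
    unfolding eq norm_exp_eq_Re by (simp only: Re_i_times Im_complex_of_real) simp
  show "\<exists>x :: 'a. char_Fq p n x \<noteq> 1"
  proof -
    have p2: "p > 1" using p by (rule prime_gt_1_nat)
    have "card {0, 1 :: 'a} \<le> CARD('a)" by (intro card_mono) auto
    then have n: "n > 0" using q by (cases n) auto
    define P where "P = (\<Sum>i<n. monom 1 (p ^ i) :: 'a poly)"
    have "coeff P 1 = (\<Sum>i<n. if i = 0 then 1 else 0)"
      unfolding P_def coeff_sum coeff_monom using p2 by (intro sum.cong refl) auto
    then have "coeff P 1 = 1" using n by simp
    then have P0: "P \<noteq> 0" by auto
    have "degree P \<le> p ^ (n - 1)"
      unfolding P_def using p2
      by (intro degree_sum_le) (auto intro!: order.trans[OF degree_monom_le] power_increasing)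
    then have "card {z. poly P z = 0} \<le> p ^ (n - 1)"
      using card_poly_roots_bound[OF P0] by simp
    also have "\<dots> < CARD('a)" unfolding q using p2 n by (intro power_strict_increasing) auto
    finally have "{z. poly P z = 0} \<noteq> UNIV" by auto
    then obtain z where "poly P z \<noteq> 0" by auto
    then have z: "prime_field_trace p n z \<noteq> 0"
      by (simp add: P_def poly_sum poly_monom prime_field_trace_def)
    have "m z \<noteq> 0" using z m(2)[of z] by (metis of_nat_0)
    have "char_Fq p n z \<noteq> 1"
    proof
      assume "char_Fq p n z = 1"
      moreover have "2 * of_real pi * \<i> / of_nat p * of_nat (m z) = \<i> * of_real (2 * pi / p * m z)"
        by simp
      ultimately have "cis (2 * pi / p * m z) = 1" by (simp only: eq cis_conv_exp)
      then have "cos (2 * pi / p * m z) = 1" by (metis cis.sel(1) one_complex.sel(1))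
      then obtain k :: int where "2 * pi / p * m z = of_int k * 2 * pi"
        unfolding cos_one_2pi_int by auto
      then have "real (m z) = of_int k * real p" using p2 by (simp add: field_simps)
      then have "int (m z) = k * int p" by (metis of_int_eq_iff of_int_mult of_int_of_nat_eq)
      then have "p dvd m z" by (metis dvd_triv_right int_dvd_int_iff)
      with \<open>m z \<noteq> 0\<close> m(1)[of z] show False by (auto dest: dvd_imp_le)
    qed
    then show ?thesis by blast
  qed
qed

section \<open>Sizes at the infinite place\<close>

context imaginary_quadratic
begin

abbreviation int_mult :: "'a poly \<times> 'a poly \<Rightarrow> 'a poly \<times> 'a poly \<Rightarrow> 'a poly \<times> 'a poly"
    (infixl "\<odot>" 70) where
  "u \<odot> v \<equiv> qmul \<alpha> u v"

abbreviation kinf_mult :: "'a fls \<times> 'a fls \<Rightarrow> 'a fls \<times> 'a fls \<Rightarrow> 'a fls \<times> 'a fls"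
    (infixl "\<star>" 70) where
  "x \<star> y \<equiv> qmul (poly_to_kinf \<alpha>) x y"

definition emb :: "'a poly \<times> 'a poly \<Rightarrow> 'a fls \<times> 'a fls" where
  "emb u = (poly_to_kinf (fst u), poly_to_kinf (snd u))"

text \<open>
  The norm \<open>\<^bold>N\<close> on the completion, as the absolute value of the algebraic norm.
\<close>

definition size_inf :: "'a fls \<times> 'a fls \<Rightarrow> real" where
  "size_inf x = abs_kinf (qnorm (poly_to_kinf \<alpha>) x)"

text \<open>
  The integers \<open>u\<close> with \<open>\<^bold>N(u) \<le> q ^ m\<close>; the zero element is covered by \<open>degree 0 = 0\<close>.
\<close>

definition int_ball :: "nat \<Rightarrow> ('a poly \<times> 'a poly) set" where
  "int_ball m = {u. degree (qnorm \<alpha> u) \<le> m}"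

lemma emb_diff: "emb (u - v) = emb u - emb v"
  by (simp add: emb_def poly_to_kinf_diff)

lemma emb_mult: "emb (u \<odot> v) = emb u \<star> emb v"
  by (simp add: emb_def qmul_def poly_to_kinf_add poly_to_kinf_mult)

lemma size_inf_mult: "size_inf (x \<star> y) = size_inf x * size_inf y"
  by (simp add: size_inf_def qnorm_qmul abs_kinf_mult)

lemma size_inf_max:
  "size_inf (x, y) = max (abs_kinf x ^ 2) (abs_kinf y ^ 2 * real CARD('a) ^ degree \<alpha>)"
  using abs_kinf_quad_norm[OF alpha_nonzero nonsquare_at_infinity, of x y]
  by (simp add: size_inf_def qnorm_def abs_kinf_poly alpha_nonzero)

lemma size_inf_diff_le: "size_inf (x - y) \<le> max (size_inf x) (size_inf y)"
proof -
  obtain a b c d where xy: "x = (a, b)" "y = (c, d)" by fastforce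
  have sq: "abs_kinf (u - v) ^ 2 \<le> max (abs_kinf u ^ 2) (abs_kinf v ^ 2)" for u v :: "'a fls"
  proof -
    have "abs_kinf (u - v) \<le> max (abs_kinf u) (abs_kinf v)"
      using abs_kinf_add_le[of u "- v"] by simp
    then have "abs_kinf (u - v) ^ 2 \<le> max (abs_kinf u) (abs_kinf v) ^ 2"
      by (intro power_mono) auto
    also have "\<dots> \<le> max (abs_kinf u ^ 2) (abs_kinf v ^ 2)" by (auto simp: max_def)
    finally show ?thesis .
  qed
  have "abs_kinf (b - d) ^ 2 * real CARD('a) ^ degree \<alpha> \<le>
      max (abs_kinf b ^ 2) (abs_kinf d ^ 2) * real CARD('a) ^ degree \<alpha>"
    using sq by (intro mult_right_mono) auto
  then have "abs_kinf (b - d) ^ 2 * real CARD('a) ^ degree \<alpha> \<le>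
      max (abs_kinf b ^ 2 * real CARD('a) ^ degree \<alpha>) (abs_kinf d ^ 2 * real CARD('a) ^ degree \<alpha>)"
    by (simp add: max_mult_distrib_right)
  with sq[of a c] show ?thesis
    unfolding xy diff_Pair size_inf_max by linarith
qed

lemma size_inf_emb: "size_inf (emb u) = (if u = 0 then 0 else real CARD('a) ^ degree (qnorm \<alpha> u))"
  using poly_to_kinf_qnorm[of \<alpha> "fst u" "snd u"] qnorm_eq_0_iff[of u]
  by (auto simp: size_inf_def emb_def abs_kinf_poly)

lemma int_ball_iff: "u \<in> int_ball m \<longleftrightarrow> size_inf (emb u) \<le> real CARD('a) ^ m"
proof (cases "u = 0")
  case True
  then show ?thesis using one_less_card by (simp add: int_ball_def size_inf_emb qnorm_def)
next
  case False
  then show ?thesis using one_less_card by (simp add: int_ball_def size_inf_emb)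
qed

text \<open>
  Sizes below \<open>1\<close> occur for quotients, so bounds are kept multiplied by \<open>q ^ N\<close>. For an integer the
  truncated subtraction is right: an integer of size less than \<open>1\<close> is \<open>0\<close>.
\<close>

lemma int_ball_scaled:
  assumes "size_inf (emb u) * real CARD('a) ^ N \<le> real CARD('a) ^ m"
  shows "u \<in> int_ball (m - N)"
proof (cases "u = 0")
  case True
  then show ?thesis by (simp add: int_ball_def qnorm_def)
next
  case False
  then have "real CARD('a) ^ (degree (qnorm \<alpha> u) + N) \<le> real CARD('a) ^ m"
    using assms by (simp add: size_inf_emb power_add)
  then have "degree (qnorm \<alpha> u) + N \<le> m" using one_less_card by simp
  then show ?thesis by (simp add: int_ball_def)
qed

lemma int_ball_subset: "int_ball m \<subseteq> polys_below (m div 2 + 1) \<times> polys_below (m div 2 + 1)"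
proof
  fix u assume u: "u \<in> int_ball m"
  show "u \<in> polys_below (m div 2 + 1) \<times> polys_below (m div 2 + 1)"
  proof (cases "u = 0")
    case True
    then show ?thesis by (auto simp: mem_Times_iff polys_below_def)
  next
    case False
    obtain a b where ab: "u = (a, b)" by fastforce
    have nz: "(a, b) \<noteq> (0, 0)" using False ab by (simp add: zero_prod_def)
    have "2 * degree a \<le> m" "2 * degree b \<le> m"
      using qnorm_degree(2,3)[OF nz] u ab by (cases "b = 0", auto simp: int_ball_def)+
    then have "degree a < m div 2 + 1" "degree b < m div 2 + 1" by linarith+
    then show ?thesis by (auto simp: ab intro: polys_below_degree)
  qed
qed

lemma finite_int_ball: "finite (int_ball m)"
  by (rule finite_subset[OF int_ball_subset]) (auto intro: finite_polys_below)

lemma card_int_ball_le: "real (card (int_ball m)) \<le> real CARD('a) ^ (m + 2)"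
proof -
  have "card (int_ball m) \<le> card (polys_below (m div 2 + 1) \<times> polys_below (m div 2 + 1) :: ('a poly \<times> 'a poly) set)"
    by (rule card_mono[OF _ int_ball_subset]) (auto intro: finite_polys_below)
  also have "\<dots> \<le> CARD('a) ^ (m div 2 + 1) * CARD('a) ^ (m div 2 + 1)"
    unfolding card_cartesian_product by (intro mult_mono card_polys_below_le) auto
  also have "\<dots> = CARD('a) ^ ((m div 2 + 1) + (m div 2 + 1))" by (simp only: power_add)
  also have "\<dots> \<le> CARD('a) ^ (m + 2)"
    using one_less_card by (intro power_increasing) auto
  finally have "real (card (int_ball m)) \<le> real (CARD('a) ^ (m + 2))" by (simp only: of_nat_le_iff)
  then show ?thesis by simp
qed

lemma int_mult_eq_0_iff: "u \<odot> v = 0 \<longleftrightarrow> u = 0 \<or> v = 0"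
  by (metis qnorm_eq_0_iff qnorm_qmul mult_eq_0_iff)

lemma int_mult_left_cancel: "u \<noteq> 0 \<Longrightarrow> u \<odot> v = u \<odot> w \<longleftrightarrow> v = w"
  using int_mult_eq_0_iff[of u "v - w"] by (simp add: qmul_diff_right)

lemma double_eq_0_iff: "u + u = 0 \<longleftrightarrow> u = 0" for u :: "'a poly \<times> 'a poly"
proof -
  have "f + f = 0 \<longleftrightarrow> f = 0" for f :: "'a poly"
  proof -
    have "f + f = smult 2 f" using smult_add_left[of 1 1 f] by simp
    then show ?thesis using odd_characteristic by simp
  qed
  then show ?thesis by (simp add: prod_eq_iff)
qed

lemma degree_qnorm_mult:
  assumes "u \<noteq> 0" "v \<noteq> 0"
  shows "degree (qnorm \<alpha> (u \<odot> v)) = degree (qnorm \<alpha> u) + degree (qnorm \<alpha> v)"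
  using assms by (simp add: qnorm_qmul degree_mult_eq qnorm_eq_0_iff)

end

section \<open>Fractions with square denominators close to a given one\<close>

text \<open>
  The fraction \<open>x = r0 / f0\<^sup>2\<close> is fixed and \<open>W\<close> is a set of pairs \<open>(f, r)\<close> for which \<open>r / f\<^sup>2\<close> is close
  to \<open>x\<close> modulo integers. The numerators are pairwise incongruent modulo \<open>f\<^sup>2\<close>, and \<open>D\<close> bounds the
  number of integers whose norm divides a given polynomial of degree at most \<open>2 * Q\<close>. The aim is to
  bound the number of elements of \<open>W\<close>.
\<close>

locale close_fractions = imaginary_quadratic \<alpha>
  for \<alpha> :: "'a::finite_field poly" +
  fixes Q N :: nat and f0 r0 s t :: "'a poly \<times> 'a poly" and x :: "'a fls \<times> 'a fls"
    and W :: "(('a poly \<times> 'a poly) \<times> ('a poly \<times> 'a poly)) set" and D :: real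
  assumes f0: "f0 \<noteq> 0" "degree (qnorm \<alpha> f0) = Q"
    and x: "emb (f0 \<odot> f0) \<star> x = emb r0"
    and comaximal: "s \<odot> r0 + t \<odot> (f0 \<odot> f0) = (1, 0)"
    and W_norm: "(f, r) \<in> W \<Longrightarrow> f \<noteq> 0 \<and> degree (qnorm \<alpha> f) = Q"
    and W_close: "(f, r) \<in> W \<Longrightarrow> \<exists>y w \<epsilon>. emb (f \<odot> f) \<star> y = emb r \<and>
      y = x + emb w + \<epsilon> \<and> size_inf \<epsilon> * real CARD('a) ^ N \<le> real CARD('a) ^ degree \<alpha>"
    and W_distinct: "(f, r) \<in> W \<Longrightarrow> (f, r') \<in> W \<Longrightarrow> r - r' = k \<odot> (f \<odot> f) \<Longrightarrow> r = r'"
    and D: "M \<noteq> 0 \<Longrightarrow> degree M \<le> 2 * Q \<Longrightarrow> real (card {u. qnorm \<alpha> u dvd M}) \<le> D"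
begin

text \<open>
  Multiplying the closeness of \<open>r / f\<^sup>2\<close> and \<open>x\<close> by \<open>f\<^sup>2\<close> shows that some numerator congruent to \<open>r\<close>
  is within \<open>q powr (2 * Q + degree \<alpha> - N)\<close> of \<open>f\<^sup>2 * x\<close>.
\<close>

lemma reduced_numerator:
  assumes "(f, r) \<in> W"
  shows "\<exists>w. size_inf (emb (r - w \<odot> (f \<odot> f)) - emb (f \<odot> f) \<star> x) * real CARD('a) ^ N \<le> real CARD('a) ^ (2 * Q + degree \<alpha>)"
proof -
  obtain y w \<epsilon> where y: "emb (f \<odot> f) \<star> y = emb r" "y = x + emb w + \<epsilon>"
      "size_inf \<epsilon> * real CARD('a) ^ N \<le> real CARD('a) ^ degree \<alpha>"
    using W_close[OF assms] by blast
  have f: "f \<noteq> 0" "degree (qnorm \<alpha> f) = Q" using W_norm[OF assms] by auto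
  have "emb (r - w \<odot> (f \<odot> f)) - emb (f \<odot> f) \<star> x =
      emb (f \<odot> f) \<star> (x + emb w + \<epsilon>) - emb w \<star> emb (f \<odot> f) - emb (f \<odot> f) \<star> x"
    using y by (simp add: emb_diff emb_mult[of w])
  also have "\<dots> = emb (f \<odot> f) \<star> \<epsilon>"
    by (simp add: qmul_add_right qmul_commute[of _ "emb w"])
  finally have "size_inf (emb (r - w \<odot> (f \<odot> f)) - emb (f \<odot> f) \<star> x) = real CARD('a) ^ (2 * Q) * size_inf \<epsilon>"
    using f by (simp add: size_inf_mult size_inf_emb int_mult_eq_0_iff degree_qnorm_mult mult_2)
  then have "size_inf (emb (r - w \<odot> (f \<odot> f)) - emb (f \<odot> f) \<star> x) * real CARD('a) ^ N =
      real CARD('a) ^ (2 * Q) * (size_inf \<epsilon> * real CARD('a) ^ N)" by simp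
  also have "\<dots> \<le> real CARD('a) ^ (2 * Q) * real CARD('a) ^ degree \<alpha>"
    by (intro mult_left_mono y) simp
  finally have "size_inf (emb (r - w \<odot> (f \<odot> f)) - emb (f \<odot> f) \<star> x) * real CARD('a) ^ N
      \<le> real CARD('a) ^ (2 * Q + degree \<alpha>)" by (simp only: power_add)
  then show ?thesis by blast
qed

text \<open>
  For a given \<open>f\<close> the reduced numerators all lie in one small ball around \<open>f\<^sup>2 * x\<close>, and they determine
  the residue classes.
\<close>

lemma card_numerators_le:
  "finite {r. (f, r) \<in> W} \<and>
   real (card {r. (f, r) \<in> W}) \<le> real CARD('a) ^ (2 * Q + degree \<alpha> - N + 2)"
proof (cases "{r. (f, r) \<in> W} = {}")
  case True
  show ?thesis unfolding True by simp
next
  case False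
  then obtain r1 where r1: "(f, r1) \<in> W" by blast
  obtain w where w: "\<And>r. (f, r) \<in> W \<Longrightarrow>
      size_inf (emb (r - w r \<odot> (f \<odot> f)) - emb (f \<odot> f) \<star> x) * real CARD('a) ^ N \<le> real CARD('a) ^ (2 * Q + degree \<alpha>)"
    using reduced_numerator[of f] by metis
  define \<rho> where "\<rho> r = r - w r \<odot> (f \<odot> f)" for r
  have inj: "inj_on (\<lambda>r. \<rho> r - \<rho> r1) {r. (f, r) \<in> W}"
  proof (rule inj_onI)
    fix r r' assume r: "r \<in> {r. (f, r) \<in> W}" "r' \<in> {r. (f, r) \<in> W}" "\<rho> r - \<rho> r1 = \<rho> r' - \<rho> r1"
    then have "r - r' = (w r - w r') \<odot> (f \<odot> f)"
      by (simp add: \<rho>_def qmul_diff_left algebra_simps)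
    with r W_distinct show "r = r'" by auto
  qed
  have sub: "(\<lambda>r. \<rho> r - \<rho> r1) ` {r. (f, r) \<in> W} \<subseteq> int_ball (2 * Q + degree \<alpha> - N)"
  proof (clarsimp)
    fix r assume r: "(f, r) \<in> W"
    let ?X = "emb (f \<odot> f) \<star> x"
    have "size_inf (emb (\<rho> r - \<rho> r1)) = size_inf ((emb (\<rho> r) - ?X) - (emb (\<rho> r1) - ?X))"
      by (simp add: emb_diff)
    also have "\<dots> \<le> max (size_inf (emb (\<rho> r) - ?X)) (size_inf (emb (\<rho> r1) - ?X))"
      by (rule size_inf_diff_le)
    finally have "size_inf (emb (\<rho> r - \<rho> r1)) * real CARD('a) ^ N \<le>
        max (size_inf (emb (\<rho> r) - ?X)) (size_inf (emb (\<rho> r1) - ?X)) * real CARD('a) ^ N"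
      by (intro mult_right_mono) auto
    also have "\<dots> \<le> real CARD('a) ^ (2 * Q + degree \<alpha>)"
      using w[OF r] w[OF r1] by (simp add: max_def \<rho>_def)
    finally show "\<rho> r - \<rho> r1 \<in> int_ball (2 * Q + degree \<alpha> - N)" by (rule int_ball_scaled)
  qed
  have "card {r. (f, r) \<in> W} \<le> card (int_ball (2 * Q + degree \<alpha> - N))"
    by (rule card_inj_on_le[OF inj sub finite_int_ball])
  moreover have "finite {r. (f, r) \<in> W}"
    using inj sub finite_int_ball by (metis finite_imageD finite_subset)
  ultimately show ?thesis
    using card_int_ball_le[of "2 * Q + degree \<alpha> - N"] by linarith
qed

definition moduli where "moduli = fst ` W"

lemma moduli_norm: "f \<in> moduli \<Longrightarrow> f \<noteq> 0 \<and> degree (qnorm \<alpha> f) = Q"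
  using W_norm by (auto simp: moduli_def)

lemma moduli_subset: "moduli \<subseteq> int_ball Q"
  using moduli_norm by (auto simp: int_ball_def)

lemma finite_moduli: "finite moduli"
  by (rule finite_subset[OF moduli_subset finite_int_ball])

lemma finite_W_card_le:
  "finite W" "real (card W) \<le> real (card moduli) * real CARD('a) ^ (2 * Q + degree \<alpha> - N + 2)"
proof -
  have eq: "W = (SIGMA f:moduli. {r. (f, r) \<in> W})" by (force simp: moduli_def)
  show "finite W" by (subst eq) (intro finite_SigmaI finite_moduli, use card_numerators_le in auto)
  have "real (card W) = (\<Sum>f\<in>moduli. real (card {r. (f, r) \<in> W}))"
    by (subst eq, subst card_SigmaI) (use finite_moduli card_numerators_le in auto)
  also have "\<dots> \<le> real (card moduli) * real CARD('a) ^ (2 * Q + degree \<alpha> - N + 2)"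
    using card_numerators_le by (intro sum_bounded_above) auto
  finally show "real (card W) \<le> real (card moduli) * real CARD('a) ^ (2 * Q + degree \<alpha> - N + 2)" .
qed

definition square_diff where "square_diff = (\<lambda>(f, f'). f \<odot> f - f' \<odot> f')"

text \<open>
  The differencing step: the condition on \<open>f\<^sup>2\<close> becomes one on the product of \<open>f - f'\<close> and \<open>f + f'\<close>,
  which is linear in that product.
\<close>

lemma square_diff_factor: "square_diff (f, f') = (f - f') \<odot> (f + f')"
  by (simp add: square_diff_def qmul_add_right qmul_diff_left qmul_commute[of _ f f'])

lemma moduli_diff_sum_in_ball:
  assumes "f \<in> moduli" "f' \<in> moduli"
  shows "f - f' \<in> int_ball Q" "f + f' \<in> int_ball Q"
proof -
  have le: "size_inf (emb f) \<le> real CARD('a) ^ Q" "size_inf (emb f') \<le> real CARD('a) ^ Q"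
    using assms moduli_subset int_ball_iff by blast+
  have "size_inf (emb (f - f')) \<le> max (size_inf (emb f)) (size_inf (emb f'))"
    unfolding emb_diff by (rule size_inf_diff_le)
  then show "f - f' \<in> int_ball Q" using le by (auto simp: int_ball_iff)
  have "size_inf (emb (0 - f')) \<le> max (size_inf (emb 0)) (size_inf (emb f'))"
    unfolding emb_diff by (rule size_inf_diff_le)
  moreover have "size_inf (emb (f - (0 - f'))) \<le> max (size_inf (emb f)) (size_inf (emb (0 - f')))"
    unfolding emb_diff[of f] by (rule size_inf_diff_le)
  moreover have "size_inf (emb 0) \<le> real CARD('a) ^ Q" by (simp add: size_inf_emb)
  ultimately have "size_inf (emb (f - (0 - f'))) \<le> real CARD('a) ^ Q" using le by linarith
  then show "f + f' \<in> int_ball Q" by (simp add: int_ball_iff)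
qed

text \<open>
  The factor \<open>f - f'\<close> of \<open>m\<close> determines the cofactor \<open>f + f'\<close>, and both determine \<open>f\<close> and \<open>f'\<close> in odd
  characteristic. So the number of pairs is bounded by a number of divisors.
\<close>

lemma card_pairs_with_square_diff_le:
  assumes "m \<noteq> 0"
  shows "real (card {p \<in> moduli \<times> moduli. square_diff p = m}) \<le> D"
proof (cases "{p \<in> moduli \<times> moduli. square_diff p = m} = {}")
  case True
  \<comment> \<open>Only the sign of \<open>D\<close> matters here, and the bound for the polynomial \<open>1\<close> provides it.\<close>
  have "real (card {u. qnorm \<alpha> u dvd 1}) \<le> D" by (rule D) auto
  then show ?thesis unfolding True by (simp add: order.trans[rotated])
next
  case False
  then obtain f1 f1' where p1: "f1 \<in> moduli" "f1' \<in> moduli" "square_diff (f1, f1') = m" by auto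
  have nz: "qnorm \<alpha> m \<noteq> 0" using assms by (simp add: qnorm_eq_0_iff)
  have "f1 - f1' \<noteq> 0" "f1 + f1' \<noteq> 0"
    using p1(3) assms unfolding square_diff_factor int_mult_eq_0_iff[symmetric] by auto
  then have deg: "degree (qnorm \<alpha> m) \<le> 2 * Q"
    using moduli_diff_sum_in_ball[OF p1(1,2)] p1(3)
    unfolding square_diff_factor by (auto simp: degree_qnorm_mult int_ball_def)
  have "inj_on (\<lambda>(f, f'). f - f') {p \<in> moduli \<times> moduli. square_diff p = m}"
  proof (rule inj_onI, clarify)
    fix f f' g g'
    assume m: "m = square_diff (f, f')" "square_diff (g, g') = square_diff (f, f')"
      and eq: "f - f' = g - g'"
    have "f - f' \<noteq> 0" using m(1) assms by (auto simp: square_diff_factor)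
    then have sum: "f + f' = g + g'"
      using m(2) eq by (simp add: square_diff_factor int_mult_left_cancel)
    have "(f - g) + (f - g) = (f + f' + (f - f')) - (g + g' + (g - g'))" by (simp add: algebra_simps)
    also have "\<dots> = 0" unfolding sum eq by simp
    finally have "f = g" by (simp add: double_eq_0_iff)
    with sum show "f = g \<and> f' = g'" by simp
  qed
  moreover have "(\<lambda>(f, f'). f - f') ` {p \<in> moduli \<times> moduli. square_diff p = m} \<subseteq> {u. qnorm \<alpha> u dvd qnorm \<alpha> m}"
    by (auto simp: square_diff_factor qnorm_qmul)
  ultimately have "card {p \<in> moduli \<times> moduli. square_diff p = m} \<le> card {u. qnorm \<alpha> u dvd qnorm \<alpha> m}"
    using card_norm_dvd_le[OF nz] by (intro card_inj_on_le) auto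
  with D[OF nz deg] show ?thesis by linarith
qed

text \<open>
  As \<open>r0\<close> is invertible modulo \<open>f0\<^sup>2\<close>, the residue \<open>z\<close> of \<open>r0 * m\<close> determines \<open>m\<close> modulo \<open>f0\<^sup>2\<close>. The ball
  has the size of the modulus, so it meets each residue class only boundedly often.
\<close>

lemma card_congruent_differences_le:
  "finite {m \<in> int_ball (2 * Q). \<exists>k. z = r0 \<odot> m - k \<odot> (f0 \<odot> f0)} \<and>
   real (card {m \<in> int_ball (2 * Q). \<exists>k. z = r0 \<odot> m - k \<odot> (f0 \<odot> f0)}) \<le> real CARD('a) ^ 2"
proof (cases "{m \<in> int_ball (2 * Q). \<exists>k. z = r0 \<odot> m - k \<odot> (f0 \<odot> f0)} = {}")
  case True
  show ?thesis unfolding True by simp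
next
  case False
  let ?S = "{m \<in> int_ball (2 * Q). \<exists>k. z = r0 \<odot> m - k \<odot> (f0 \<odot> f0)}"
  obtain m1 k1 where m1: "m1 \<in> int_ball (2 * Q)" "z = r0 \<odot> m1 - k1 \<odot> (f0 \<odot> f0)" using False by auto
  have sub: "?S \<subseteq> (\<lambda>j. m1 + j \<odot> (f0 \<odot> f0)) ` int_ball 0"
  proof
    fix m assume "m \<in> ?S"
    then obtain k where m: "m \<in> int_ball (2 * Q)" "z = r0 \<odot> m - k \<odot> (f0 \<odot> f0)" by auto
    have eq: "r0 \<odot> (m - m1) = (k - k1) \<odot> (f0 \<odot> f0)"
      using m(2) m1(2) by (simp add: qmul_diff_left qmul_diff_right algebra_simps)
    define j where "j = s \<odot> (k - k1) + t \<odot> (m - m1)"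
    have "m - m1 = (s \<odot> r0 + t \<odot> (f0 \<odot> f0)) \<odot> (m - m1)" by (simp add: comaximal)
    also have "\<dots> = s \<odot> (r0 \<odot> (m - m1)) + t \<odot> (m - m1) \<odot> (f0 \<odot> f0)"
      by (subst qmul_add_left) (simp only: qmul_ac)
    also have "\<dots> = j \<odot> (f0 \<odot> f0)" by (simp only: eq j_def qmul_add_left qmul_assoc)
    finally have mj: "m - m1 = j \<odot> (f0 \<odot> f0)" .
    have "size_inf (emb (m - m1)) \<le> max (size_inf (emb m)) (size_inf (emb m1))"
      unfolding emb_diff by (rule size_inf_diff_le)
    also have "\<dots> \<le> real CARD('a) ^ (2 * Q)" using m(1) m1(1) by (simp add: int_ball_iff)
    finally have "j \<odot> (f0 \<odot> f0) \<in> int_ball (2 * Q)" by (simp add: int_ball_iff mj)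
    have "j \<in> int_ball 0"
    proof (cases "j = 0")
      case False
      with f0 \<open>j \<odot> (f0 \<odot> f0) \<in> int_ball (2 * Q)\<close> show ?thesis
        by (simp add: int_ball_def degree_qnorm_mult int_mult_eq_0_iff)
    qed (simp add: int_ball_def qnorm_def)
    moreover have "m = m1 + j \<odot> (f0 \<odot> f0)" using mj by (simp add: algebra_simps)
    ultimately show "m \<in> (\<lambda>j. m1 + j \<odot> (f0 \<odot> f0)) ` int_ball 0" by blast
  qed
  have "card ?S \<le> card (int_ball 0)" by (rule surj_card_le[OF finite_int_ball sub])
  moreover have "finite ?S" by (rule finite_subset[OF sub]) (intro finite_imageI finite_int_ball)
  moreover have "real (card (int_ball 0)) \<le> real CARD('a) ^ 2"
    using card_int_ball_le[of 0] by (simp only: add_0)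
  ultimately show ?thesis by (meson of_nat_mono order.trans)
qed

text \<open>
  If \<open>f\<^sup>2 * x\<close> and \<open>f'\<^sup>2 * x\<close> are close to integers, so is \<open>m * x\<close> for \<open>m = f\<^sup>2 - f'\<^sup>2\<close>. Multiplied by
  \<open>f0\<^sup>2\<close>, this says that \<open>r0 * m\<close> has a small residue modulo \<open>f0\<^sup>2\<close>.
\<close>

lemma square_diff_congruence:
  assumes "f \<in> moduli" "f' \<in> moduli"
  shows "\<exists>z\<in>int_ball (4 * Q + degree \<alpha> - N). \<exists>k. z = r0 \<odot> square_diff (f, f') - k \<odot> (f0 \<odot> f0)"
proof -
  have num: "\<exists>\<rho>. size_inf (emb \<rho> - emb (f \<odot> f) \<star> x) * real CARD('a) ^ N \<le> real CARD('a) ^ (2 * Q + degree \<alpha>)"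
    if "f \<in> moduli" for f
  proof -
    have "\<exists>r. (f, r) \<in> W" using that by (force simp: moduli_def)
    then obtain r where "(f, r) \<in> W" by (elim exE)
    from reduced_numerator[OF this] show ?thesis by blast
  qed
  obtain \<rho> \<rho>' where \<rho>: "size_inf (emb \<rho> - emb (f \<odot> f) \<star> x) * real CARD('a) ^ N \<le> real CARD('a) ^ (2 * Q + degree \<alpha>)"
      "size_inf (emb \<rho>' - emb (f' \<odot> f') \<star> x) * real CARD('a) ^ N \<le> real CARD('a) ^ (2 * Q + degree \<alpha>)"
    using num assms by blast
  define z where "z = r0 \<odot> square_diff (f, f') - (\<rho> - \<rho>') \<odot> (f0 \<odot> f0)"
  let ?a = "emb \<rho>' - emb (f' \<odot> f') \<star> x" and ?b = "emb \<rho> - emb (f \<odot> f) \<star> x"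
  have "emb z = emb (f0 \<odot> f0) \<star> x \<star> (emb (f \<odot> f) - emb (f' \<odot> f')) -
      (emb \<rho> - emb \<rho>') \<star> emb (f0 \<odot> f0)"
    unfolding z_def square_diff_def x
    by (simp add: emb_diff emb_mult[of r0] emb_mult[of _ "f0 \<odot> f0"])
  also have "\<dots> = emb (f0 \<odot> f0) \<star> (?a - ?b)"
    by (simp add: qmul_distribs qmul_ac algebra_simps)
  finally have "size_inf (emb z) = real CARD('a) ^ (2 * Q) * size_inf (?a - ?b)"
    using f0 by (simp add: size_inf_mult size_inf_emb int_mult_eq_0_iff degree_qnorm_mult mult_2)
  also have "\<dots> \<le> real CARD('a) ^ (2 * Q) * max (size_inf ?a) (size_inf ?b)"
    by (intro mult_left_mono size_inf_diff_le) simp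
  finally have "size_inf (emb z) * real CARD('a) ^ N \<le> real CARD('a) ^ (2 * Q) * max (size_inf ?a) (size_inf ?b) * real CARD('a) ^ N"
    by (rule mult_right_mono) simp
  also have "\<dots> = real CARD('a) ^ (2 * Q) * (max (size_inf ?a) (size_inf ?b) * real CARD('a) ^ N)" by simp
  also have "\<dots> \<le> real CARD('a) ^ (2 * Q) * real CARD('a) ^ (2 * Q + degree \<alpha>)"
    using \<rho> by (intro mult_left_mono) (auto simp: max_def)
  also have "\<dots> = real CARD('a) ^ (4 * Q + degree \<alpha>)" by (simp add: power_add[symmetric])
  finally have "z \<in> int_ball (4 * Q + degree \<alpha> - N)" by (rule int_ball_scaled)
  then show ?thesis unfolding z_def by blast
qed

text \<open>
  All pairs \<open>(f, f')\<close> are counted by the value \<open>m\<close> of \<open>f\<^sup>2 - f'\<^sup>2\<close>. For \<open>m = 0\<close> only \<open>f' = f\<close> and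
  \<open>f' = - f\<close> occur. The nonzero \<open>m\<close> are few by the congruence they satisfy, and each comes from few pairs
  by the divisor bound.
\<close>

lemma card_moduli_square_le:
  "real (card moduli) ^ 2 \<le> 2 * real CARD('a) ^ (Q + 2) + real CARD('a) ^ (4 * Q + degree \<alpha> - N + 4) * D"
proof -
  \<comment> \<open>The nonzero differences of squares.\<close>
  define Ms where "Ms = square_diff ` (moduli \<times> moduli) - {0}"
  have finP: "finite (moduli \<times> moduli)" using finite_moduli by simp
  have D0: "D \<ge> 0" using order.trans[OF _ D[of 1]] by simp
  define B where "B = int_ball (4 * Q + degree \<alpha> - N)"
  have sub: "Ms \<subseteq> (\<Union>z\<in>B. {m \<in> int_ball (2 * Q). \<exists>k. z = r0 \<odot> m - k \<odot> (f0 \<odot> f0)})"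
  proof
    fix m assume "m \<in> Ms"
    then obtain f f' where f: "f \<in> moduli" "f' \<in> moduli" "m = square_diff (f, f')" "m \<noteq> 0"
      by (auto simp: Ms_def)
    have "f - f' \<noteq> 0" "f + f' \<noteq> 0"
      using f(3,4) unfolding square_diff_factor by (auto simp: int_mult_eq_0_iff)
    then have "m \<in> int_ball (2 * Q)"
      using moduli_diff_sum_in_ball[OF f(1,2)]
      unfolding f(3) square_diff_factor by (auto simp: degree_qnorm_mult int_ball_def)
    with square_diff_congruence[OF f(1,2)]
    show "m \<in> (\<Union>z\<in>B. {m \<in> int_ball (2 * Q). \<exists>k. z = r0 \<odot> m - k \<odot> (f0 \<odot> f0)})"
      unfolding B_def f(3) by blast
  qed
  have "card Ms \<le> card (\<Union>z\<in>B. {m \<in> int_ball (2 * Q). \<exists>k. z = r0 \<odot> m - k \<odot> (f0 \<odot> f0)})"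
    using card_congruent_differences_le finite_int_ball unfolding B_def
    by (intro card_mono[OF _ sub[unfolded B_def]]) blast
  also have "\<dots> \<le> (\<Sum>z\<in>B. card {m \<in> int_ball (2 * Q). \<exists>k. z = r0 \<odot> m - k \<odot> (f0 \<odot> f0)})"
    unfolding B_def by (rule card_UN_le[OF finite_int_ball])
  finally have "real (card Ms) \<le>
      (\<Sum>z\<in>B. real (card {m \<in> int_ball (2 * Q). \<exists>k. z = r0 \<odot> m - k \<odot> (f0 \<odot> f0)}))"
    by (simp only: of_nat_sum[symmetric] of_nat_le_iff)
  also have "\<dots> \<le> real (card B) * real CARD('a) ^ 2"
    using card_congruent_differences_le by (intro sum_bounded_above) auto
  also have "\<dots> \<le> real CARD('a) ^ (4 * Q + degree \<alpha> - N + 2) * real CARD('a) ^ 2"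
    unfolding B_def by (intro mult_right_mono card_int_ball_le) simp
  also have "\<dots> = real CARD('a) ^ (4 * Q + degree \<alpha> - N + 4)" by (simp only: power_add[symmetric] add.assoc) simp
  finally have Ms: "real (card Ms) \<le> real CARD('a) ^ (4 * Q + degree \<alpha> - N + 4)" .
  have "{p \<in> moduli \<times> moduli. square_diff p = 0} \<subseteq> (\<lambda>f. (f, f)) ` moduli \<union> (\<lambda>f. (f, - f)) ` moduli"
  proof clarify
    fix f f' assume f: "f \<in> moduli" "f' \<in> moduli" "square_diff (f, f') = 0"
      and n: "(f, f') \<notin> (\<lambda>f. (f, - f)) ` moduli"
    from f(3) have "f - f' = 0 \<or> f + f' = 0" by (simp add: square_diff_factor int_mult_eq_0_iff)
    moreover have "f' \<noteq> - f" using n f(1) by blast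
    ultimately have "f' = f" by (auto simp: add_eq_0_iff)
    then show "(f, f') \<in> (\<lambda>f. (f, f)) ` moduli" using f(1) by blast
  qed
  then have "card {p \<in> moduli \<times> moduli. square_diff p = 0} \<le>
      card ((\<lambda>f. (f, f)) ` moduli \<union> (\<lambda>f. (f, - f)) ` moduli)"
    by (rule card_mono[rotated]) (use finite_moduli in auto)
  also have "\<dots> \<le> card ((\<lambda>f. (f, f)) ` moduli) + card ((\<lambda>f. (f, - f)) ` moduli)" by (rule card_Un_le)
  also have "\<dots> \<le> card moduli + card moduli" by (intro add_mono card_image_le finite_moduli)
  finally have "real (card {p \<in> moduli \<times> moduli. square_diff p = 0}) \<le> 2 * real (card moduli)" by simp
  also have "\<dots> \<le> 2 * real CARD('a) ^ (Q + 2)"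
    using card_mono[OF finite_int_ball moduli_subset] card_int_ball_le[of Q] by linarith
  finally have zero: "real (card {p \<in> moduli \<times> moduli. square_diff p = 0}) \<le> 2 * real CARD('a) ^ (Q + 2)" .
  have "moduli \<times> moduli \<subseteq> {p \<in> moduli \<times> moduli. square_diff p = 0} \<union>
      (\<Union>m\<in>Ms. {p \<in> moduli \<times> moduli. square_diff p = m})"
    by (auto simp: Ms_def)
  then have "card (moduli \<times> moduli) \<le> card ({p \<in> moduli \<times> moduli. square_diff p = 0} \<union>
      (\<Union>m\<in>Ms. {p \<in> moduli \<times> moduli. square_diff p = m}))"
    by (rule card_mono[rotated]) (use finP in \<open>auto simp: Ms_def\<close>)
  also have "\<dots> \<le> card {p \<in> moduli \<times> moduli. square_diff p = 0} +
      card (\<Union>m\<in>Ms. {p \<in> moduli \<times> moduli. square_diff p = m})" by (rule card_Un_le)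
  also have "\<dots> \<le> card {p \<in> moduli \<times> moduli. square_diff p = 0} +
      (\<Sum>m\<in>Ms. card {p \<in> moduli \<times> moduli. square_diff p = m})"
    using finP by (intro add_left_mono card_UN_le) (simp add: Ms_def)
  finally have "real (card (moduli \<times> moduli)) \<le> real (card {p \<in> moduli \<times> moduli. square_diff p = 0}) +
      (\<Sum>m\<in>Ms. real (card {p \<in> moduli \<times> moduli. square_diff p = m}))"
    by (simp only: of_nat_sum[symmetric] of_nat_add[symmetric] of_nat_le_iff)
  also have "(\<Sum>m\<in>Ms. real (card {p \<in> moduli \<times> moduli. square_diff p = m})) \<le> real (card Ms) * D"
    by (intro sum_bounded_above card_pairs_with_square_diff_le) (auto simp: Ms_def)
  also have "\<dots> \<le> real CARD('a) ^ (4 * Q + degree \<alpha> - N + 4) * D" using Ms D0 by (rule mult_right_mono)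
  finally show ?thesis using zero by (simp add: card_cartesian_product power2_eq_square)
qed

end

section \<open>Coefficients of Laurent series\<close>

text \<open>
  Laurent series are indexed by the exponent of \<open>1/t\<close>, so multiplication by \<open>t ^ i\<close> brings the coefficient
  at \<open>k + i\<close> to \<open>k\<close>. For \<open>k = 1\<close>
  this is the residue that the additive character reads off: a pairing of the coefficients of \<open>g\<close> with the
  first \<open>n\<close> coefficients of the fractional part of \<open>y\<close>.
\<close>

lemma fls_nth_poly_mult:
  fixes g :: "'a::field poly"
  assumes "g \<in> polys_below n"
  shows "fls_nth (poly_to_kinf g * y) k = (\<Sum>i<n. coeff g i * fls_nth y (k + int i))"
proof -
  have main: "fls_nth (poly_to_kinf g * y) k = (\<Sum>i<n. coeff g i * fls_nth y (k + int i))"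
    if "\<And>i. i \<ge> n \<Longrightarrow> coeff g i = 0" for n k
    using that
  proof (induction g arbitrary: n k)
    case 0
    then show ?case by simp
  next
    case (pCons c g)
    have "fls_nth (fls_X_inv * (poly_to_kinf g * y)) k = fls_nth (poly_to_kinf g * y) (k + 1)"
      using fls_X_inv_times_conv_shift(1)[of "poly_to_kinf g * y"] by simp
    then have eq: "fls_nth (poly_to_kinf (pCons c g) * y) k =
        c * fls_nth y k + fls_nth (poly_to_kinf g * y) (k + 1)"
      by (simp add: distrib_right mult.assoc)
    show ?case
    proof (cases n)
      case 0
      have "pCons c g = 0"
        using pCons.prems by (intro poly_eqI) (simp add: 0)
      then show ?thesis using 0 by simp
    next
      case (Suc n')
      have "fls_nth (poly_to_kinf g * y) (k + 1) = (\<Sum>i<n'. coeff g i * fls_nth y (k + 1 + int i))"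
        by (rule pCons.IH) (use pCons.prems[of "Suc _"] Suc in simp)
      then show ?thesis
        unfolding eq Suc sum.lessThan_Suc_shift by (simp add: add_ac)
    qed
  qed
  show ?thesis using assms by (intro main) (simp add: polys_below_def)
qed

lemma ex_polynomial_part:
  fixes h :: "'a::field fls"
  shows "\<exists>w. \<forall>i\<le>0. fls_nth (h - poly_to_kinf w) i = 0"
proof -
  define k where "k = nat (1 - fls_subdegree h)"
  define w where "w = Poly (map (\<lambda>j. fls_nth h (- int j)) [0..<k])"
  have "coeff w j = fls_nth h (- int j)" for j
    by (auto simp: w_def nth_default_def k_def intro!: fls_eq0_below_subdegree[symmetric])
  then have "fls_nth (h - poly_to_kinf w) i = 0" if "i \<le> 0" for i
    using that by (simp add: fls_nth_poly_to_kinf)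
  then show ?thesis by blast
qed

lemma abs_kinf_le_of_nth_eq_0:
  fixes \<epsilon> :: "'a::finite_field fls"
  assumes "\<And>i. i \<le> int n \<Longrightarrow> fls_nth \<epsilon> i = 0"
  shows "abs_kinf \<epsilon> ^ 2 * real CARD('a) ^ (2 * n + 2) \<le> 1"
proof (cases "\<epsilon> = 0")
  case True
  then show ?thesis by (simp add: abs_kinf_def)
next
  case False
  have "fls_subdegree \<epsilon> \<ge> int (n + 1)"
  proof (rule ccontr)
    assume "\<not> fls_subdegree \<epsilon> \<ge> int (n + 1)"
    then have "fls_nth \<epsilon> (fls_subdegree \<epsilon>) = 0" by (intro assms) simp
    with False show False by simp
  qed
  then have "abs_kinf \<epsilon> \<le> real CARD('a) powi (- int (n + 1))"
    using False one_le_CARD[where 'a = 'a] by (auto simp: abs_kinf_def intro!: power_int_increasing)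
  then have "abs_kinf \<epsilon> * real CARD('a) ^ (n + 1) \<le> real CARD('a) powi (- int (n + 1)) * real CARD('a) ^ (n + 1)"
    by (rule mult_right_mono) simp
  also have "\<dots> = 1" unfolding power_int_minus power_int_of_nat by (rule left_inverse) simp
  finally have "(abs_kinf \<epsilon> * real CARD('a) ^ (n + 1)) ^ 2 \<le> 1 ^ 2" by (intro power_mono) auto
  moreover have "(real CARD('a) ^ (n + 1)) ^ 2 = real CARD('a) ^ (2 * n + 2)"
    unfolding power_mult[symmetric] by (simp add: mult.commute)
  ultimately show ?thesis by (simp only: power_mult_distrib power_one)
qed

section \<open>From the abstract field to pairs of polynomials\<close>

lemma k_to_kinf_add: "k_to_kinf (x + y) = k_to_kinf x + k_to_kinf y"
proof -
  obtain a b where x: "x = Fract a b" "b \<noteq> 0" by (cases x)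
  obtain c d where y: "y = Fract c d" "d \<noteq> 0" by (cases y)
  show ?thesis using x(2) y(2)
    by (simp add: x(1) y(1) k_to_kinf_Fract poly_to_kinf_add poly_to_kinf_mult field_simps)
qed

lemma k_to_kinf_mult: "k_to_kinf (x * y) = k_to_kinf x * k_to_kinf y"
proof -
  obtain a b where x: "x = Fract a b" "b \<noteq> 0" by (cases x)
  obtain c d where y: "y = Fract c d" "d \<noteq> 0" by (cases y)
  show ?thesis using x(2) y(2)
    by (simp add: x(1) y(1) k_to_kinf_Fract poly_to_kinf_mult)
qed

lemma K_to_Kinf_mult: "K_to_Kinf (x \<otimes>\<^bsub>K \<alpha>\<^esub> y) = qmul (poly_to_kinf \<alpha>) (K_to_Kinf x) (K_to_Kinf y)"
  by (cases x; cases y) (simp add: K_to_Kinf_def qmul_def k_to_kinf_add k_to_kinf_mult)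

lemma comaximal_bezout:
  assumes "comaximal R r f" and "\<one>\<^bsub>R\<^esub> \<in> carrier R"
  shows "\<exists>a\<in>carrier R. \<exists>b\<in>carrier R. (a \<otimes>\<^bsub>R\<^esub> r) \<oplus>\<^bsub>R\<^esub> (b \<otimes>\<^bsub>R\<^esub> f) = \<one>\<^bsub>R\<^esub>"
proof -
  have "\<one>\<^bsub>R\<^esub> \<in> (PIdl\<^bsub>R\<^esub> r) <+>\<^bsub>R\<^esub> (PIdl\<^bsub>R\<^esub> f)" using assms by (simp add: comaximal_def)
  then obtain a b where "a \<in> carrier R" "b \<in> carrier R"
      "\<one>\<^bsub>R\<^esub> = (a \<otimes>\<^bsub>R\<^esub> r) \<oplus>\<^bsub>R\<^esub> (b \<otimes>\<^bsub>R\<^esub> f)"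
    unfolding set_add_def' cgenideal_def by blast
  then show ?thesis by metis
qed

context imaginary_quadratic
begin

definition fract_pair :: "'a poly \<times> 'a poly \<Rightarrow> 'a poly fract \<times> 'a poly fract" where
  "fract_pair u = (to_fract (fst u), to_fract (snd u))"

lemma fract_pair_eq_iff [simp]: "fract_pair u = fract_pair v \<longleftrightarrow> u = v"
  by (auto simp: fract_pair_def prod_eq_iff)

lemma fract_pair_mult: "fract_pair u \<otimes>\<^bsub>K \<alpha>\<^esub> fract_pair v = fract_pair (u \<odot> v)"
  by (simp add: fract_pair_def qmul_def)

lemma fract_pair_add: "fract_pair u \<oplus>\<^bsub>K \<alpha>\<^esub> fract_pair v = fract_pair (u + v)"
  by (simp add: fract_pair_def)

lemma fract_pair_0: "fract_pair 0 = \<zero>\<^bsub>K \<alpha>\<^esub>"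
  by (simp add: fract_pair_def)

lemma fract_pair_1: "fract_pair (1, 0) = \<one>\<^bsub>K \<alpha>\<^esub>"
  by (simp add: fract_pair_def)

lemma K_to_Kinf_fract_pair: "K_to_Kinf (fract_pair u) = emb u"
  by (simp add: K_to_Kinf_def fract_pair_def emb_def)

lemma carrier_K_integers: "carrier (K_integers \<alpha>) = range fract_pair"
  by (auto simp: K_integers_def fract_pair_def image_iff)

lemma K_integers_ops:
  "x \<otimes>\<^bsub>K_integers \<alpha>\<^esub> y = x \<otimes>\<^bsub>K \<alpha>\<^esub> y" "x \<oplus>\<^bsub>K_integers \<alpha>\<^esub> y = x \<oplus>\<^bsub>K \<alpha>\<^esub> y"
  "\<one>\<^bsub>K_integers \<alpha>\<^esub> = \<one>\<^bsub>K \<alpha>\<^esub>"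
  by (simp_all add: K_integers_def)

lemma fract_pair_square:
  "fract_pair f [^]\<^bsub>K \<alpha>\<^esub> (2::nat) = fract_pair (f \<odot> f)"
  "fract_pair f [^]\<^bsub>K_integers \<alpha>\<^esub> (2::nat) = fract_pair (f \<odot> f)"
proof -
  have "\<one>\<^bsub>K \<alpha>\<^esub> \<otimes>\<^bsub>K \<alpha>\<^esub> fract_pair f = fract_pair f"
    by (simp only: fract_pair_1[symmetric] fract_pair_mult qmul_one)
  then show "fract_pair f [^]\<^bsub>K \<alpha>\<^esub> (2::nat) = fract_pair (f \<odot> f)"
    "fract_pair f [^]\<^bsub>K_integers \<alpha>\<^esub> (2::nat) = fract_pair (f \<odot> f)"
    by (simp_all add: nat_pow_def numeral_2_eq_2 K_integers_ops fract_pair_mult del: quad_ext_simps)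
qed

lemma norm_Kinf_eq: "norm_Kinf \<alpha> x = size_inf x"
  by (cases x) (simp add: norm_Kinf_def abs_Kinf_eq[OF alpha_nonzero nonsquare_at_infinity]
      size_inf_def qnorm_def)

lemma ball_Kinf_zero_iff: "emb u \<in> ball_Kinf \<alpha> \<zero>\<^bsub>Kinf \<alpha>\<^esub> (real N) \<longleftrightarrow> u \<in> int_ball N"
proof -
  interpret KI: cring "Kinf \<alpha>" by (rule cring_quad_ext)
  have "emb u \<ominus>\<^bsub>Kinf \<alpha>\<^esub> \<zero>\<^bsub>Kinf \<alpha>\<^esub> = emb u"
    unfolding a_minus_def using KI.minus_zero KI.r_zero[of "emb u"] by (simp del: quad_ext_simps(4))
  then show ?thesis
    unfolding ball_Kinf_def mem_Collect_eq
    using one_less_card by (simp add: norm_Kinf_eq int_ball_iff powr_realpow del: quad_ext_simps)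
qed

text \<open>
  A square root of \<open>\<alpha>\<close> would be a zero of the norm form already over the completion at infinity.
\<close>

lemma alpha_not_square: "\<nexists>c. to_fract \<alpha> = c ^ 2"
proof
  assume "\<exists>c. to_fract \<alpha> = c ^ 2"
  then obtain c where "to_fract \<alpha> = c * c" by (auto simp: power2_eq_square)
  then have "poly_to_kinf \<alpha> = k_to_kinf c ^ 2"
    by (metis k_to_kinf_to_fract k_to_kinf_mult power2_eq_square)
  then have "size_inf (k_to_kinf c, 1) = 0"
    by (simp add: size_inf_def qnorm_def)
  moreover have "size_inf (k_to_kinf c, 1) \<ge> abs_kinf (1 :: 'a fls) ^ 2 * real CARD('a) ^ degree \<alpha>"
    unfolding size_inf_max by (rule max.cobounded2)
  moreover have "real CARD('a) ^ degree \<alpha> > 0" by simp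
  moreover have "abs_kinf (1 :: 'a fls) = 1" by (simp add: abs_kinf_def)
  ultimately show False by (simp only: power_one mult_1)
qed

text \<open>
  The reciprocal of \<open>2 * sqrt \<alpha> * f\<^sup>2\<close>, as it stands in the exponential sum.
\<close>

definition twist_inverse where
  "twist_inverse f = inv\<^bsub>K \<alpha>\<^esub> (([(2::nat)] \<cdot>\<^bsub>K \<alpha>\<^esub> quad_sqrt) \<otimes>\<^bsub>K \<alpha>\<^esub> (f [^]\<^bsub>K \<alpha>\<^esub> (2::nat)))"

text \<open>
  The image of \<open>r / f\<^sup>2\<close> in the completion.
\<close>

definition frequency where
  "frequency f r = (0, 2) \<star> (K_to_Kinf r \<star> K_to_Kinf (twist_inverse f))"

lemma emb_two_sqrt: "emb (0, 2) = (0, 2)"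
proof -
  have "poly_to_kinf 2 = (2 :: 'a fls)"
    using poly_to_kinf_add[of 1 1] by (simp del: poly_to_kinf_pCons)
  then show ?thesis by (simp add: emb_def)
qed

lemma frequency_eq:
  assumes "f \<noteq> 0"
  shows "emb (f \<odot> f) \<star> frequency (fract_pair f) (fract_pair r) = emb r"
proof -
  interpret KF: Ring.field "K \<alpha>" by (rule field_quad_ext[OF alpha_not_square])
  have two: "[(2::nat)] \<cdot>\<^bsub>K \<alpha>\<^esub> quad_sqrt = fract_pair (0, 2)"
  proof -
    have "to_fract (2 :: 'a poly) = 1 + 1"
      using to_fract_add[of 1 "1 :: 'a poly"] by simp
    then show ?thesis
      by (simp add: add_pow_def nat_pow_def numeral_2_eq_2 quad_sqrt_def fract_pair_def)
  qed
  have nz: "(0, 2) \<odot> (f \<odot> f) \<noteq> 0"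
  proof -
    have "coeff (2 :: 'a poly) 0 = 2" by (metis coeff_pCons_0 numeral_poly)
    then have "(2 :: 'a poly) \<noteq> 0" using odd_characteristic by force
    then have "(0, 2 :: 'a poly) \<noteq> 0" by (simp add: zero_prod_def)
    then show ?thesis using assms by (simp add: int_mult_eq_0_iff)
  qed
  have "fract_pair ((0, 2) \<odot> (f \<odot> f)) \<noteq> \<zero>\<^bsub>K \<alpha>\<^esub>"
    unfolding fract_pair_0[symmetric] fract_pair_eq_iff by (rule nz)
  then have "fract_pair ((0, 2) \<odot> (f \<odot> f)) \<otimes>\<^bsub>K \<alpha>\<^esub> twist_inverse (fract_pair f) = \<one>\<^bsub>K \<alpha>\<^esub>"
    unfolding twist_inverse_def two fract_pair_square fract_pair_mult
    by (intro KF.Units_r_inv) (simp add: KF.field_Units)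
  then have "emb ((0, 2) \<odot> (f \<odot> f)) \<star> K_to_Kinf (twist_inverse (fract_pair f)) = (1, 0)"
    using K_to_Kinf_mult[of \<alpha> "fract_pair ((0, 2) \<odot> (f \<odot> f))" "twist_inverse (fract_pair f)"]
    unfolding K_to_Kinf_fract_pair fract_pair_1[symmetric] by (simp add: K_to_Kinf_fract_pair) (simp add: emb_def)
  then have inv: "(0, 2) \<star> emb (f \<odot> f) \<star> K_to_Kinf (twist_inverse (fract_pair f)) = (1, 0)"
    by (simp only: emb_mult[of "(0, 2)"] emb_two_sqrt)
  have "emb (f \<odot> f) \<star> frequency (fract_pair f) (fract_pair r) =
      ((0, 2) \<star> emb (f \<odot> f) \<star> K_to_Kinf (twist_inverse (fract_pair f))) \<star> emb r"
    unfolding frequency_def K_to_Kinf_fract_pair by (simp only: qmul_ac)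
  then show ?thesis unfolding inv by simp
qed

text \<open>
  Division by \<open>2 * sqrt \<alpha>\<close> followed by the trace extracts the coefficient of \<open>sqrt \<alpha>\<close>. Hence the phase
  of \<open>g\<close> is \<open>g1 * y2 + g2 * y1\<close> for \<open>y = r / f\<^sup>2\<close>, a pairing of polynomials with Laurent series that
  does not involve \<open>\<alpha>\<close>.
\<close>

lemma trace_frequency:
  "k_to_kinf (quad_trace ((fract_pair g \<otimes>\<^bsub>K \<alpha>\<^esub> r) \<otimes>\<^bsub>K \<alpha>\<^esub> twist_inverse f)) = snd (emb g \<star> frequency f r)"
proof -
  let ?X = "(fract_pair g \<otimes>\<^bsub>K \<alpha>\<^esub> r) \<otimes>\<^bsub>K \<alpha>\<^esub> twist_inverse f"
  have "k_to_kinf (quad_trace ?X) = k_to_kinf (fst ?X + fst ?X)"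
    by (simp add: quad_trace_def)
  also have "\<dots> = snd ((0, 2) \<star> K_to_Kinf ?X)"
    unfolding k_to_kinf_add by (simp add: qmul_def K_to_Kinf_def)
  also have "(0, 2) \<star> K_to_Kinf ?X = emb g \<star> frequency f r"
    unfolding K_to_Kinf_mult K_to_Kinf_fract_pair frequency_def by (simp only: qmul_ac)
  finally show ?thesis .
qed

lemma reduced_residues_distinct:
  assumes R: "reduced_residues_mod_square (K_integers \<alpha>) (fract_pair f) S"
    and "fract_pair r \<in> S" "fract_pair r' \<in> S" and eq: "r - r' = k \<odot> (f \<odot> f)"
  shows "r = r'"
proof -
  let ?I = "PIdl\<^bsub>K_integers \<alpha>\<^esub> (fract_pair f [^]\<^bsub>K_integers \<alpha>\<^esub> (2::nat))"
  have I: "?I = range (\<lambda>x. fract_pair (x \<odot> (f \<odot> f)))"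
  proof -
    have "?I = range (\<lambda>x. fract_pair x \<otimes>\<^bsub>K \<alpha>\<^esub> fract_pair (f \<odot> f))"
      unfolding fract_pair_square cgenideal_def carrier_K_integers K_integers_ops by blast
    then show ?thesis by (simp only: fract_pair_mult)
  qed
  have sub: "?I +>\<^bsub>K_integers \<alpha>\<^esub> fract_pair r \<subseteq> ?I +>\<^bsub>K_integers \<alpha>\<^esub> fract_pair r'"
    if "r - r' = k \<odot> (f \<odot> f)" for r r' k
  proof -
    have "fract_pair (x \<odot> (f \<odot> f) + r) = fract_pair ((x + k) \<odot> (f \<odot> f) + r')" for x
      using that by (simp add: qmul_add_left algebra_simps)
    then show ?thesis
      unfolding a_r_coset_def' I by (auto simp: K_integers_ops fract_pair_add)
  qed
  have "r' - r = (0 - k) \<odot> (f \<odot> f)"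
    unfolding qmul_diff_left eq[symmetric] by simp
  with sub[OF eq] sub
  have "?I +>\<^bsub>K_integers \<alpha>\<^esub> fract_pair r = ?I +>\<^bsub>K_integers \<alpha>\<^esub> fract_pair r'" by blast
  then have "fract_pair r = fract_pair r'"
    using R assms(2,3) unfolding reduced_residues_mod_square_def bij_betw_def inj_on_def by blast
  then show ?thesis by simp
qed

text \<open>
  Squaring the relation \<open>a * r + b * f = 1\<close> gives an inverse of \<open>r\<close> modulo \<open>f\<^sup>2\<close>.
\<close>

lemma reduced_residue_bezout:
  assumes "reduced_residues_mod_square (K_integers \<alpha>) (fract_pair f) S" and "fract_pair r \<in> S"
  shows "\<exists>s t. s \<odot> r + t \<odot> (f \<odot> f) = (1, 0)"
proof -
  have "comaximal (K_integers \<alpha>) (fract_pair r) (fract_pair f)"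
    using assms by (auto simp: reduced_residues_mod_square_def)
  moreover have "\<one>\<^bsub>K_integers \<alpha>\<^esub> \<in> carrier (K_integers \<alpha>)"
    unfolding carrier_K_integers K_integers_ops fract_pair_1[symmetric] by simp
  ultimately obtain a' b' where a': "a' \<in> range fract_pair" and b': "b' \<in> range fract_pair"
    and 1: "(a' \<otimes>\<^bsub>K \<alpha>\<^esub> fract_pair r) \<oplus>\<^bsub>K \<alpha>\<^esub> (b' \<otimes>\<^bsub>K \<alpha>\<^esub> fract_pair f) = \<one>\<^bsub>K \<alpha>\<^esub>"
    using comaximal_bezout[of "K_integers \<alpha>" "fract_pair r" "fract_pair f"]
    unfolding carrier_K_integers K_integers_ops by blast
  obtain a b where "a' = fract_pair a" "b' = fract_pair b" using a' b' by blast
  with 1 have "fract_pair (a \<odot> r + b \<odot> f) = fract_pair (1, 0)"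
    by (simp only: fract_pair_mult fract_pair_add fract_pair_1)
  then have 1: "a \<odot> r + b \<odot> f = (1, 0)" by simp
  \<comment> \<open>Stated with sums only, as the pairs have no numeral \<open>2\<close>.\<close>
  have "(a \<odot> (a \<odot> r) + (b \<odot> (a \<odot> f) + b \<odot> (a \<odot> f))) \<odot> r + (b \<odot> b) \<odot> (f \<odot> f) =
      (a \<odot> r + b \<odot> f) \<odot> (a \<odot> r + b \<odot> f)"
    by (simp add: qmul_distribs qmul_ac add_ac)
  also have "\<dots> = (1, 0)" unfolding 1 by simp
  finally show ?thesis by blast
qed

text \<open>
  Two frequencies that agree in the first few coefficients of their fractional parts are close modulo
  integers. The numbers \<open>n1\<close> and \<open>n2\<close> are interchanged in the coordinates because \<open>g1\<close> pairs with \<open>y2\<close>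
  and \<open>g2\<close> with \<open>y1\<close>. The first coordinate of the difference is controlled less well, since \<open>g2\<close> has fewer
  coefficients, while the second one has the weight \<open>q ^ degree \<alpha>\<close> in the norm; each of the two effects
  costs the factor \<open>q ^ degree \<alpha>\<close>.
\<close>

lemma frequencies_close:
  fixes y x :: "'a fls \<times> 'a fls"
  assumes n1: "N \<le> 2 * n1 + 2" and n2: "N \<le> 2 * n2 + 2 + degree \<alpha>"
    and eq1: "\<And>i. i < n1 \<Longrightarrow> fls_nth (snd y) (1 + int i) = fls_nth (snd x) (1 + int i)"
    and eq2: "\<And>i. i < n2 \<Longrightarrow> fls_nth (fst y) (1 + int i) = fls_nth (fst x) (1 + int i)"
  shows "\<exists>w \<epsilon>. y = x + emb w + \<epsilon> \<and> size_inf \<epsilon> * real CARD('a) ^ N \<le> real CARD('a) ^ degree \<alpha>"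
proof -
  have part: "\<exists>w. abs_kinf (h - g - poly_to_kinf w) ^ 2 * real CARD('a) ^ (2 * n + 2) \<le> 1"
    if "\<And>i. i < n \<Longrightarrow> fls_nth h (1 + int i) = fls_nth g (1 + int i)" for h g :: "'a fls" and n
  proof -
    obtain w where w: "\<And>i. i \<le> 0 \<Longrightarrow> fls_nth (h - g - poly_to_kinf w) i = 0"
      using ex_polynomial_part[of "h - g"] by blast
    have "fls_nth (h - g - poly_to_kinf w) i = 0" if "i \<le> int n" for i
    proof (cases "i \<le> 0")
      case False
      define j where "j = nat (i - 1)"
      have j: "i = 1 + int j" using False by (simp add: j_def)
      then show ?thesis using that \<open>\<And>i. i < n \<Longrightarrow> fls_nth h (1 + int i) = fls_nth g (1 + int i)\<close>[of j]
        by (simp add: fls_nth_poly_to_kinf)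
    qed (use w in auto)
    then show ?thesis using abs_kinf_le_of_nth_eq_0 by blast
  qed
  obtain w1 where w1: "abs_kinf (fst y - fst x - poly_to_kinf w1) ^ 2 * real CARD('a) ^ (2 * n2 + 2) \<le> 1"
    using part[OF eq2] by blast
  obtain w2 where w2: "abs_kinf (snd y - snd x - poly_to_kinf w2) ^ 2 * real CARD('a) ^ (2 * n1 + 2) \<le> 1"
    using part[OF eq1] by blast
  define e1 where "e1 = fst y - fst x - poly_to_kinf w1"
  define e2 where "e2 = snd y - snd x - poly_to_kinf w2"
  have scale: "e ^ 2 * real CARD('a) ^ N \<le> real CARD('a) ^ k"
    if "e ^ 2 * real CARD('a) ^ m \<le> 1" "N \<le> m + k" for e :: real and m k
  proof -
    have "e ^ 2 * real CARD('a) ^ N \<le> e ^ 2 * real CARD('a) ^ (m + k)"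
      using that one_less_card by (intro mult_left_mono power_increasing) auto
    also have "\<dots> = (e ^ 2 * real CARD('a) ^ m) * real CARD('a) ^ k" by (simp add: power_add)
    also have "\<dots> \<le> 1 * real CARD('a) ^ k" by (intro mult_right_mono that) simp
    finally show ?thesis by simp
  qed
  have b1: "abs_kinf e1 ^ 2 * real CARD('a) ^ N \<le> real CARD('a) ^ degree \<alpha>"
    by (rule scale[OF w1[folded e1_def]]) (use n2 in simp)
  have "abs_kinf e2 ^ 2 * real CARD('a) ^ N \<le> real CARD('a) ^ 0"
    by (rule scale[OF w2[folded e2_def]]) (use n1 in simp)
  then have b2: "abs_kinf e2 ^ 2 * real CARD('a) ^ N * real CARD('a) ^ degree \<alpha> \<le> 1 * real CARD('a) ^ degree \<alpha>"
    by (intro mult_right_mono) auto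
  have "size_inf (e1, e2) * real CARD('a) ^ N \<le> real CARD('a) ^ degree \<alpha>"
    unfolding size_inf_max using b1 b2 by (auto simp: max_def mult_ac)
  moreover have "y = x + emb (w1, w2) + (e1, e2)"
    by (simp add: e1_def e2_def emb_def prod_eq_iff)
  ultimately show ?thesis by blast
qed

text \<open>
  The exponent \<open>1 / 6\<close> is chosen so that the cube of the divisor bound, for degrees up to \<open>2 * Q\<close>, is of
  order \<open>2 ^ Q\<close>.
\<close>

lemma card_norm_dvd_bound:
  assumes C0: "C0 > 0" and T: "\<And>M :: 'a poly. M \<noteq> 0 \<Longrightarrow> real (card {d. d dvd M}) \<le> C0 * 2 powr (1 / 6 * degree M)"
    and M: "M \<noteq> 0" "degree M \<le> 2 * Q"
  shows "real (card {u. qnorm \<alpha> u dvd M}) \<le> real CARD('a) ^ 2 * C0 ^ 3 * 2 ^ Q"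
proof -
  have "real (card {u. qnorm \<alpha> u dvd M}) \<le> real (CARD('a) ^ 2 * card {d. d dvd M} ^ 3)"
    using card_norm_dvd_le[OF M(1)] by (simp only: of_nat_le_iff)
  also have "\<dots> = real CARD('a) ^ 2 * real (card {d. d dvd M}) ^ 3" by simp
  also have "\<dots> \<le> real CARD('a) ^ 2 * (C0 * 2 powr (1 / 6 * degree M)) ^ 3"
    using T[OF M(1)] by (intro mult_left_mono power_mono) auto
  also have "(C0 * 2 powr (1 / 6 * degree M)) ^ 3 = C0 ^ 3 * 2 powr (degree M / 2)"
    by (simp add: power_mult_distrib power3_eq_cube powr_add[symmetric])
  also have "real CARD('a) ^ 2 * (C0 ^ 3 * 2 powr (degree M / 2)) \<le> real CARD('a) ^ 2 * (C0 ^ 3 * 2 powr Q)"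
    using C0 M(2) by (intro mult_left_mono powr_mono) auto
  finally show ?thesis by (simp add: powr_realpow)
qed

end

section \<open>The large sieve inequality for square moduli\<close>

text \<open>
  The final arithmetic: \<open>M\<close> is the number of moduli and \<open>W\<close> the number of fractions close to a given one.
  For \<open>N \<le> 2 * Q\<close> the trivial bound on \<open>M\<close> gives the term \<open>q ^ (3 * Q)\<close>. For larger \<open>N\<close> each modulus
  has boundedly many numerators, and the bound on \<open>M\<^sup>2\<close> gives the other two terms; the divisor factor
  \<open>2 ^ Q\<close> is absorbed because then \<open>2 powr (Q / 2) \<le> 2 powr ((N - Q) / 2)\<close>.
\<close>

lemma sieve_constant_bound:
  fixes q M W C0 :: real and Q N d :: nat
  assumes q: "q \<ge> 1" and C0: "C0 > 0" and M0: "M \<ge> 0"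
    and W: "W \<le> M * q ^ (2 * Q + d - N + 2)" and M: "M \<le> q ^ (Q + 2)"
    and M2: "M ^ 2 \<le> 2 * q ^ (Q + 2) + q ^ (4 * Q + d - N + 4) * (q ^ 2 * C0 ^ 3 * 2 ^ Q)"
  shows "W * q ^ (N + 2) \<le> (q ^ (d + 6) + 2 * q ^ (d + 4) * sqrt (2 * q ^ 2 + q ^ (d + 6) * C0 ^ 3)) *
    (q ^ (3 * Q) + 2 powr ((real N - real Q) / 2) *
      (q powr (real Q / 2 + real N) + q powr (2 * real Q + real N / 2)))"
proof -
  define L where "L = 2 powr ((real N - real Q) / 2)"
  define X where "X = q powr (real Q / 2 + real N)"
  define Y where "Y = q powr (2 * real Q + real N / 2)"
  define C1 where "C1 = sqrt (2 * q ^ 2 + q ^ (d + 6) * C0 ^ 3)"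
  have qp: "q > 0" using q by simp
  have pos: "L > 0" "X > 0" "Y > 0" "C1 > 0" "q ^ i > 0" for i
    using qp C0 by (simp_all add: L_def X_def Y_def C1_def add_pos_pos)
  have cross: "u * v \<le> (u + u') * (v + v')" "u' * v' \<le> (u + u') * (v + v')"
    if "u \<ge> 0" "u' \<ge> 0" "v \<ge> 0" "v' \<ge> 0" for u u' v v' :: real
    using that by (auto intro!: mult_mono)
  show ?thesis
  proof (cases "N \<le> 2 * Q")
    case True
    have "W * q ^ (N + 2) \<le> M * q ^ (2 * Q + d - N + 2) * q ^ (N + 2)"
      using W qp by (intro mult_right_mono) auto
    also have "\<dots> \<le> q ^ (Q + 2) * q ^ (2 * Q + d - N + 2) * q ^ (N + 2)"
      using M qp by (intro mult_right_mono) auto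
    also have "\<dots> = q ^ (d + 6) * q ^ (3 * Q)"
    proof -
      have "Q + 2 + (2 * Q + d - N + 2) + (N + 2) = d + 6 + 3 * Q" using True by simp
      then show ?thesis by (simp only: power_add[symmetric])
    qed
    also have "\<dots> \<le> (q ^ (d + 6) + 2 * q ^ (d + 4) * C1) * (q ^ (3 * Q) + L * (X + Y))"
      by (rule cross(1)) (use pos qp in \<open>simp_all add: less_imp_le\<close>)
    finally show ?thesis unfolding L_def X_def Y_def C1_def .
  next
    case False
    then have N: "2 * Q \<le> N" by simp
    \<comment> \<open>Square roots of the three quantities \<open>q ^ Q\<close>, \<open>2 ^ Q\<close> and \<open>q powr (4 * Q - N)\<close> in the bound for \<open>M\<^sup>2\<close>.\<close>
    define E where "E = q powr (real Q / 2)"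
    define F where "F = 2 powr (real Q / 2)"
    define H where "H = q powr (2 * real Q - real N / 2)"
    have pos': "E > 0" "F > 0" "H > 0" using qp by (simp_all add: E_def F_def H_def)
    have E2: "E ^ 2 = q ^ Q"
      using qp by (simp add: E_def power2_eq_square powr_add[symmetric] powr_realpow)
    have F2: "F ^ 2 = 2 ^ Q"
      by (simp add: F_def power2_eq_square powr_add[symmetric] powr_realpow)
    have H2: "q ^ (4 * Q + d - N) \<le> q ^ d * (H ^ 2 + 1)"
    proof (cases "N \<le> 4 * Q")
      case True
      have "H ^ 2 = q powr real (4 * Q - N)"
        using True by (simp add: H_def power2_eq_square powr_add[symmetric] of_nat_diff)
      also have "\<dots> = q ^ (4 * Q - N)" using qp by (rule powr_realpow)
      finally have "H ^ 2 = q ^ (4 * Q - N)" .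
      moreover have "4 * Q + d - N = d + (4 * Q - N)" using True by simp
      ultimately have "q ^ (4 * Q + d - N) = q ^ d * H ^ 2" by (simp only: power_add)
      then show ?thesis using pos(5)[of d] by (simp add: distrib_left)
    next
      case False
      then have "q ^ (4 * Q + d - N) \<le> q ^ d" using q by (intro power_increasing) auto
      moreover have "0 \<le> q ^ d * H ^ 2" using qp by simp
      ultimately show ?thesis by (simp add: distrib_left)
    qed
    have "M ^ 2 \<le> 2 * q ^ 2 * E ^ 2 + q ^ 6 * C0 ^ 3 * F ^ 2 * q ^ (4 * Q + d - N)"
      using M2 unfolding E2 F2 by (simp add: power_add algebra_simps power_numeral_reduce)
    also have "\<dots> \<le> 2 * q ^ 2 * E ^ 2 + q ^ 6 * C0 ^ 3 * F ^ 2 * (q ^ d * (H ^ 2 + 1))"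
      using H2 C0 qp by (intro add_left_mono mult_left_mono) auto
    also have "\<dots> = 2 * q ^ 2 * E ^ 2 + q ^ (d + 6) * C0 ^ 3 * ((F * H) ^ 2 + F ^ 2)"
      by (simp add: power_add power_mult_distrib algebra_simps)
    also have "\<dots> \<le> (2 * q ^ 2 + q ^ (d + 6) * C0 ^ 3) * (E ^ 2 + ((F * H) ^ 2 + F ^ 2))"
    proof -
      have "0 \<le> 2 * q ^ 2 * ((F * H) ^ 2 + F ^ 2)" "0 \<le> q ^ (d + 6) * C0 ^ 3 * E ^ 2"
        using qp C0 by simp_all
      then show ?thesis by (simp only: distrib_left distrib_right)
    qed
    also have "\<dots> \<le> (2 * q ^ 2 + q ^ (d + 6) * C0 ^ 3) * (E + F * H + F) ^ 2"
    proof -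
      have "0 \<le> E * (F * H)" "0 \<le> E * F" "0 \<le> (F * H) * F" using pos' by simp_all
      then have "E ^ 2 + ((F * H) ^ 2 + F ^ 2) \<le> (E + F * H + F) ^ 2"
        by (simp add: power2_eq_square algebra_simps)
      then show ?thesis using qp C0 by (intro mult_left_mono) auto
    qed
    also have "\<dots> = (C1 * (E + F * H + F)) ^ 2"
      using qp C0 by (simp add: C1_def power_mult_distrib)
    finally have MC: "M \<le> C1 * (E + F * H + F)"
      by (rule power2_le_imp_le) (use pos pos' in \<open>simp add: less_imp_le\<close>)
    have FL: "F \<le> L"
      unfolding F_def L_def using N by (intro powr_mono) (auto simp: field_simps)
    have L1: "1 \<le> L" unfolding L_def using N by (intro ge_one_powr_ge_zero) auto
    have qN: "q ^ N = q powr real N" using qp by (simp add: powr_realpow)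
    have EX: "q ^ N * E = X" unfolding qN E_def X_def by (simp add: powr_add[symmetric] add.commute)
    have HY: "q ^ N * H = Y" unfolding qN H_def Y_def by (simp add: powr_add[symmetric] algebra_simps)
    have NX: "q ^ N \<le> X" unfolding qN X_def using q by (intro powr_mono) auto
    have "q ^ N * (E + F * H + F) = X + F * Y + F * q ^ N"
      unfolding EX[symmetric] HY[symmetric] by (simp add: algebra_simps)
    also have "\<dots> \<le> L * X + L * Y + L * X"
      using FL L1 NX pos pos' qp by (intro add_mono mult_mono) auto
    also have "\<dots> \<le> 2 * (L * (X + Y))" using pos by (simp add: algebra_simps)
    finally have key: "q ^ N * (E + F * H + F) \<le> 2 * (L * (X + Y))" .
    have "W * q ^ (N + 2) \<le> M * q ^ (2 * Q + d - N + 2) * q ^ (N + 2)"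
      using W qp by (intro mult_right_mono) auto
    also have "\<dots> \<le> M * q ^ (d + 2) * q ^ (N + 2)"
      using M0 q N by (intro mult_right_mono mult_left_mono power_increasing) auto
    also have "\<dots> \<le> C1 * (E + F * H + F) * q ^ (d + 2) * q ^ (N + 2)"
      using MC qp by (intro mult_right_mono) auto
    also have "\<dots> = C1 * q ^ (d + 4) * (q ^ N * (E + F * H + F))"
      by (simp add: power_add power_numeral_reduce algebra_simps)
    also have "\<dots> \<le> C1 * q ^ (d + 4) * (2 * (L * (X + Y)))"
      using pos by (intro mult_left_mono key) (auto intro: less_imp_le)
    also have "\<dots> = (2 * q ^ (d + 4) * C1) * (L * (X + Y))" by simp
    also have "\<dots> \<le> (q ^ (d + 6) + 2 * q ^ (d + 4) * C1) * (q ^ (3 * Q) + L * (X + Y))"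
      by (rule cross(2)) (use pos qp in \<open>simp_all add: less_imp_le\<close>)
    finally show ?thesis unfolding L_def X_def Y_def C1_def .
  qed
qed

context imaginary_quadratic
begin

text \<open>
  The second side is \<open>0\<close> when \<open>N < degree \<alpha>\<close>, because then the ball contains no element with a
  nonzero second coordinate.
\<close>

lemma int_ball_subset_box:
  "int_ball N \<subseteq> polys_below (N div 2 + 1) \<times>
     polys_below (if degree \<alpha> \<le> N then (N - degree \<alpha>) div 2 + 1 else 0)"
proof
  fix u assume u: "u \<in> int_ball N"
  obtain a b where ab: "u = (a, b)" by fastforce
  have a: "a \<in> polys_below (N div 2 + 1)" using int_ball_subset u ab by blast
  have "b \<in> polys_below (if degree \<alpha> \<le> N then (N - degree \<alpha>) div 2 + 1 else 0)"
  proof (cases "b = 0")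
    case True
    then show ?thesis by (simp add: polys_below_def)
  next
    case False
    then have "2 * degree b + degree \<alpha> \<le> N"
      using qnorm_degree(3)[of a b] u ab by (simp add: int_ball_def)
    then have "degree \<alpha> \<le> N" "degree b < (N - degree \<alpha>) div 2 + 1" by linarith+
    then show ?thesis by (simp add: polys_below_degree)
  qed
  with a show "u \<in> polys_below (N div 2 + 1) \<times>
      polys_below (if degree \<alpha> \<le> N then (N - degree \<alpha>) div 2 + 1 else 0)"
    by (simp add: ab)
qed

text \<open>
  The coordinates of \<open>g\<close> form a vector of length at most \<open>N + 2\<close> over \<open>F\<^sub>q\<close>, and the phase pairs it
  with the leading coefficients of the fractional parts of \<open>r / f\<^sup>2\<close>. The multiplicity needed for the
  sieve is the number of fractions with the same coefficients as a given one, which are all close to it.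
\<close>

lemma large_sieve_square_moduli:
  fixes a :: "'a poly fract \<times> 'a poly fract \<Rightarrow> complex" and Q N :: nat and C0 :: real
    and R :: "'a poly fract \<times> 'a poly fract \<Rightarrow> ('a poly fract \<times> 'a poly fract) set"
  assumes \<psi>: "additive_character (char_Fq p n :: 'a \<Rightarrow> complex)"
    and C0: "C0 > 0"
    and T: "\<And>M :: 'a poly. M \<noteq> 0 \<Longrightarrow> real (card {d. d dvd M}) \<le> C0 * 2 powr (1 / 6 * degree M)"
    and R: "\<And>f. f \<in> carrier (K_integers \<alpha>) - {\<zero>\<^bsub>K \<alpha>\<^esub>} \<Longrightarrow>
      reduced_residues_mod_square (K_integers \<alpha>) f (R f)"
  defines "F \<equiv> {f \<in> carrier (K_integers \<alpha>) - {\<zero>\<^bsub>K \<alpha>\<^esub>}. norm_Kinf \<alpha> (K_to_Kinf f) = real CARD('a) ^ Q}"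
    and "G \<equiv> {g \<in> carrier (K_integers \<alpha>). K_to_Kinf g \<in> ball_Kinf \<alpha> \<zero>\<^bsub>Kinf \<alpha>\<^esub> (real N)}"
    and "B \<equiv> (real CARD('a) ^ (degree \<alpha> + 6) + 2 * real CARD('a) ^ (degree \<alpha> + 4) *
        sqrt (2 * real CARD('a) ^ 2 + real CARD('a) ^ (degree \<alpha> + 6) * C0 ^ 3)) *
      (real CARD('a) ^ (3 * Q) + 2 powr ((real N - real Q) / 2) *
        (real CARD('a) powr (real Q / 2 + real N) + real CARD('a) powr (2 * real Q + real N / 2)))"
  shows "(\<Sum>f\<in>F. \<Sum>r\<in>R f. (cmod (\<Sum>g\<in>G. a g * char_kinf p n (k_to_kinf (quad_trace
      ((g \<otimes>\<^bsub>K \<alpha>\<^esub> r) \<otimes>\<^bsub>K \<alpha>\<^esub> twist_inverse f))))) ^ 2) \<le> B * (\<Sum>g\<in>G. (cmod (a g)) ^ 2)"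
proof -
  interpret additive_character "char_Fq p n :: 'a \<Rightarrow> complex" by (rule \<psi>)
  let ?q = "real CARD('a)"
  have q1: "?q \<ge> 1" using one_less_card by simp
  have F: "F = fract_pair ` {u. u \<noteq> 0 \<and> degree (qnorm \<alpha> u) = Q}"
  proof -
    have "norm_Kinf \<alpha> (K_to_Kinf (fract_pair u)) = ?q ^ Q \<longleftrightarrow> degree (qnorm \<alpha> u) = Q" if "u \<noteq> 0" for u
      using that one_less_card by (simp add: K_to_Kinf_fract_pair norm_Kinf_eq size_inf_emb)
    then show ?thesis
      unfolding F_def carrier_K_integers fract_pair_0[symmetric] by auto
  qed
  have G: "G = fract_pair ` int_ball N"
    unfolding G_def carrier_K_integers by (auto simp: K_to_Kinf_fract_pair ball_Kinf_zero_iff simp del: quad_ext_simps)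
  have finF: "finite F"
    unfolding F by (intro finite_imageI finite_subset[OF _ finite_int_ball[of Q]]) (auto simp: int_ball_def)
  define n1 where "n1 = N div 2 + 1"
  define n2 where "n2 = (if degree \<alpha> \<le> N then (N - degree \<alpha>) div 2 + 1 else 0)"
  define I where "I = {..<n1} <+> {..<n2}"
  define un where "un = inv_into UNIV fract_pair"
  have un [simp]: "un (fract_pair u) = u" for u
    unfolding un_def by (rule inv_f_f) (simp add: inj_def)
  \<comment> \<open>The left part of \<open>I\<close> carries \<open>g1\<close> and \<open>y2\<close>, the right part \<open>g2\<close> and \<open>y1\<close>.\<close>
  define v where "v g = case_sum (coeff (fst (un g))) (coeff (snd (un g)))" for g
  define z where "z = (\<lambda>(f, r). case_sum (\<lambda>i. fls_nth (snd (frequency f r)) (1 + int i))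
      (\<lambda>i. fls_nth (fst (frequency f r)) (1 + int i)))"
  have box: "fst u \<in> polys_below n1" "snd u \<in> polys_below n2" if "u \<in> int_ball N" for u
    using int_ball_subset_box[of N] that unfolding n1_def n2_def by auto
  have char: "char_kinf p n (k_to_kinf (quad_trace ((g \<otimes>\<^bsub>K \<alpha>\<^esub> r) \<otimes>\<^bsub>K \<alpha>\<^esub> twist_inverse f))) =
      char_Fq p n (\<Sum>i\<in>I. v g i * z (f, r) i)" if g: "g \<in> G" for g f r
  proof -
    obtain u where u: "u \<in> int_ball N" "g = fract_pair u" using g unfolding G by blast
    have "fls_nth (snd (emb u \<star> frequency f r)) 1 =
        (\<Sum>i<n1. coeff (fst u) i * fls_nth (snd (frequency f r)) (1 + int i)) +
        (\<Sum>i<n2. coeff (snd u) i * fls_nth (fst (frequency f r)) (1 + int i))"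
      using fls_nth_poly_mult[OF box(1)[OF u(1)]] fls_nth_poly_mult[OF box(2)[OF u(1)]]
      by (simp add: qmul_def emb_def)
    also have "\<dots> = (\<Sum>i\<in>I. v g i * z (f, r) i)"
      unfolding I_def by (subst sum.Plus) (simp_all add: v_def z_def u(2))
    finally show ?thesis unfolding u(2) trace_frequency char_kinf_def by simp
  qed
  have B0: "B \<ge> 0"
    unfolding B_def using C0 by (intro mult_nonneg_nonneg add_nonneg_nonneg) auto
  have inj: "\<exists>i\<in>I. v g i \<noteq> v g' i" if g: "g \<in> G" "g' \<in> G" "g \<noteq> g'" for g g'
  proof (rule ccontr)
    assume same: "\<not> (\<exists>i\<in>I. v g i \<noteq> v g' i)"
    obtain u u' where u: "u \<in> int_ball N" "g = fract_pair u" "u' \<in> int_ball N" "g' = fract_pair u'"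
      using g unfolding G by blast
    have "coeff (fst u) i = coeff (fst u') i" for i
    proof (cases "i < n1")
      case True
      then have "v g (Inl i) = v g' (Inl i)" using same by (auto simp: I_def)
      then show ?thesis by (simp add: v_def u)
    next
      case False
      then show ?thesis using box(1)[OF u(1)] box(1)[OF u(3)] by (simp add: polys_below_def)
    qed
    moreover have "coeff (snd u) i = coeff (snd u') i" for i
    proof (cases "i < n2")
      case True
      then have "v g (Inr i) = v g' (Inr i)" using same by (auto simp: I_def)
      then show ?thesis by (simp add: v_def u)
    next
      case False
      then show ?thesis using box(2)[OF u(1)] box(2)[OF u(3)] by (simp add: polys_below_def)
    qed
    ultimately have "u = u'" by (simp add: prod_eq_iff poly_eq_iff)
    with g(3) u show False by simp
  qed
  have fibre: "finite {j \<in> Sigma F R. \<forall>i\<in>I. z j i = z j0 i} \<and>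
      real (card {j \<in> Sigma F R. \<forall>i\<in>I. z j i = z j0 i}) \<le> B / ?q ^ (N + 2)"
    if j0: "j0 \<in> Sigma F R" for j0
  proof -
    define S where "S = {j \<in> Sigma F R. \<forall>i\<in>I. z j i = z j0 i}"
    have red: "reduced_residues_mod_square (K_integers \<alpha>) f (R f)" if "f \<in> F" for f
      using R[of f] that by (simp add: F_def)
    have in_range: "\<exists>f r. f \<noteq> 0 \<and> degree (qnorm \<alpha> f) = Q \<and> j = (fract_pair f, fract_pair r)"
      if in_J: "j \<in> Sigma F R" for j
    proof -
      obtain f' r' where j: "j = (f', r')" "f' \<in> F" "r' \<in> R f'" using in_J by blast
      then have "r' \<in> range fract_pair"
        using red[of f'] unfolding reduced_residues_mod_square_def carrier_K_integers by blast
      with j show ?thesis unfolding F by blast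
    qed
    obtain f0 r0 where f0: "f0 \<noteq> 0" "degree (qnorm \<alpha> f0) = Q" "j0 = (fract_pair f0, fract_pair r0)"
      using in_range[OF j0] by blast
    have j0': "fract_pair f0 \<in> F" "fract_pair r0 \<in> R (fract_pair f0)" using j0 f0(3) by auto
    obtain s t where st: "s \<odot> r0 + t \<odot> (f0 \<odot> f0) = (1, 0)"
      using reduced_residue_bezout[OF red[OF j0'(1)] j0'(2)] by blast
    \<comment> \<open>The fibre over \<open>z j0\<close>, in terms of polynomials.\<close>
    define W where "W = {(f, r). (fract_pair f, fract_pair r) \<in> S}"
    have W_F: "fract_pair f \<in> F" "fract_pair r \<in> R (fract_pair f)" if "(f, r) \<in> W" for f r
      using that by (auto simp: W_def S_def)
    have W_norm: "f \<noteq> 0 \<and> degree (qnorm \<alpha> f) = Q" if "(f, r) \<in> W" for f r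
      using W_F(1)[OF that] unfolding F by auto
    interpret close_fractions \<alpha> Q N f0 r0 s t "frequency (fract_pair f0) (fract_pair r0)" W
      "?q ^ 2 * C0 ^ 3 * 2 ^ Q"
    proof
      show "f0 \<noteq> 0" "degree (qnorm \<alpha> f0) = Q" "s \<odot> r0 + t \<odot> (f0 \<odot> f0) = (1, 0)"
        using f0 st by auto
      show "emb (f0 \<odot> f0) \<star> frequency (fract_pair f0) (fract_pair r0) = emb r0"
        by (rule frequency_eq[OF f0(1)])
      fix f r assume fr: "(f, r) \<in> W"
      show "f \<noteq> 0 \<and> degree (qnorm \<alpha> f) = Q" by (rule W_norm[OF fr])
      show "r = r'" if "(f, r') \<in> W" "r - r' = k \<odot> (f \<odot> f)" for r' k
        using reduced_residues_distinct[OF red[OF W_F(1)[OF fr]] W_F(2)[OF fr] W_F(2)[OF that(1)] that(2)] .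
      let ?y = "frequency (fract_pair f) (fract_pair r)"
      let ?x = "frequency (fract_pair f0) (fract_pair r0)"
      have same: "z (fract_pair f, fract_pair r) i = z (fract_pair f0, fract_pair r0) i" if "i \<in> I" for i
        using fr that by (simp add: W_def S_def f0(3))
      have "\<exists>w \<epsilon>. ?y = ?x + emb w + \<epsilon> \<and> size_inf \<epsilon> * ?q ^ N \<le> ?q ^ degree \<alpha>"
      proof (rule frequencies_close[of N n1 n2])
        show "N \<le> 2 * n1 + 2" "N \<le> 2 * n2 + 2 + degree \<alpha>" by (auto simp: n1_def n2_def)
        show "fls_nth (snd ?y) (1 + int i) = fls_nth (snd ?x) (1 + int i)" if "i < n1" for i
          using same[of "Inl i"] that by (auto simp: I_def z_def)
        show "fls_nth (fst ?y) (1 + int i) = fls_nth (fst ?x) (1 + int i)" if "i < n2" for i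
          using same[of "Inr i"] that by (auto simp: I_def z_def)
      qed
      moreover have "emb (f \<odot> f) \<star> ?y = emb r" using W_norm[OF fr] frequency_eq by blast
      ultimately show "\<exists>y w \<epsilon>. emb (f \<odot> f) \<star> y = emb r \<and> y = ?x + emb w + \<epsilon> \<and>
          size_inf \<epsilon> * ?q ^ N \<le> ?q ^ degree \<alpha>" by blast
    next
      fix M :: "'a poly" assume "M \<noteq> 0" "degree M \<le> 2 * Q"
      then show "real (card {u. qnorm \<alpha> u dvd M}) \<le> ?q ^ 2 * C0 ^ 3 * 2 ^ Q"
        by (intro card_norm_dvd_bound C0 T)
    qed
    have S: "S = map_prod fract_pair fract_pair ` W"
    proof
      show "S \<subseteq> map_prod fract_pair fract_pair ` W"
      proof
        fix j assume j: "j \<in> S"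
        then obtain f r where "j = (fract_pair f, fract_pair r)" using in_range[of j] by (auto simp: S_def)
        with j show "j \<in> map_prod fract_pair fract_pair ` W"
          by (intro image_eqI[of _ _ "(f, r)"]) (auto simp: W_def)
      qed
    qed (auto simp: W_def)
    have "card S \<le> card W" unfolding S by (rule card_image_le[OF finite_W_card_le(1)])
    then have cS: "real (card S) * ?q ^ (N + 2) \<le> real (card W) * ?q ^ (N + 2)"
      by (intro mult_right_mono) auto
    have "card moduli \<le> card (int_ball Q)" by (rule card_mono[OF finite_int_ball moduli_subset])
    then have cm: "real (card moduli) \<le> ?q ^ (Q + 2)" using card_int_ball_le[of Q] by linarith
    have "real (card W) * ?q ^ (N + 2) \<le> B"
      unfolding B_def
      by (rule sieve_constant_bound[OF q1 C0 _ finite_W_card_le(2) cm card_moduli_square_le]) simp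
    with cS have "real (card S) * ?q ^ (N + 2) \<le> B" by linarith
    then have "real (card S) \<le> B / ?q ^ (N + 2)" by (subst pos_le_divide_eq) auto
    moreover have "finite S" unfolding S by (rule finite_imageI[OF finite_W_card_le(1)])
    ultimately show ?thesis unfolding S_def by blast
  qed
  have finI: "finite I" by (simp add: I_def)
  have finG: "finite G" unfolding G by (intro finite_imageI finite_int_ball)
  have B': "B / ?q ^ (N + 2) \<ge> 0" using B0 by simp
  have "finite (Sigma F R)"
    by (rule large_sieve_fibres(1)[OF finI finG _ _ B', where v = v and y = z]) (erule (2) inj, erule fibre)
  have finR: "finite (R f)" if "f \<in> F" for f
  proof -
    have "R f = snd ` (Sigma F R \<inter> {f} \<times> UNIV)" using that by force
    then show ?thesis using \<open>finite (Sigma F R)\<close> by (metis finite_Int finite_imageI)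
  qed
  have "(\<Sum>f\<in>F. \<Sum>r\<in>R f. (cmod (\<Sum>g\<in>G. a g * char_kinf p n (k_to_kinf (quad_trace
      ((g \<otimes>\<^bsub>K \<alpha>\<^esub> r) \<otimes>\<^bsub>K \<alpha>\<^esub> twist_inverse f))))) ^ 2) =
      (\<Sum>f\<in>F. \<Sum>r\<in>R f. (cmod (\<Sum>g\<in>G. a g * char_Fq p n (\<Sum>i\<in>I. v g i * z (f, r) i))) ^ 2)"
    by (simp only: char cong: sum.cong)
  also have "\<dots> = (\<Sum>j\<in>Sigma F R. (cmod (\<Sum>g\<in>G. a g * char_Fq p n (\<Sum>i\<in>I. v g i * z j i))) ^ 2)"
    by (subst sum.Sigma) (use finF finR in \<open>auto simp: case_prod_beta\<close>)
  also have "\<dots> \<le> B / ?q ^ (N + 2) * real (CARD('a) ^ card I) * (\<Sum>g\<in>G. (cmod (a g)) ^ 2)"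
    by (rule large_sieve_fibres(2)[OF finI finG _ _ B']) (erule (2) inj, erule fibre)
  also have "\<dots> \<le> B / ?q ^ (N + 2) * ?q ^ (N + 2) * (\<Sum>g\<in>G. (cmod (a g)) ^ 2)"
  proof -
    have "card I \<le> N + 2" by (auto simp: I_def card_Plus n1_def n2_def)
    then have "real (CARD('a) ^ card I) \<le> ?q ^ (N + 2)"
      using q1 by (simp add: power_increasing del: power_Suc)
    then show ?thesis using B' by (intro mult_right_mono mult_left_mono sum_nonneg) auto
  qed
  also have "\<dots> = B * (\<Sum>g\<in>G. (cmod (a g)) ^ 2)" by simp
  finally show ?thesis .
qed

end

theorem theorem3p2:
  fixes p n d :: nat
  assumes "prime p" and "p > 2" and "CARD('a::finite_field) = p ^ n"
  shows "\<exists>C>0. \<forall>(\<alpha> :: 'a poly) (Q :: nat) (N :: nat)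
      (a :: 'a poly fract \<times> 'a poly fract \<Rightarrow> complex)
      (R :: 'a poly fract \<times> 'a poly fract \<Rightarrow> ('a poly fract \<times> 'a poly fract) set).
    squarefree \<alpha> \<longrightarrow> degree \<alpha> = d \<longrightarrow>
    odd (degree \<alpha>) \<or> (\<nexists>c. lead_coeff \<alpha> = c ^ 2) \<longrightarrow>
    (\<forall>f \<in> carrier (K_integers \<alpha>) - {\<zero>\<^bsub>K \<alpha>\<^esub>}.
        reduced_residues_mod_square (K_integers \<alpha>) f (R f)) \<longrightarrow>
    (\<Sum>f \<in> {f \<in> carrier (K_integers \<alpha>) - {\<zero>\<^bsub>K \<alpha>\<^esub>}.
              norm_Kinf \<alpha> (K_to_Kinf f) = real CARD('a) ^ Q}.
       \<Sum>r \<in> R f.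
         (cmod (\<Sum>g \<in> {g \<in> carrier (K_integers \<alpha>).
                         K_to_Kinf g \<in> ball_Kinf \<alpha> \<zero>\<^bsub>Kinf \<alpha>\<^esub> (real N)}.
            a g * char_kinf p n (k_to_kinf (quad_trace
              ((g \<otimes>\<^bsub>K \<alpha>\<^esub> r) \<otimes>\<^bsub>K \<alpha>\<^esub>
               inv\<^bsub>K \<alpha>\<^esub> (([(2::nat)] \<cdot>\<^bsub>K \<alpha>\<^esub> quad_sqrt) \<otimes>\<^bsub>K \<alpha>\<^esub> (f [^]\<^bsub>K \<alpha>\<^esub> (2::nat)))))))) ^ 2)
    \<le> C * ((real CARD('a) ^ (3 * Q)
            + 2 powr ((real N - real Q) / 2)
              * (real CARD('a) powr (real Q / 2 + real N)
                 + real CARD('a) powr (2 * real Q + real N / 2)))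
           * (\<Sum>g \<in> {g \<in> carrier (K_integers \<alpha>).
                     K_to_Kinf g \<in> ball_Kinf \<alpha> \<zero>\<^bsub>Kinf \<alpha>\<^esub> (real N)}.
                (cmod (a g)) ^ 2))"
proof -
  obtain C0 :: real where C0: "C0 > 0"
    and T: "\<And>M :: 'a poly. M \<noteq> 0 \<Longrightarrow> real (card {d. d dvd M}) \<le> C0 * 2 powr (1 / 6 * degree M)"
    using card_divisors_le[of "1 / 6", where 'a = 'a] by auto
  define C where "C = real CARD('a) ^ (d + 6) + 2 * real CARD('a) ^ (d + 4) *
    sqrt (2 * real CARD('a) ^ 2 + real CARD('a) ^ (d + 6) * C0 ^ 3)"
  have \<psi>: "additive_character (char_Fq p n :: 'a \<Rightarrow> complex)"
    by (rule additive_character_char_Fq[OF assms(1,3)])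
  have "\<not> CHAR('a) dvd 2"
    using CHAR_eq[OF assms(1,3)] assms(2) by (auto dest: dvd_imp_le)
  then have two: "(2 :: 'a) \<noteq> 0" by (metis of_nat_eq_0_iff_char_dvd of_nat_numeral)
  show ?thesis
  proof (intro exI[of _ C] conjI allI impI, goal_cases)
    case 1
    show ?case unfolding C_def using C0 by (intro add_pos_nonneg) auto
  next
    case (2 \<alpha> Q N a R)
    interpret imaginary_quadratic \<alpha> by standard (use 2 two in auto)
    show ?case
      using large_sieve_square_moduli[OF \<psi> C0, where R = R and Q = Q and N = N and a = a] T 2
      unfolding twist_inverse_def C_def by (simp add: mult.assoc)
  qed
qed

end
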